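(* Let $\psi:\mathbb{R}\to\mathbb{R}$ be a strictly increasing function (not necessarily continuous) and let $F=\{(x,\psi(x)):x\in\mathbb{R}\}\subset\mathbb{R}^2$ be its graph. Then every compact set $K\subset\Phi(F)\subset\mathbb{T}^2$ satisfies $|\nu|(K)=0$ for every $\nu\in RP(\mathbb{T}^2)$. In particular, no non-zero RP-measure on $\mathbb{T}^2$ has support contained in $\Phi(F)$.
   Context: $\Phi:\mathbb{R}^2\to\mathbb{T}^2$, $\Phi(x_1,x_2)=(e^{ix_1},e^{ix_2})$. $RP(\mathbb{T}^2)$ is the set of real Borel measures $\mu$ of bounded variation on $\mathbb{T}^2$ whose Poisson integral $P[d\mu](z)=\int_{\mathbb{T}^2}\prod_{j=1}^2\frac{1-|z_j|^2}{|\zeta_j-z_j|^2}\,d\mu(\zeta)$ is the real part of a holomorphic function on $\mathbb{D}^2$ (RP-measures). *)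

theory Defs
  imports "HOL-Analysis.Analysis"
begin

definition Phi :: "real \<times> real \<Rightarrow> complex \<times> complex" where
  "Phi x = (cis (fst x), cis (snd x))"

definition torus2 :: "(complex \<times> complex) set" where
  "torus2 = {z. cmod (fst z) = 1 \<and> cmod (snd z) = 1}"

definition disc2 :: "(complex \<times> complex) set" where
  "disc2 = {z. cmod (fst z) < 1 \<and> cmod (snd z) < 1}"

definition poisson2 :: "complex \<times> complex \<Rightarrow> complex \<times> complex \<Rightarrow> real" where
  "poisson2 z \<zeta> =
     ((1 - (cmod (fst z))\<^sup>2) / (cmod (fst \<zeta> - fst z))\<^sup>2) *
     ((1 - (cmod (snd z))\<^sup>2) / (cmod (snd \<zeta> - snd z))\<^sup>2)"

text \<open>Holomorphy in two complex variables: complex (Frechet) differentiability,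
  i.e. the real derivative is complex linear.\<close>
definition holomorphic2_on :: "(complex \<times> complex \<Rightarrow> complex) \<Rightarrow> (complex \<times> complex) set \<Rightarrow> bool" where
  "holomorphic2_on f S \<longleftrightarrow>
     (\<forall>z\<in>S. \<exists>a b. (f has_derivative (\<lambda>h. a * fst h + b * snd h)) (at z))"

text \<open>A real Borel measure of bounded variation on T^2 is represented by its Jordan
  decomposition (Mp, Mn): two finite positive Borel measures concentrated on T^2
  and mutually singular; nu = Mp - Mn and |nu| = Mp + Mn.\<close>
definition real_measure_T2 :: "(complex \<times> complex) measure \<Rightarrow> (complex \<times> complex) measure \<Rightarrow> bool" where
  "real_measure_T2 Mp Mn \<longleftrightarrow>
     sets Mp = sets borel \<and> sets Mn = sets borel \<and>
     finite_measure Mp \<and> finite_measure Mn \<and>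
     emeasure Mp (UNIV - torus2) = 0 \<and> emeasure Mn (UNIV - torus2) = 0 \<and>
     (\<exists>A\<in>sets borel. emeasure Mp (UNIV - A) = 0 \<and> emeasure Mn A = 0)"

definition RP_measure :: "(complex \<times> complex) measure \<Rightarrow> (complex \<times> complex) measure \<Rightarrow> bool" where
  "RP_measure Mp Mn \<longleftrightarrow> real_measure_T2 Mp Mn \<and>
     (\<exists>f. holomorphic2_on f disc2 \<and>
        (\<forall>z\<in>disc2. Re (f z) = (\<integral>\<zeta>. poisson2 z \<zeta> \<partial>Mp) - (\<integral>\<zeta>. poisson2 z \<zeta> \<partial>Mn)))"

definition total_variation :: "(complex \<times> complex) measure \<Rightarrow> (complex \<times> complex) measure \<Rightarrow> (complex \<times> complex) set \<Rightarrow> ennreal" where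
  "total_variation Mp Mn K = emeasure Mp K + emeasure Mn K"

end

theory Submission
  imports Defs "HOL-Complex_Analysis.Complex_Analysis"
begin

text \<open>Let \<open>\<nu> = Mp - Mn\<close>. Being the real part of a holomorphic function, the Poisson integral of \<open>\<nu>\<close> has
  no Fourier coefficients of mixed sign, so \<open>\<nu>\<close> annihilates every \<open>u^k v^l\<close> with \<open>k, l \<ge> 1\<close>, where
  \<open>u = \<zeta>\<^sub>1\<close> and \<open>v\<close> is the conjugate of \<open>\<zeta>\<^sub>2\<close>. The functions whose product with every annihilated
  function is again annihilated form an algebra that is closed under bounded pointwise limits and contains
  all \<open>g u\<close> and \<open>g v\<close> with \<open>g\<close> holomorphic near the closed disc. If it contains the indicators of all
  compact subsets of \<open>K\<close>, then \<open>K\<close> is null.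

  In the coordinates \<open>(u, v)\<close> the graph is decreasing. Two mechanisms produce the indicators. If one
  projection of a compact piece of the graph has measure zero, functions of that coordinate alone peak
  on the projection, and on it the other coordinate is a bounded Borel function of the first.
  If the piece is bi-Lipschitz, sum the kernels \<open>\<epsilon> / (sqrt (1 + \<epsilon> - u/c) sqrt (1 + \<epsilon> - v/d))\<close> over
  a net of points \<open>(c, d)\<close> of mesh \<open>\<epsilon>\<close> along the curve. Their real parts are nonnegative, and since the
  curve is decreasing the arguments of the two factors partly cancel along it: the sum \<open>S\<close> grows like
  \<open>log (1/\<epsilon>)\<close> on the curve but stays bounded at each point off it, so that
  \<open>exp (- S / sqrt (log (1/\<epsilon>)))\<close> tends to the indicator of the complement. By a Vitali covering argument
  the points of an increasing graph with unbounded difference quotients have a null projection, so countably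
  many bi-Lipschitz pieces and the two exceptional sets exhaust the graph.\<close>

section \<open>Multipliers of the annihilator\<close>

text \<open>The orthogonality has exponents \<open>k, l \<ge> 1\<close>, so multiplication by
  \<open>u\<close> and \<open>v\<close> preserves it while conjugates need not; every peaking
  function therefore has to be built from functions holomorphic in the disc. On a bi-Lipschitz piece
  both projections may have positive measure. Bounded limits of holomorphic functions of one
  coordinate cannot peak there, so the two coordinates have to cooperate. The exponent one half in
  the kernel is forced from two sides. Along the curve both square roots have modulus about the root
  of the distance, so the terms are about \<open>\<epsilon> / (j * \<epsilon>)\<close> and add up to
  a logarithm. Off the curve one factor stays bounded, and
  \<open>\<epsilon> / sqrt (j * \<epsilon>)\<close> summed over \<open>1 / \<epsilon>\<close> nodes
  is bounded. The locale asks of \<open>u\<close> and \<open>v\<close> only what the torus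
  coordinates keep under rotation and exchange, so the same results serve both projections and all
  arcs.\<close>

locale analytic_pair =
  fixes P N :: "'a::{second_countable_topology, complete_space} measure"
    and u v :: "'a \<Rightarrow> complex"
  assumes sets_P: "sets P = sets borel" and sets_N: "sets N = sets borel"
    and finite_P: "finite_measure P" and finite_N: "finite_measure N"
    and jordan: "\<exists>A\<in>sets borel. emeasure P (UNIV - A) = 0 \<and> emeasure N A = 0"
    and cont_u: "continuous_on UNIV u" and cont_v: "continuous_on UNIV v"
    and uv_inj: "u x = u y \<Longrightarrow> v x = v y \<Longrightarrow> x = y"
    and AE_P: "AE x in P. cmod (u x) = 1 \<and> cmod (v x) = 1"
    and AE_N: "AE x in N. cmod (u x) = 1 \<and> cmod (v x) = 1"
    and orth: "1 \<le> k \<Longrightarrow> 1 \<le> l \<Longrightarrow>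
      (\<integral>x. u x ^ k * v x ^ l \<partial>P) = (\<integral>x. u x ^ k * v x ^ l \<partial>N)"
begin

text \<open>\<open>W\<close> carries all the mass of both measures, but \<open>u\<close> and
  \<open>v\<close> may be unbounded elsewhere, so bounds and limits are required on \<open>W\<close>
  only.\<close>

definition W :: "'a set" where
  "W = {x. cmod (u x) = 1 \<and> cmod (v x) = 1}"

definition bd :: "('a \<Rightarrow> complex) \<Rightarrow> bool" where
  "bd F \<longleftrightarrow> F \<in> borel_measurable borel \<and> (\<exists>B. \<forall>x\<in>W. cmod (F x) \<le> B)"

text \<open>\<open>F\<close> times the signed measure \<open>P - N\<close> is again orthogonal to
  all mixed monomials. Products of two such \<open>F\<close> need not have this property, which is
  why the algebra is that of the multipliers \<open>mult\<close>.\<close>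

definition annih :: "('a \<Rightarrow> complex) \<Rightarrow> bool" where
  "annih F \<longleftrightarrow> bd F \<and> (\<forall>k\<ge>1. \<forall>l\<ge>1.
     (\<integral>x. u x ^ k * v x ^ l * F x \<partial>P) = (\<integral>x. u x ^ k * v x ^ l * F x \<partial>N))"

definition mult :: "('a \<Rightarrow> complex) \<Rightarrow> bool" where
  "mult F \<longleftrightarrow> bd F \<and> (\<forall>G. annih G \<longrightarrow> annih (\<lambda>x. F x * G x))"

section \<open>The algebra of multipliers and its closure under bounded limits\<close>

lemma u_meas [measurable]: "u \<in> borel_measurable borel"
  and v_meas [measurable]: "v \<in> borel_measurable borel"
  using cont_u cont_v by (auto intro: borel_measurable_continuous_onI)

lemma bd_meas: "bd F \<Longrightarrow> F \<in> borel_measurable borel"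
  "bd F \<Longrightarrow> F \<in> borel_measurable P" "bd F \<Longrightarrow> F \<in> borel_measurable N"
  using measurable_cong_sets[OF sets_P refl] measurable_cong_sets[OF sets_N refl]
  by (auto simp: bd_def)

lemma AE_W: "AE x in P. x \<in> W" "AE x in N. x \<in> W"
  using AE_P AE_N by (simp_all add: W_def)

lemma bdI: "F \<in> borel_measurable borel \<Longrightarrow> (\<And>x. x \<in> W \<Longrightarrow> cmod (F x) \<le> B) \<Longrightarrow> bd F"
  by (auto simp: bd_def)

lemma bd_const: "bd (\<lambda>x. c)"
  by (rule bdI[of _ "cmod c"]) auto

lemma bd_u: "bd u" and bd_v: "bd v"
  by (rule bdI[of _ 1]; auto simp: W_def)+

lemma bd_add: assumes "bd F" "bd G" shows "bd (\<lambda>x. F x + G x)"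
proof -
  obtain A B where AB: "\<forall>x\<in>W. cmod (F x) \<le> A" "\<forall>x\<in>W. cmod (G x) \<le> B"
    using assms by (auto simp: bd_def)
  show ?thesis
    by (rule bdI[of _ "A + B"]) (use assms AB in \<open>auto simp: bd_def intro: norm_triangle_mono\<close>)
qed

lemma bd_mult: assumes "bd F" "bd G" shows "bd (\<lambda>x. F x * G x)"
proof -
  obtain A B where AB: "\<forall>x\<in>W. cmod (F x) \<le> A" "\<forall>x\<in>W. cmod (G x) \<le> B"
    using assms by (auto simp: bd_def)
  have "cmod (F x * G x) \<le> A * B" if "x \<in> W" for x
    using AB that by (auto simp: norm_mult intro!: mult_mono intro: order_trans[OF norm_ge_zero])
  then show ?thesis
    using assms by (intro bdI[of _ "A*B"]) (auto simp: bd_def)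
qed

lemma bd_power: "bd F \<Longrightarrow> bd (\<lambda>x. F x ^ n)"
  by (induction n) (auto intro: bd_const bd_mult)

lemma bd_integrable: assumes "bd F" shows "integrable P F" "integrable N F"
proof -
  interpret P: finite_measure P by (rule finite_P)
  interpret N: finite_measure N by (rule finite_N)
  obtain B where B: "\<forall>x\<in>W. cmod (F x) \<le> B" using assms by (auto simp: bd_def)
  show "integrable P F" "integrable N F"
    using AE_W B bd_meas[OF assms]
    by (auto intro!: P.integrable_const_bound[of _ B] N.integrable_const_bound[of _ B])
qed

lemma bd_kernel: "bd F \<Longrightarrow> bd (\<lambda>x. u x ^ k * v x ^ l * F x)"
  by (intro bd_mult bd_power bd_u bd_v)

lemma annih_one: "annih (\<lambda>x. 1)"
  using orth by (auto simp: annih_def bd_const)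

lemma annih_add: assumes "annih F" "annih G" shows "annih (\<lambda>x. F x + G x)"
proof -
  have b: "bd F" "bd G" using assms by (simp_all add: annih_def)
  have i: "integrable P (\<lambda>x. u x ^ k * v x ^ l * F x)" "integrable P (\<lambda>x. u x ^ k * v x ^ l * G x)"
     "integrable N (\<lambda>x. u x ^ k * v x ^ l * F x)" "integrable N (\<lambda>x. u x ^ k * v x ^ l * G x)" for k l
    by (intro bd_integrable bd_kernel b)+
  show ?thesis
    using assms by (simp add: annih_def distrib_left i bd_add b)
qed

lemma annih_cmult: assumes "annih F" shows "annih (\<lambda>x. c * F x)"
proof -
  have "(\<lambda>x. u x ^ k * v x ^ l * (c * F x)) = (\<lambda>x. c * (u x ^ k * v x ^ l * F x))" for k l
    by (auto simp: algebra_simps)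
  then show ?thesis using assms by (simp add: annih_def bd_mult bd_const)
qed

text \<open>Multiplication by \<open>u\<close> only raises an exponent, so the index stays in the
  range \<open>k \<ge> 1\<close> of the orthogonality. For \<open>cnj u\<close> this argument breaks
  down at \<open>k = 1\<close>.\<close>

lemma annih_u: assumes "annih F" shows "annih (\<lambda>x. u x * F x)"
proof -
  have "(\<lambda>x. u x ^ k * v x ^ l * (u x * F x)) = (\<lambda>x. u x ^ Suc k * v x ^ l * F x)" for k l
    by (auto simp: algebra_simps)
  with assms show ?thesis
    by (simp add: annih_def bd_mult bd_u del: power_Suc)
qed

lemma annih_v: assumes "annih F" shows "annih (\<lambda>x. v x * F x)"
proof -
  have "(\<lambda>x. u x ^ k * v x ^ l * (v x * F x)) = (\<lambda>x. u x ^ k * v x ^ Suc l * F x)" for k l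
    by (auto simp: algebra_simps)
  with assms show ?thesis
    by (simp add: annih_def bd_mult bd_v del: power_Suc)
qed

text \<open>Dominated convergence with a constant majorant, the measures being finite. Measurability
  of \<open>G\<close> is a separate hypothesis because convergence is known on \<open>W\<close>
  only.\<close>

lemma annih_limit:
  assumes F: "\<And>n::nat. annih (F n)" and G: "G \<in> borel_measurable borel"
    and B: "\<And>n x. x \<in> W \<Longrightarrow> cmod (F n x) \<le> B"
    and lim: "\<And>x. x \<in> W \<Longrightarrow> (\<lambda>n. F n x) \<longlonglongrightarrow> G x"
  shows "annih G"
proof -
  interpret P: finite_measure P by (rule finite_P)
  interpret N: finite_measure N by (rule finite_N)
  have bdF: "bd (F n)" for n using F by (simp add: annih_def)
  have "cmod (G x) \<le> B" if "x \<in> W" for x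
    using tendsto_norm[OF lim[OF that]] B[OF that] by (intro LIMSEQ_le_const2) auto
  then have bdG: "bd G" using G by (intro bdI) auto
  have le: "cmod (u x ^ k * v x ^ l * F n x) \<le> B" if "x \<in> W" for n x k l
    using that B[OF that] by (simp add: W_def norm_mult norm_power)
  have tt: "(\<lambda>n. u x ^ k * v x ^ l * F n x) \<longlonglongrightarrow> u x ^ k * v x ^ l * G x" if "x \<in> W" for x k l
    by (intro tendsto_intros lim that)
  note m = bd_meas[OF bd_kernel[OF bdF]] bd_meas[OF bd_kernel[OF bdG]]
  have LP: "(\<lambda>n. \<integral>x. u x ^ k * v x ^ l * F n x \<partial>P) \<longlonglongrightarrow> (\<integral>x. u x ^ k * v x ^ l * G x \<partial>P)" for k l
  proof (rule integral_dominated_convergence[where w="\<lambda>_. B"])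
    show "AE x in P. (\<lambda>n. u x ^ k * v x ^ l * F n x) \<longlonglongrightarrow> u x ^ k * v x ^ l * G x"
      using AE_W(1) by eventually_elim (rule tt)
    show "AE x in P. cmod (u x ^ k * v x ^ l * F n x) \<le> B" for n
      using AE_W(1) by eventually_elim (rule le)
  qed (use m in simp_all)
  have LN: "(\<lambda>n. \<integral>x. u x ^ k * v x ^ l * F n x \<partial>N) \<longlonglongrightarrow> (\<integral>x. u x ^ k * v x ^ l * G x \<partial>N)" for k l
  proof (rule integral_dominated_convergence[where w="\<lambda>_. B"])
    show "AE x in N. (\<lambda>n. u x ^ k * v x ^ l * F n x) \<longlonglongrightarrow> u x ^ k * v x ^ l * G x"
      using AE_W(2) by eventually_elim (rule tt)
    show "AE x in N. cmod (u x ^ k * v x ^ l * F n x) \<le> B" for n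
      using AE_W(2) by eventually_elim (rule le)
  qed (use m in simp_all)
  have eq: "(\<integral>x. u x ^ k * v x ^ l * F n x \<partial>P) = (\<integral>x. u x ^ k * v x ^ l * F n x \<partial>N)"
    if "1 \<le> k" "1 \<le> l" for k l n
    using F that by (simp add: annih_def)
  have "(\<integral>x. u x ^ k * v x ^ l * G x \<partial>P) = (\<integral>x. u x ^ k * v x ^ l * G x \<partial>N)"
    if "1 \<le> k" "1 \<le> l" for k l
    using LIMSEQ_unique[OF LP[of k l, unfolded eq[OF that]] LN] .
  then show ?thesis unfolding annih_def using bdG by blast
qed

lemma mult_bd: "mult F \<Longrightarrow> bd F" by (simp add: mult_def)

lemma mult_annih: assumes "mult F" shows "annih F"
  using assms annih_one unfolding mult_def by fastforce

lemma mult_const: "mult (\<lambda>x. c)"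
  by (auto simp: mult_def bd_const annih_cmult)

lemma mult_u: "mult u" and mult_v: "mult v"
  by (auto simp: mult_def bd_u bd_v annih_u annih_v)

lemma mult_add: "mult F \<Longrightarrow> mult G \<Longrightarrow> mult (\<lambda>x. F x + G x)"
  by (auto simp: mult_def bd_add annih_add distrib_right)

lemma mult_mult: "mult F \<Longrightarrow> mult G \<Longrightarrow> mult (\<lambda>x. F x * G x)"
  by (auto simp: mult_def bd_mult mult.assoc)

lemma mult_power: "mult F \<Longrightarrow> mult (\<lambda>x. F x ^ n)"
  by (induction n) (auto intro: mult_const mult_mult)

lemma mult_diff: "mult F \<Longrightarrow> mult G \<Longrightarrow> mult (\<lambda>x. F x - G x)"
  using mult_add[of F "\<lambda>x. (-1) * G x"] mult_mult[OF mult_const[of "-1"], of G] by simp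

lemma mult_sum: "(\<And>i. i \<in> I \<Longrightarrow> mult (F i)) \<Longrightarrow> mult (\<lambda>x. \<Sum>i\<in>I. F i x)"
  by (induction I rule: infinite_finite_induct) (auto intro: mult_const mult_add)

lemma mult_limit:
  assumes F: "\<And>n::nat. mult (F n)" and G: "G \<in> borel_measurable borel"
    and B: "\<And>n x. x \<in> W \<Longrightarrow> cmod (F n x) \<le> B"
    and lim: "\<And>x. x \<in> W \<Longrightarrow> (\<lambda>n. F n x) \<longlonglongrightarrow> G x"
  shows "mult G"
proof -
  have "cmod (G x) \<le> B" if "x \<in> W" for x
    using tendsto_norm[OF lim[OF that]] B[OF that] by (intro LIMSEQ_le_const2) auto
  then have bdG: "bd G" using G by (intro bdI) auto
  have "annih (\<lambda>x. G x * H x)" if H: "annih H" for H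
  proof -
    obtain C where C: "\<forall>x\<in>W. cmod (H x) \<le> C" and Hb: "bd H"
      using H by (auto simp: annih_def bd_def)
    show ?thesis
    proof (rule annih_limit[where F="\<lambda>n x. F n x * H x" and B="B*C"])
      show "annih (\<lambda>x. F n x * H x)" for n using F H by (simp add: mult_def)
      show "(\<lambda>x. G x * H x) \<in> borel_measurable borel"
        using G bd_meas(1)[OF Hb] by measurable
      show "cmod (F n x * H x) \<le> B * C" if "x \<in> W" for n x
        using that B[OF that, of n] C order_trans[OF norm_ge_zero B[OF that]]
        by (auto simp: norm_mult intro!: mult_mono)
      show "(\<lambda>n. F n x * H x) \<longlonglongrightarrow> G x * H x" if "x \<in> W" for x
        by (intro tendsto_intros lim that)
    qed
  qed
  then show ?thesis using bdG by (simp add: mult_def)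
qed

text \<open>Absolute convergence at radius \<open>B\<close> bounds all partial sums by one number,
  as closure under bounded limits demands.\<close>

lemma mult_series:
  assumes F: "mult F" and B: "\<And>x. x \<in> W \<Longrightarrow> cmod (F x) \<le> B"
    and a: "summable (\<lambda>n. cmod (a n) * B ^ n)"
    and G: "G \<in> borel_measurable borel"
    and s: "\<And>x. x \<in> W \<Longrightarrow> (\<lambda>n. a n * F x ^ n) sums G x"
  shows "mult G"
proof (rule mult_limit[where F="\<lambda>n x. \<Sum>i<n. a i * F x ^ i" and B="\<Sum>n. cmod (a n) * B ^ n"])
  show "mult (\<lambda>x. \<Sum>i<n. a i * F x ^ i)" for n
    by (intro mult_sum mult_mult mult_const mult_power F)
  show "cmod (\<Sum>i<n. a i * F x ^ i) \<le> (\<Sum>n. cmod (a n) * B ^ n)" if x: "x \<in> W" for n x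
  proof -
    have B0: "0 \<le> B" using order_trans[OF norm_ge_zero B[OF x]] .
    have "cmod (\<Sum>i<n. a i * F x ^ i) \<le> (\<Sum>i<n. cmod (a i) * B ^ i)"
      using B[OF x] by (intro sum_norm_le) (auto simp: norm_mult norm_power intro!: mult_left_mono power_mono)
    also have "\<dots> \<le> (\<Sum>n. cmod (a n) * B ^ n)"
      using a B0 by (intro sum_le_suminf) auto
    finally show ?thesis .
  qed
  show "(\<lambda>n. \<Sum>i<n. a i * F x ^ i) \<longlonglongrightarrow> G x" if "x \<in> W" for x
    using s[OF that] by (simp add: sums_def)
qed (rule G)

lemma mult_exp: assumes "mult F" shows "mult (\<lambda>x. exp (F x))"
proof -
  obtain B where B: "\<forall>x\<in>W. cmod (F x) \<le> B" using mult_bd[OF assms] by (auto simp: bd_def)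
  have [measurable]: "F \<in> borel_measurable borel" using bd_meas(1)[OF mult_bd[OF assms]] .
  show ?thesis
  proof (rule mult_series[OF assms, where a="\<lambda>n. inverse (fact n)" and B=B])
    show "summable (\<lambda>n. cmod (inverse (fact n)) * B ^ n)"
      using summable_exp[of B] unfolding norm_inverse norm_fact by simp
    show "(\<lambda>n. inverse (fact n) * F x ^ n) sums exp (F x)" if "x \<in> W" for x
      using exp_converges[of "F x"] by (simp add: scaleR_conv_of_real)
    show "(\<lambda>x. exp (F x)) \<in> borel_measurable borel" by measurable
  qed (use B in auto)
qed

text \<open>A disc larger than the closed unit disc makes the Taylor series at 0 converge absolutely
  at radius 1. The kernels below carry a positive shift for this reason.\<close>

lemma mult_holomorphic:
  assumes F: "mult F" and B: "\<And>x. x \<in> W \<Longrightarrow> cmod (F x) \<le> 1"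
    and g: "g holomorphic_on ball 0 R" and R: "R > 1" and G: "(\<lambda>x. g (F x)) \<in> borel_measurable borel"
  shows "mult (\<lambda>x. g (F x))"
proof -
  define a where "a n = (deriv ^^ n) g 0 / fact n" for n
  have s: "(\<lambda>n. a n * w ^ n) sums g w" if "w \<in> ball 0 R" for w
    using holomorphic_power_series[OF g that] unfolding a_def by simp
  define r where "r = (1 + R) / 2"
  have r: "1 < r" "r < R" using R by (auto simp: r_def)
  have "summable (\<lambda>n. a n * of_real r ^ n)"
    using s[of "of_real r"] r by (auto simp: sums_iff)
  then have "summable (\<lambda>n. cmod (a n * 1 ^ n))"
    by (rule powser_insidea) (use r in auto)
  then have sm: "summable (\<lambda>n. cmod (a n) * 1 ^ n)" by (simp add: norm_mult)
  show ?thesis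
  proof (rule mult_series[OF F _ sm G])
    show "cmod (F x) \<le> 1" if "x \<in> W" for x using B that .
    show "(\<lambda>n. a n * F x ^ n) sums g (F x)" if "x \<in> W" for x
      using s[of "F x"] B[OF that] R by simp
  qed
qed

section \<open>Indicators and Borel functions as multipliers\<close>

lemma indicator_Diff_mult:
  "mult (indicator A) \<Longrightarrow> mult (indicator B) \<Longrightarrow> B \<subseteq> A \<Longrightarrow> mult (indicator (A - B))"
proof -
  assume "mult (indicator A)" "mult (indicator B)" "B \<subseteq> A"
  moreover from this(3) have "(\<lambda>x. indicator A x - indicator B x :: complex) = indicator (A - B)"
    by (auto simp: fun_eq_iff indicator_def)
  ultimately show ?thesis using mult_diff[of "indicator A" "indicator B"] by simp
qed

lemma mult_indicator_union:
  assumes d: "disjoint_family A" and m: "\<And>i::nat. mult (indicator (A i))"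
    and A: "\<And>i. A i \<in> sets borel"
  shows "mult (indicator (\<Union>i. A i))"
proof (rule mult_limit[where F="\<lambda>n x. \<Sum>i<n. indicator (A i) x" and B=1])
  have eq: "(\<Sum>i<n. indicator (A i) x :: complex) = indicator (\<Union>i<n. A i) x" for n x
    using d by (subst indicator_UN_disjoint) (auto simp: disjoint_family_on_def)
  show "mult (\<lambda>x. \<Sum>i<n. indicator (A i) x)" for n
    by (intro mult_sum m)
  show "indicator (\<Union>i. A i) \<in> borel_measurable borel"
    using A by (intro borel_measurable_indicator) auto
  show "cmod (\<Sum>i<n. indicator (A i) x) \<le> 1" for n x
    unfolding eq by (simp add: indicator_def)
  show "(\<lambda>n. \<Sum>i<n. indicator (A i) x :: complex) \<longlonglongrightarrow> indicator (\<Union>i. A i) x" for x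
    unfolding eq by (rule LIMSEQ_indicator_UN)
qed

text \<open>Induction over the Borel sets, generated from the intersection-stable closed sets by
  complements and disjoint unions. Intersecting with \<open>D\<close> makes the complements relative
  to \<open>D\<close>, since only closed subsets of \<open>D\<close> are known to give
  multipliers.\<close>

lemma mult_indicator_borel:
  fixes q :: "'a \<Rightarrow> 'b::topological_space"
  assumes q: "q \<in> borel_measurable borel" and D: "closed D"
    and m: "\<And>C. closed C \<Longrightarrow> C \<subseteq> D \<Longrightarrow> mult (indicator (q -` C))"
    and Z: "Z \<in> sets borel"
  shows "mult (indicator (q -` (Z \<inter> D)))"
proof -
  have borel: "sigma_sets UNIV {S::'b set. closed S} = sets borel"
    by (simp add: borel_eq_closed)
  have i: "Int_stable {S::'b set. closed S}" by (auto simp: Int_stable_def)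
  have c: "{S::'b set. closed S} \<subseteq> Pow UNIV" by auto
  have z: "Z \<in> sigma_sets UNIV {S::'b set. closed S}" using Z borel by simp
  from i c z show ?thesis
  proof (induction rule: sigma_sets_induct_disjoint)
    case (basic A)
    then show ?case using m[of "A \<inter> D"] D by (auto intro: closed_Int)
  next
    case empty
    then show ?case using mult_const[of 0] by (simp add: indicator_def)
  next
    case (compl A)
    have "q -` ((UNIV - A) \<inter> D) = q -` D - q -` (A \<inter> D)" by auto
    then show ?case using indicator_Diff_mult[OF m[OF D order_refl] compl(2)] by auto
  next
    case (union A)
    have "mult (indicator (\<Union>i. q -` (A i \<inter> D)))"
    proof (rule mult_indicator_union)
      show "disjoint_family (\<lambda>i. q -` (A i \<inter> D))"
        using union(1) by (auto simp: disjoint_family_on_def)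
      show "mult (indicator (q -` (A i \<inter> D)))" for i by (rule union(3))
      show "q -` (A i \<inter> D) \<in> sets borel" for i
        using union(2) borel D measurable_sets_borel[OF q, of "A i \<inter> D"] by auto
    qed
    moreover have "q -` ((\<Union>i. A i) \<inter> D) = (\<Union>i. q -` (A i \<inter> D))" by auto
    ultimately show ?case by simp
  qed
qed

text \<open>Simple functions approximate \<open>G\<close>, and each is a finite combination of
  indicators of its fibres. As \<open>G\<close> is an arbitrary Borel function bounded on
  \<open>D\<close>, even conjugates of coordinates become multipliers once restricted to a suitable
  set.\<close>

lemma mult_comp_borel:
  fixes q :: "'a \<Rightarrow> 'b::topological_space" and G :: "'b \<Rightarrow> complex"
  assumes q: "q \<in> borel_measurable borel" and D: "closed D"
    and m: "\<And>C. closed C \<Longrightarrow> C \<subseteq> D \<Longrightarrow> mult (indicator (q -` C))"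
    and G: "G \<in> borel_measurable borel" and B: "\<And>t. t \<in> D \<Longrightarrow> cmod (G t) \<le> B"
  shows "mult (\<lambda>x. G (q x) * indicator D (q x))"
proof -
  obtain s where s: "\<And>i. simple_function borel (s i)" "\<And>x. (\<lambda>i. s i x) \<longlonglongrightarrow> G x"
    "\<And>i x. cmod (s i x) \<le> 2 * cmod (G x)"
    using borel_measurable_implies_sequence_metric[OF G, of 0] by auto
  show ?thesis
  proof (rule mult_limit[where F="\<lambda>n x. s n (q x) * indicator D (q x)" and B="2*\<bar>B\<bar>"])
    fix n
    have fin: "finite (range (s n))" using s(1)[of n] by (simp add: simple_function_def)
    have "mult (indicator (q -` (s n -` {y} \<inter> D)))" for y
    proof (rule mult_indicator_borel[OF q D m])
      show "s n -` {y} \<in> sets borel"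
        using simple_functionD(2)[OF s(1)[of n], of "{y}"] by simp
    qed
    then have "mult (\<lambda>x. \<Sum>y\<in>range (s n). y * indicator (q -` (s n -` {y} \<inter> D)) x)"
      by (intro mult_sum mult_mult mult_const)
    moreover have "(\<Sum>y\<in>range (s n). y * indicator (q -` (s n -` {y} \<inter> D)) x) = s n (q x) * indicator D (q x)" for x
    proof -
      have "(\<Sum>y\<in>range (s n). y * indicator (q -` (s n -` {y} \<inter> D)) x)
          = (\<Sum>y\<in>range (s n). if y = s n (q x) then y * indicator D (q x) else 0)"
        by (intro sum.cong) (auto simp: indicator_def)
      then show ?thesis using fin by simp
    qed
    ultimately show "mult (\<lambda>x. s n (q x) * indicator D (q x))" by simp
  next
    have [measurable]: "D \<in> sets borel" using D by simp
    show "(\<lambda>x. G (q x) * indicator D (q x)) \<in> borel_measurable borel"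
      using q G by measurable
    show "cmod (s n (q x) * indicator D (q x)) \<le> 2 * \<bar>B\<bar>" for n x
      using s(3)[of n "q x"] B[of "q x"] by (auto simp: indicator_def)
    show "(\<lambda>n. s n (q x) * indicator D (q x)) \<longlonglongrightarrow> G (q x) * indicator D (q x)" for x
      by (intro tendsto_intros s(2))
  qed
qed

text \<open>Restricted to \<open>K\<close>, the conjugates of \<open>u\<close> and \<open>v\<close>
  are multipliers. They cancel the factor \<open>u * v\<close> in the moment with
  \<open>k = l = 1\<close>, which leaves equal masses of \<open>Z \<inter> K\<close> under
  \<open>P\<close> and \<open>N\<close> for all Borel \<open>Z\<close>.\<close>

lemma null_if_mult:
  assumes K: "compact K" and m: "\<And>C. compact C \<Longrightarrow> C \<subseteq> K \<Longrightarrow> mult (indicator C)"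
  shows "emeasure P K = 0 \<and> emeasure N K = 0"
proof -
  obtain A where A: "A \<in> sets borel" "emeasure P (UNIV - A) = 0" "emeasure N A = 0"
    using jordan by auto
  interpret P: finite_measure P by (rule finite_P)
  interpret N: finite_measure N by (rule finite_N)
  have Kc: "closed K" by (rule compact_imp_closed[OF K])
  have sp: "space P = UNIV" "space N = UNIV"
    using sets_eq_imp_space_eq[OF sets_P] sets_eq_imp_space_eq[OF sets_N] by auto
  have meas: "measure P (Z \<inter> K) = measure N (Z \<inter> K)" if Z: "Z \<in> sets borel" for Z
  proof -
    have ZK: "Z \<inter> K \<in> sets borel" using Z Kc by auto
    define G where "G x = cnj (u x) * cnj (v x) * indicator Z x" for x
    have "continuous_on K (\<lambda>x. cnj (u x) * cnj (v x))"
      using continuous_on_subset[OF cont_u, of K] continuous_on_subset[OF cont_v, of K]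
      by (auto intro!: continuous_intros)
    then have "bounded ((\<lambda>x. cnj (u x) * cnj (v x)) ` K)"
      using K by (intro compact_imp_bounded compact_continuous_image)
    then obtain B where B: "\<And>x. x \<in> K \<Longrightarrow> cmod (cnj (u x) * cnj (v x)) \<le> B"
      by (auto simp: bounded_iff)
    have "mult (\<lambda>x. G (id x) * indicator K (id x))"
    proof (rule mult_comp_borel[where B="\<bar>B\<bar>"])
      show "mult (indicator (id -` C))" if "closed C" "C \<subseteq> K" for C
        using m[of C] that compact_Int_closed[OF K that(1)] by (simp add: Int_absorb1)
      have "cnj \<in> borel_measurable borel"
        by (intro borel_measurable_continuous_onI continuous_intros)
      then show "G \<in> borel_measurable borel"
        unfolding G_def using Z by measurable
      show "cmod (G t) \<le> \<bar>B\<bar>" if "t \<in> K" for t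
        using B[OF that] by (auto simp: G_def indicator_def)
    qed (use Kc in auto)
    then have "annih (\<lambda>x. G x * indicator K x)" using mult_annih by simp
    then have eq: "(\<integral>x. u x ^ 1 * v x ^ 1 * (G x * indicator K x) \<partial>P)
        = (\<integral>x. u x ^ 1 * v x ^ 1 * (G x * indicator K x) \<partial>N)"
      unfolding annih_def by blast
    have ind: "u x ^ 1 * v x ^ 1 * (G x * indicator K x) = indicator (Z \<inter> K) x" if "x \<in> W" for x
    proof -
      have "u x * cnj (u x) = 1" "v x * cnj (v x) = 1"
        using that by (simp_all add: W_def complex_norm_square[symmetric])
      then have "u x * v x * (cnj (u x) * cnj (v x)) = 1" by (simp add: algebra_simps)
      then show ?thesis by (simp add: G_def indicator_def)
    qed
    have GK: "bd (\<lambda>x. G x * indicator K x)"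
      using \<open>annih (\<lambda>x. G x * indicator K x)\<close> by (simp add: annih_def)
    have iP: "indicator (Z \<inter> K) \<in> borel_measurable P" "indicator (Z \<inter> K) \<in> borel_measurable N"
      using ZK by (auto simp: sets_P sets_N intro!: borel_measurable_indicator)
    have "(\<integral>x. u x ^ 1 * v x ^ 1 * (G x * indicator K x) \<partial>P) = (\<integral>x. indicator (Z \<inter> K) x \<partial>P)"
    proof (rule integral_cong_AE)
      show "AE x in P. u x ^ 1 * v x ^ 1 * (G x * indicator K x) = indicator (Z \<inter> K) x"
        using AE_W(1) by eventually_elim (rule ind)
    qed (rule bd_meas(2)[OF bd_kernel[OF GK]], rule iP)
    moreover have "(\<integral>x. u x ^ 1 * v x ^ 1 * (G x * indicator K x) \<partial>N) = (\<integral>x. indicator (Z \<inter> K) x \<partial>N)"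
    proof (rule integral_cong_AE)
      show "AE x in N. u x ^ 1 * v x ^ 1 * (G x * indicator K x) = indicator (Z \<inter> K) x"
        using AE_W(2) by eventually_elim (rule ind)
    qed (rule bd_meas(3)[OF bd_kernel[OF GK]], rule iP)
    ultimately have "(\<integral>x. indicator (Z \<inter> K) x \<partial>P) = (\<integral>x. indicator (Z \<inter> K) x \<partial>N :: complex)"
      using eq by simp
    moreover have "indicator (Z \<inter> K) = (\<lambda>x. complex_of_real (indicator (Z \<inter> K) x))"
      by (auto simp: fun_eq_iff indicator_def)
    ultimately show ?thesis by (simp add: sp)
  qed
  \<comment> \<open>\<open>N\<close> has no mass on \<open>A\<close> and \<open>P\<close> none off
    \<open>A\<close>, so the equality of masses for \<open>Z = A\<close> and for its complement
    makes both vanish on \<open>K\<close>.\<close>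
  have "emeasure N (A \<inter> K) \<le> emeasure N A"
    using A(1) by (intro emeasure_mono) (auto simp: sets_N)
  then have NA: "measure N (A \<inter> K) = 0" using A(3) by (simp add: measure_def)
  have "emeasure P ((UNIV - A) \<inter> K) \<le> emeasure P (UNIV - A)"
    using A(1) by (intro emeasure_mono) (auto simp: sets_P)
  then have PA: "measure P ((UNIV - A) \<inter> K) = 0" using A(2) by (simp add: measure_def)
  have KA: "K = (A \<inter> K) \<union> ((UNIV - A) \<inter> K)" "(A \<inter> K) \<inter> ((UNIV - A) \<inter> K) = {}" by auto
  have sets: "A \<inter> K \<in> sets borel" "(UNIV - A) \<inter> K \<in> sets borel" using A(1) Kc by auto
  have split: "measure P K = measure P (A \<inter> K) + measure P ((UNIV - A) \<inter> K)"
     "measure N K = measure N (A \<inter> K) + measure N ((UNIV - A) \<inter> K)"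
    using P.finite_measure_Union[OF _ _ KA(2)] N.finite_measure_Union[OF _ _ KA(2)] sets KA(1)
    by (simp_all add: sets_P sets_N)
  have "measure P K = 0" "measure N K = 0"
    using split NA PA meas[OF A(1)] meas[of "UNIV - A"] A(1) by auto
  then show ?thesis
    by (simp add: P.emeasure_eq_measure N.emeasure_eq_measure)
qed

end

section \<open>Peaking on sets of measure zero\<close>

text \<open>For compact sets on a line or a circle this is Lebesgue measure zero. The covers are
  finite and centred in \<open>E\<close> because each ball will give one kernel, directed at its
  centre, which must lie on the unit circle.\<close>

definition content_zero :: "'a::metric_space set \<Rightarrow> bool" where
  "content_zero E \<longleftrightarrow> (\<forall>\<eta>>0. \<exists>(I::nat set) c a. finite I \<and> (\<forall>i\<in>I. c i \<in> E \<and> 0 < a i) \<and>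
     (\<Sum>i\<in>I. a i) < \<eta> \<and> E \<subseteq> (\<Union>i\<in>I. ball (c i) (a i)))"

lemma content_zeroI:
  assumes "\<And>\<eta>::real. \<eta> > 0 \<Longrightarrow> \<exists>T r. finite T \<and> T \<subseteq> E \<and> (\<forall>c\<in>T. 0 < r c) \<and> (\<Sum>c\<in>T. r c) < \<eta> \<and>
     E \<subseteq> (\<Union>c\<in>T. ball c (r c))"
  shows "content_zero E"
  unfolding content_zero_def
proof (intro allI impI)
  fix \<eta> :: real assume "\<eta> > 0"
  from assms[OF this] obtain T r where T: "finite T" "T \<subseteq> E" "\<forall>c\<in>T. 0 < r c" "(\<Sum>c\<in>T. r c) < \<eta>"
      "E \<subseteq> (\<Union>c\<in>T. ball c (r c))"
    by (elim exE conjE) (rule that)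
  obtain h where h: "bij_betw h {0..<card T} T"
    using ex_bij_betw_nat_finite[OF T(1)] by blast
  have im: "h ` {0..<card T} = T" by (rule bij_betw_imp_surj_on[OF h])
  have "(\<Sum>i\<in>{0..<card T}. r (h i)) = (\<Sum>c\<in>T. r c)"
    by (rule sum.reindex_bij_betw[OF h])
  then have 1: "(\<Sum>i\<in>{0..<card T}. r (h i)) < \<eta>" using T(4) by simp
  have "(\<Union>i\<in>{0..<card T}. ball (h i) (r (h i))) = (\<Union>c\<in>h ` {0..<card T}. ball c (r c))"
    by (simp only: image_image)
  then have "(\<Union>i\<in>{0..<card T}. ball (h i) (r (h i))) = (\<Union>c\<in>T. ball c (r c))"
    unfolding im .
  then have 2: "E \<subseteq> (\<Union>i\<in>{0..<card T}. ball (h i) (r (h i)))" using T(5) by simp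
  have 3: "\<forall>i\<in>{0..<card T}. h i \<in> E \<and> 0 < r (h i)"
  proof
    fix i assume "i \<in> {0..<card T}"
    then have "h i \<in> T" using im by blast
    then show "h i \<in> E \<and> 0 < r (h i)" using T(2,3) by blast
  qed
  show "\<exists>(I::nat set) c a. finite I \<and> (\<forall>i\<in>I. c i \<in> E \<and> 0 < a i) \<and>
     (\<Sum>i\<in>I. a i) < \<eta> \<and> E \<subseteq> (\<Union>i\<in>I. ball (c i) (a i))"
    by (intro exI[of _ "{0..<card T}"] exI[of _ h] exI[of _ "\<lambda>i. r (h i)"] conjI 1 2 3) simp
qed

text \<open>The centres have to move into the smaller set, which costs a factor 2 in the radii;
  balls that miss it are dropped.\<close>

lemma content_zero_subset:
  assumes "content_zero E" "E' \<subseteq> E"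
  shows "content_zero E'"
  unfolding content_zero_def
proof (intro allI impI)
  fix \<eta> :: real assume "\<eta> > 0"
  then obtain I :: "nat set" and c a where I: "finite I" "\<forall>i\<in>I. c i \<in> E \<and> 0 < a i"
     "(\<Sum>i\<in>I. a i) < \<eta> / 2" "E \<subseteq> (\<Union>i\<in>I. ball (c i) (a i))"
    using assms(1) unfolding content_zero_def by (metis half_gt_zero)
  define J where "J = {i\<in>I. ball (c i) (a i) \<inter> E' \<noteq> {}}"
  then have "\<forall>i\<in>J. \<exists>d. d \<in> ball (c i) (a i) \<inter> E'" by blast
  then obtain d where d: "\<And>i. i \<in> J \<Longrightarrow> d i \<in> ball (c i) (a i) \<inter> E'" by metis
  have J: "finite J" "J \<subseteq> I" using I(1) by (auto simp: J_def)
  have "(\<Sum>i\<in>J. a i) \<le> (\<Sum>i\<in>I. a i)" using I J by (intro sum_mono2) force+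
  then have 1: "(\<Sum>i\<in>J. 2 * a i) < \<eta>" using I(3) by (simp add: sum_distrib_left[symmetric])
  have 2: "E' \<subseteq> (\<Union>i\<in>J. ball (d i) (2 * a i))"
  proof
    fix x assume x: "x \<in> E'"
    then obtain i where i: "i \<in> I" "x \<in> ball (c i) (a i)" using assms(2) I(4) by blast
    then have "i \<in> J" using x by (auto simp: J_def)
    moreover have "dist (d i) x < 2 * a i"
      using d[OF calculation] i(2) dist_triangle[of "d i" x "c i"] by (simp add: dist_commute)
    ultimately show "x \<in> (\<Union>i\<in>J. ball (d i) (2 * a i))" by auto
  qed
  have 3: "\<forall>i\<in>J. d i \<in> E' \<and> 0 < 2 * a i" using d I(2) J(2) by auto
  show "\<exists>(I::nat set) c a. finite I \<and> (\<forall>i\<in>I. c i \<in> E' \<and> 0 < a i) \<and>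
     (\<Sum>i\<in>I. a i) < \<eta> \<and> E' \<subseteq> (\<Union>i\<in>I. ball (c i) (a i))"
    by (intro exI[of _ J] exI[of _ d] exI[of _ "\<lambda>i. 2 * a i"] conjI 1 2 3 J(1))
qed

lemma content_zero_image:
  assumes "content_zero E" "\<And>x y. dist (f x) (f y) \<le> dist x y"
  shows "content_zero (f ` E)"
  unfolding content_zero_def
proof (intro allI impI)
  fix \<eta> :: real assume "\<eta> > 0"
  then obtain I :: "nat set" and c a where I: "finite I" "\<forall>i\<in>I. c i \<in> E \<and> 0 < a i"
     "(\<Sum>i\<in>I. a i) < \<eta>" "E \<subseteq> (\<Union>i\<in>I. ball (c i) (a i))"
    using assms(1) unfolding content_zero_def by metis
  have 1: "f ` E \<subseteq> (\<Union>i\<in>I. ball (f (c i)) (a i))"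
  proof (rule image_subsetI)
    fix x assume "x \<in> E"
    then obtain i where "i \<in> I" "dist (c i) x < a i" using I(4) by auto
    then show "f x \<in> (\<Union>i\<in>I. ball (f (c i)) (a i))"
      using assms(2)[of "c i" x] by (auto intro!: bexI[of _ i])
  qed
  have 2: "\<forall>i\<in>I. f (c i) \<in> f ` E \<and> 0 < a i" using I(2) by blast
  show "\<exists>(I::nat set) c a. finite I \<and> (\<forall>i\<in>I. c i \<in> f ` E \<and> 0 < a i) \<and>
     (\<Sum>i\<in>I. a i) < \<eta> \<and> f ` E \<subseteq> (\<Union>i\<in>I. ball (c i) (a i))"
    by (intro exI[of _ I] exI[of _ "\<lambda>i. f (c i)"] exI[of _ a] conjI 1 2 I(1,3))
qed

text \<open>On the unit circle \<open>cmod (1 - cnj c * z) = cmod (z - c)\<close>. Adding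
  \<open>a\<close> gives a number of real part at least \<open>a\<close> whose modulus is comparable
  to \<open>a + cmod (z - c)\<close>.\<close>

lemma unit_circle_kernel:
  assumes "cmod c = 1" "cmod z = 1" "a > 0"
  shows "Re (1 + of_real a - cnj c * z) \<ge> a" "cmod (z - c) \<le> cmod (1 + of_real a - cnj c * z)"
    "cmod (1 + of_real a - cnj c * z) \<le> a + cmod (z - c)"
proof -
  define t where "t = cnj c * z"
  have t: "cmod t = 1" using assms by (simp add: t_def norm_mult)
  have "c * (1 - t) = c - (c * cnj c) * z" by (simp add: t_def algebra_simps)
  also have "c * cnj c = 1" using assms(1) by (simp add: complex_norm_square[symmetric])
  finally have "cmod (c * (1 - t)) = cmod (c - z)" by simp
  then have d: "cmod (1 - t) = cmod (z - c)" using assms(1) by (simp add: norm_mult norm_minus_commute)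
  have re: "Re t \<le> 1" using complex_Re_le_cmod[of t] t by simp
  show "Re (1 + of_real a - cnj c * z) \<ge> a" using re by (simp add: t_def[symmetric])
  have "(cmod (1 - t))\<^sup>2 \<le> (cmod (1 + of_real a - t))\<^sup>2"
    using re assms(3) by (auto simp: cmod_power2 intro!: power_mono)
  then show "cmod (z - c) \<le> cmod (1 + of_real a - cnj c * z)"
    unfolding d t_def[symmetric] by (rule power2_le_imp_le) simp
  have "cmod (1 + of_real a - t) \<le> cmod (of_real a) + cmod (1 - t)"
    using norm_triangle_ineq[of "of_real a" "1 - t"] by (simp add: algebra_simps)
  then show "cmod (1 + of_real a - cnj c * z) \<le> a + cmod (z - c)"
    unfolding d t_def[symmetric] using assms(3) by simp
qed

lemma Re_pos_kernel_ball:
  assumes "cmod c = 1" "a > 0" "z \<in> ball 0 (1 + a)"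
  shows "Re (1 + of_real a - cnj c * z) > 0"
proof -
  have "Re (cnj c * z) \<le> cmod z"
    using complex_Re_le_cmod[of "cnj c * z"] assms(1) by (simp add: norm_mult)
  then show ?thesis using assms(3) by simp
qed

context analytic_pair
begin

text \<open>Each ball of a cover, with centre \<open>c\<close> and radius \<open>a\<close>,
  contributes \<open>a / (1 + a - cnj c * z)\<close>. Its real part is nonnegative, and at least 1/4
  inside the ball; at distance \<open>d\<close> from \<open>E\<close> its modulus is at most
  \<open>a / d\<close>. The sums are amplified by \<open>n + 1\<close>, and a total radius below
  \<open>1 / (n + 1)^2\<close> still sends them to 0 off \<open>E\<close>.\<close>

lemma mult_indicator_content_zero:
  assumes E: "closed E" "content_zero E" and circ: "\<And>c. c \<in> E \<Longrightarrow> cmod c = 1"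
  shows "mult (indicator (u -` E))"
proof -
  define R where "R n I c a \<longleftrightarrow> finite I \<and> (\<forall>i\<in>I. c i \<in> E \<and> 0 < a i) \<and>
     (\<Sum>i\<in>I. a i) < 1 / (real n + 1)^2 \<and> E \<subseteq> (\<Union>i\<in>I. ball (c i) (a i))"
    for n and I :: "nat set" and c a
  have "\<exists>I c a. R n I c a" for n
    using E(2)[unfolded content_zero_def, rule_format, of "1 / (real n + 1)^2"]
    unfolding R_def by simp
  then obtain I c a where R: "\<And>n. R n (I n) (c n) (a n)" by metis
  have I: "finite (I n)" "\<And>i. i \<in> I n \<Longrightarrow> c n i \<in> E" "\<And>i. i \<in> I n \<Longrightarrow> (0::real) < a n i"
     "(\<Sum>i\<in>I n. a n i) < 1 / (real n + 1)^2" "E \<subseteq> (\<Union>i\<in>I n. ball (c n i) (a n i))" for n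
    using R[of n] unfolding R_def by blast+
  define k where "k n i z = of_real (a n i) / (1 + of_real (a n i) - cnj (c n i) * z)" for n i z
  define S where "S n z = (\<Sum>i\<in>I n. k n i z)" for n z
  have mk: "mult (\<lambda>x. k n i (u x))" if i: "i \<in> I n" for n i
  proof (rule mult_holomorphic[OF mult_u])
    show "k n i holomorphic_on ball 0 (1 + a n i)"
    proof -
      have "1 + of_real (a n i) - cnj (c n i) * z \<noteq> 0" if "z \<in> ball 0 (1 + a n i)" for z
        using Re_pos_kernel_ball[OF circ[OF I(2)[OF i]] I(3)[OF i] that] by (metis less_irrefl zero_complex.simps(1))
      then show ?thesis unfolding k_def by (auto intro!: holomorphic_intros)
    qed
    show "1 < 1 + a n i" using I(3)[OF i] by simp
    show "(\<lambda>x. k n i (u x)) \<in> borel_measurable borel"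
      unfolding k_def by measurable
  qed (simp add: W_def)
  have F: "mult (\<lambda>x. exp (of_real (- (real n + 1)) * S n (u x)))" for n
    unfolding S_def by (intro mult_exp mult_mult mult_const mult_sum mk)
  have kpos: "Re (k n i z) \<ge> 0" if "i \<in> I n" "cmod z = 1" for n i z
    using unit_circle_kernel(1)[OF circ[OF I(2)[OF that(1)]] that(2) I(3)[OF that(1)]] I(3)[OF that(1)]
    unfolding k_def by (subst Re_divide) (auto intro!: divide_nonneg_nonneg mult_nonneg_nonneg add_nonneg_nonneg)
  have Spos: "Re (S n z) \<ge> 0" if "cmod z = 1" for n z
    unfolding S_def using kpos that by (auto intro: sum_nonneg)
  have nF: "cmod (exp (of_real (- (real n + 1)) * S n z)) = exp (- ((real n + 1) * Re (S n z)))" for n z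
    by (simp add: norm_exp_eq_Re algebra_simps)
  have "mult (\<lambda>x. 1 - indicator (u -` E) x)"
  proof (rule mult_limit[OF F, where B=1])
    have "u -` E \<in> sets borel" using measurable_sets_borel[OF u_meas, of E] E(1) by simp
    then show "(\<lambda>x. 1 - indicator (u -` E) x :: complex) \<in> borel_measurable borel" by measurable
    show "cmod (exp (of_real (- (real n + 1)) * S n (u x))) \<le> 1" if "x \<in> W" for n x
      unfolding nF using Spos[of "u x" n] that by (simp add: W_def mult_nonneg_nonneg)
    show "(\<lambda>n. exp (of_real (- (real n + 1)) * S n (u x))) \<longlonglongrightarrow> 1 - indicator (u -` E) x" if "x \<in> W" for x
    proof (cases "u x \<in> E")
      case True
      have ux: "cmod (u x) = 1" using that by (simp add: W_def)
      \<comment> \<open>The constant comes from one ball containing the point: there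
        \<open>Re w \<ge> a\<close> and \<open>cmod w \<le> 2 * a\<close>, hence
        \<open>Re (a / w) \<ge> 1 / 4\<close>.\<close>
      have lb: "Re (S n (u x)) \<ge> 1/4" for n
      proof -
        obtain i where i: "i \<in> I n" "u x \<in> ball (c n i) (a n i)" using I(5) True by blast
        define w where "w = 1 + of_real (a n i) - cnj (c n i) * u x"
        have a: "a n i > 0" using I(3) i by blast
        note w = unit_circle_kernel[OF circ[OF I(2)[OF i(1)]] ux a, folded w_def]
        have w2: "cmod w \<le> 2 * a n i" using w(3) i(2) by (simp add: dist_norm norm_minus_commute)
        then have "(cmod w)\<^sup>2 \<le> (2 * a n i)\<^sup>2" by (intro power_mono) auto
        also have "\<dots> = 4 * (a n i * a n i)" by (simp add: power2_eq_square)
        also have "\<dots> \<le> 4 * (a n i * Re w)" using w(1) a by simp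
        finally have le: "(cmod w)\<^sup>2 \<le> 4 * (a n i * Re w)" .
        have w0: "(cmod w)\<^sup>2 > 0" using w(1) a by auto
        have "Re (k n i (u x)) = a n i * Re w / (cmod w)\<^sup>2"
          unfolding k_def w_def[symmetric] by (simp add: Re_divide cmod_power2)
        then have "1/4 \<le> Re (k n i (u x))" using le w0 by (simp add: le_divide_eq)
        also have "\<dots> \<le> Re (S n (u x))"
          unfolding S_def Re_sum using kpos ux I(1) i(1) by (intro member_le_sum) auto
        finally show ?thesis .
      qed
      have "(\<lambda>n. exp (of_real (- (real n + 1)) * S n (u x))) \<longlonglongrightarrow> 0"
      proof (rule Lim_null_comparison)
        show "\<forall>\<^sub>F n in sequentially. cmod (exp (of_real (- (real n + 1)) * S n (u x))) \<le> exp (- ((real n + 1) / 4))"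
        proof (intro always_eventually allI)
          fix n
          have "(real n + 1) * (1/4) \<le> (real n + 1) * Re (S n (u x))"
            by (rule mult_left_mono[OF lb]) simp
          then show "cmod (exp (of_real (- (real n + 1)) * S n (u x))) \<le> exp (- ((real n + 1) / 4))"
            unfolding nF by simp
        qed
        show "(\<lambda>n. exp (- ((real n + 1) / 4))) \<longlonglongrightarrow> 0" by real_asymp
      qed
      then show ?thesis using True by simp
    next
      case False
      have ux: "cmod (u x) = 1" using that by (simp add: W_def)
      obtain d where d: "d > 0" "\<And>c. c \<in> E \<Longrightarrow> d \<le> dist (u x) c"
        using separate_point_closed[OF E(1) False] by auto
      have ub: "cmod (S n (u x)) \<le> 1 / (real n + 1)^2 / d" for n
      proof -
        have "cmod (k n i (u x)) \<le> a n i / d" if i: "i \<in> I n" for i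
        proof -
          note w = unit_circle_kernel[OF circ[OF I(2)[OF i]] ux I(3)[OF i]]
          have "d \<le> cmod (1 + of_real (a n i) - cnj (c n i) * u x)"
            using d(2)[OF I(2)[OF i]] w(2) by (simp add: dist_norm)
          then show ?thesis unfolding k_def norm_divide
            using I(3)[OF i] d(1) by (auto intro!: divide_left_mono mult_pos_pos)
        qed
        then have "cmod (S n (u x)) \<le> (\<Sum>i\<in>I n. a n i / d)" unfolding S_def by (rule sum_norm_le)
        also have "\<dots> = (\<Sum>i\<in>I n. a n i) / d" by (simp add: sum_divide_distrib)
        also have "\<dots> \<le> 1 / (real n + 1)^2 / d" using I(4)[of n] d(1) by (intro divide_right_mono) auto
        finally show ?thesis .
      qed
      have "(\<lambda>n. of_real (- (real n + 1)) * S n (u x)) \<longlonglongrightarrow> 0"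
      proof (rule Lim_null_comparison)
        show "\<forall>\<^sub>F n in sequentially. cmod (of_real (- (real n + 1)) * S n (u x)) \<le> 1 / (real n + 1) / d"
        proof (intro always_eventually allI)
          fix n
          have "cmod (of_real (- (real n + 1)) * S n (u x)) = (real n + 1) * cmod (S n (u x))"
            unfolding norm_mult norm_of_real by simp
          also have "\<dots> \<le> (real n + 1) * (1 / (real n + 1)^2 / d)" by (intro mult_left_mono ub) simp
          also have "\<dots> = 1 / (real n + 1) / d" by (simp add: power2_eq_square)
          finally show "cmod (of_real (- (real n + 1)) * S n (u x)) \<le> 1 / (real n + 1) / d" .
        qed
        show "(\<lambda>n. 1 / (real n + 1) / d) \<longlonglongrightarrow> 0" using d(1) by real_asymp
      qed
      from tendsto_exp[OF this] show ?thesis using False by simp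
    qed
  qed
  from mult_diff[OF mult_const[of 1] this] show ?thesis by simp
qed

end

lemma norm_one_plus_less_2:
  assumes "cmod w \<le> 1" "w \<noteq> 1"
  shows "cmod (1 + w) < 2"
proof -
  have "(cmod w)\<^sup>2 \<le> 1" using assms(1) by (simp add: power_le_one)
  then have w: "(Re w)\<^sup>2 + (Im w)\<^sup>2 \<le> 1" by (simp add: cmod_power2)
  have "Re w \<le> 1" using complex_Re_le_cmod[of w] assms(1) by simp
  moreover have "Re w \<noteq> 1"
  proof
    assume "Re w = 1"
    with w show False using assms(2) by (auto simp: complex_eq_iff)
  qed
  ultimately have "Re w < 1" by simp
  moreover have "(cmod (1 + w))\<^sup>2 = 1 + 2 * Re w + ((Re w)\<^sup>2 + (Im w)\<^sup>2)"
    unfolding cmod_power2 by (simp add: power2_eq_square algebra_simps)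
  ultimately have "(cmod (1 + w))\<^sup>2 < 2\<^sup>2" using w by simp
  then show ?thesis by (rule power2_less_imp_less) simp
qed

context analytic_pair
begin

text \<open>On the small set the second coordinate is a function of the first, so
  \<^term>\<open>cnj (v y) * v x\<close> with \<^term>\<open>u y = u x\<close>, \<^term>\<open>y \<in> K\<close> is a multiplier that peaks exactly on \<^term>\<open>K\<close>.\<close>
lemma mult_indicator_graph_content_zero:
  assumes K: "compact K" "K \<subseteq> W" and inj: "inj_on u K" and E0: "content_zero (u ` K)"
  shows "mult (indicator K)"
proof -
  define E where "E = u ` K"
  define g where "g = the_inv_into K u"
  have g: "g (u y) = y" if "y \<in> K" for y
    unfolding g_def by (rule the_inv_into_f_f[OF inj that])
  have Ec: "closed E" unfolding E_def
    by (intro compact_imp_closed compact_continuous_image K continuous_on_subset[OF cont_u]) auto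
  have "continuous_on E g" unfolding E_def
    by (rule continuous_on_inv) (use g K continuous_on_subset[OF cont_u] in auto)
  then have "continuous_on E (\<lambda>t. cnj (v (g t)))"
    by (intro continuous_intros continuous_on_compose2[OF cont_v]) auto
  then have "(\<lambda>t. indicator E t *\<^sub>R cnj (v (g t))) \<in> borel_measurable borel"
    using Ec by (intro borel_measurable_continuous_on_indicator) auto
  moreover define G where "G t = indicator E t *\<^sub>R cnj (v (g t))" for t
  ultimately have G: "G \<in> borel_measurable borel" by (simp add: G_def[abs_def])
  have Gn: "cmod (G t) = 1" if "t \<in> E" for t
    using that g K(2) by (auto simp: G_def E_def W_def)
  have mG: "mult (\<lambda>x. G (u x) * indicator E (u x))"
  proof (rule mult_comp_borel[OF u_meas Ec _ G, where B=1])
    fix C :: "complex set" assume C: "closed C" "C \<subseteq> E"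
    show "mult (indicator (u -` C))"
    proof (rule mult_indicator_content_zero[OF C(1)])
      show "content_zero C" using content_zero_subset[OF E0] C(2) by (simp add: E_def)
      show "cmod c = 1" if "c \<in> C" for c
        using that C(2) K(2) by (auto simp: E_def W_def)
    qed
  qed (simp add: Gn)
  define w where "w x = G (u x) * indicator E (u x) * v x" for x
  have w: "mult w" unfolding w_def by (intro mult_mult[OF mG] mult_v)
  have wn: "cmod (w x) \<le> 1" if "x \<in> W" for x
    using Gn[of "u x"] that by (auto simp: w_def norm_mult indicator_def W_def)
  have wK: "w x = 1" if "x \<in> K" for x
    using that g[OF that] K(2) 
    by (auto simp: w_def G_def E_def W_def complex_norm_square[symmetric] mult.commute)
  have w1: "x \<in> K" if "x \<in> W" "w x = 1" for x
  proof -
    have uE: "u x \<in> E" using that(2) by (cases "u x \<in> E") (auto simp: w_def)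
    then obtain y where y: "y \<in> K" "u x = u y" by (auto simp: E_def)
    have eq: "cnj (v y) * v x = 1" using that(2) uE y g by (simp add: w_def G_def)
    have "v y * cnj (v y) = 1" using y K(2) by (auto simp: W_def complex_norm_square[symmetric])
    then have "v x = v y" using eq by (metis mult.assoc mult.commute mult.right_neutral)
    then show ?thesis using uv_inj[of x y] y by simp
  qed
  show ?thesis
  \<comment> \<open>Averaging with 1 turns a function of modulus at most 1 into one whose modulus
    reaches 1 only where \<open>w x = 1\<close>, so its powers tend to the indicator of
    \<open>K\<close>.\<close>
  proof (rule mult_limit[where F="\<lambda>n x. ((1 / 2) * (1 + w x)) ^ n" and B=1])
    show "mult (\<lambda>x. ((1 / 2) * (1 + w x)) ^ n)" for n
      by (intro mult_power mult_mult mult_add mult_const w)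
    show "indicator K \<in> borel_measurable borel"
      using compact_imp_closed[OF K(1)] by (intro borel_measurable_indicator) auto
    have nrm: "cmod ((1 / 2) * (1 + w x)) \<le> 1" if "x \<in> W" for x
      using norm_triangle_ineq[of 1 "w x"] wn[OF that] by (simp add: norm_mult)
    then show "cmod (((1 / 2) * (1 + w x)) ^ n) \<le> 1" if "x \<in> W" for n x
      using that by (simp add: norm_power power_le_one del: times_divide_eq_left)
    show "(\<lambda>n. ((1 / 2) * (1 + w x)) ^ n) \<longlonglongrightarrow> indicator K x" if "x \<in> W" for x
    proof (cases "x \<in> K")
      case True then show ?thesis using wK by simp
    next
      case False
      then have "w x \<noteq> 1" using w1 that by blast
      then have "cmod ((1 / 2) * (1 + w x)) < 1"
        using norm_one_plus_less_2[OF wn[OF that]] by (simp add: norm_mult)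
      from LIMSEQ_power_zero[OF this] show ?thesis using False by simp
    qed
  qed
qed

lemma null_if_content_zero:
  assumes K: "compact K" "K \<subseteq> W" and inj: "inj_on u K" and E0: "content_zero (u ` K)"
  shows "emeasure P K = 0 \<and> emeasure N K = 0"
proof (rule null_if_mult[OF K(1)])
  fix C assume "compact C" "C \<subseteq> K"
  then show "mult (indicator C)"
    using K(2) inj E0 
    by (intro mult_indicator_graph_content_zero) (auto intro: inj_on_subset content_zero_subset)
qed

end

section \<open>Steep points and bi-Lipschitz extension\<close>

lemma disjoint_balls_real:
  fixes x y :: real
  assumes "disjnt (ball x r) (ball y s)" "0 < r" "0 < s" "x < y"
  shows "x + r \<le> y - s"
proof (rule ccontr)
  assume *: "\<not> x + r \<le> y - s"
  define z where "z = (max x (y - s) + min y (x + r)) / 2"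
  have "max x (y - s) < min y (x + r)" using * assms by auto
  then have "max x (y - s) < z" "z < min y (x + r)" by (auto simp: z_def)
  then have "z \<in> ball x r" "z \<in> ball y s" by (auto simp: dist_real_def)
  then show False using assms(1) by (auto simp: disjnt_def)
qed

lemma sum_lengths_le:
  fixes lo hi :: "'i \<Rightarrow> real"
  assumes I: "finite I" and le: "\<And>i. i \<in> I \<Longrightarrow> lo i \<le> hi i"
    and sub: "\<And>i. i \<in> I \<Longrightarrow> {lo i<..<hi i} \<subseteq> {0..1}"
    and dj: "\<And>i j. i \<in> I \<Longrightarrow> j \<in> I \<Longrightarrow> i \<noteq> j \<Longrightarrow> hi i \<le> lo j \<or> hi j \<le> lo i"
  shows "(\<Sum>i\<in>I. hi i - lo i) \<le> 1"
proof -
  have fm: "{lo i<..<hi i} \<in> fmeasurable lborel" if "i \<in> I" for i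
    using le[OF that] by (simp add: fmeasurable_def)
  have pw: "pairwise (\<lambda>i j. disjnt {lo i<..<hi i} {lo j<..<hi j}) I"
    using dj by (fastforce simp: pairwise_def disjnt_def)
  have "measure lborel (\<Union>i\<in>I. {lo i<..<hi i}) = (\<Sum>i\<in>I. measure lborel {lo i<..<hi i})"
    by (rule measure_UNION'[OF I fm pw])
  also have "\<dots> = (\<Sum>i\<in>I. hi i - lo i)"
    using le by (intro sum.cong) auto
  finally have "(\<Sum>i\<in>I. hi i - lo i) = measure lborel (\<Union>i\<in>I. {lo i<..<hi i})" ..
  also have "\<dots> \<le> measure lborel {0..1::real}"
    using sub I by (intro measure_mono_fmeasurable) (auto simp: fmeasurable_def)
  finally show ?thesis by simp
qed

text \<open>From each point \<open>x\<close> of \<open>C\<close> some secant, ending at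
  \<open>g x\<close>, has slope above \<open>6 / \<eta>\<close>. For balls of radius
  \<open>\<bar>x - g x\<bar>\<close> selected disjoint by Vitali the secant intervals do not
  overlap, so by monotonicity their rises add up to at most 1 and the radii to at most
  \<open>\<eta> / 6\<close>. Only values of \<open>f\<close> on \<open>S\<close>, which may have
  gaps, enter.\<close>

lemma content_zero_steep:
  fixes f :: "real \<Rightarrow> real"
  assumes S: "S \<subseteq> {0..1}" and mono: "\<And>x y. x \<in> S \<Longrightarrow> y \<in> S \<Longrightarrow> x \<le> y \<Longrightarrow> f x \<le> f y"
    and f01: "\<And>x. x \<in> S \<Longrightarrow> f x \<in> {0..1}"
    and C: "compact C" "C \<subseteq> S"
    and steep: "\<And>x L. x \<in> C \<Longrightarrow> \<exists>x'\<in>S. \<bar>f x - f x'\<bar> > L * \<bar>x - x'\<bar>"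
  shows "content_zero C"
proof (rule content_zeroI)
  fix \<eta> :: real assume eta: "\<eta> > 0"
  \<comment> \<open>The slope \<open>6 / \<eta>\<close> against the Vitali enlargement by 5 leaves
    \<open>5 * \<eta> / 6 < \<eta>\<close>.\<close>
  obtain g where g: "\<And>x. x \<in> C \<Longrightarrow> g x \<in> S" "\<And>x. x \<in> C \<Longrightarrow> \<bar>f x - f (g x)\<bar> > 6 / \<eta> * \<bar>x - g x\<bar>"
    using steep[of _ "6 / \<eta>"] by metis
  define r where "r x = \<bar>x - g x\<bar>" for x
  have r: "0 < r x" "r x \<le> 1" "r x \<le> \<eta> / 6 * \<bar>f x - f (g x)\<bar>" if "x \<in> C" for x
  proof -
    have "g x \<noteq> x" using g(2)[OF that] by auto
    then show "0 < r x" by (simp add: r_def)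
    have "x \<in> {0..1}" "g x \<in> {0..1}" using that g(1)[OF that] C(2) S by auto
    then show "r x \<le> 1" by (auto simp: r_def)
    show "r x \<le> \<eta> / 6 * \<bar>f x - f (g x)\<bar>"
      using g(2)[OF that] eta by (simp add: r_def field_simps)
  qed
  have "C \<subseteq> (\<Union>x\<in>C. ball x (r x))" using r(1) by force
  then obtain T where T: "T \<subseteq> C" "finite T" "C \<subseteq> (\<Union>x\<in>T. ball x (r x))"
    using compactE_image[OF C(1), of C "\<lambda>x. ball x (r x)"] by blast
  obtain D where D: "D \<subseteq> T" "pairwise (\<lambda>i j. disjnt (ball i (r i)) (ball j (r j))) D"
     "C \<subseteq> (\<Union>i\<in>D. ball i (5 * r i))"
    by (rule Vitali_covering_lemma_balls[OF T(3), where B=1]) (use r T(1) in auto)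
  have fD: "finite D" using D(1) T(2) finite_subset by blast
  have DC: "D \<subseteq> C" using D(1) T(1) by blast
  define lo where "lo x = min x (g x)" for x
  define hi where "hi x = max x (g x)" for x
  have lohi: "lo x \<in> S" "hi x \<in> S" "lo x \<le> hi x" if "x \<in> D" for x
    using that g(1) DC C(2) by (auto simp: lo_def hi_def min_def max_def)
  \<comment> \<open>\<open>g x\<close> is at distance exactly \<open>r x\<close>, so each secant
    interval fits into the closed ball, and closures of disjoint balls can at most touch.\<close>
  have sep: "hi x \<le> lo y" if "x \<in> D" "y \<in> D" "x < y" for x y
  proof -
    have "x + r x \<le> y - r y"
      using D(2) that r(1) DC by (intro disjoint_balls_real) (auto simp: pairwise_def)
    then show ?thesis by (auto simp: lo_def hi_def r_def)
  qed
  have "(\<Sum>x\<in>D. f (hi x) - f (lo x)) \<le> 1"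
  proof (rule sum_lengths_le[OF fD])
    show "f (lo i) \<le> f (hi i)" if "i \<in> D" for i using mono lohi[OF that] by blast
    show "{f (lo i)<..<f (hi i)} \<subseteq> {0..1}" if "i \<in> D" for i
      using f01[OF lohi(1)[OF that]] f01[OF lohi(2)[OF that]] by auto
    show "f (hi i) \<le> f (lo j) \<or> f (hi j) \<le> f (lo i)" if "i \<in> D" "j \<in> D" "i \<noteq> j" for i j
    proof (cases "i < j")
      case True then show ?thesis using sep mono lohi that by blast
    next
      case False
      then have "j < i" using that(3) by simp
      then show ?thesis using sep mono lohi that by blast
    qed
  qed
  moreover have "5 * r x \<le> 5 * \<eta> / 6 * (f (hi x) - f (lo x))" if "x \<in> D" for x
  proof -
    have "f (lo x) \<le> f (hi x)" using mono lohi[OF that] by blast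
    then have "\<bar>f x - f (g x)\<bar> = f (hi x) - f (lo x)"
      by (auto simp: lo_def hi_def min_def max_def split: if_splits)
    then show ?thesis using r(3)[of x] DC that by auto
  qed
  then have "(\<Sum>x\<in>D. 5 * r x) \<le> (\<Sum>x\<in>D. 5 * \<eta> / 6 * (f (hi x) - f (lo x)))"
    by (rule sum_mono)
  moreover have "\<dots> = 5 * \<eta> / 6 * (\<Sum>x\<in>D. f (hi x) - f (lo x))" by (simp add: sum_distrib_left)
  moreover have "5 * \<eta> / 6 * (\<Sum>x\<in>D. f (hi x) - f (lo x)) \<le> 5 * \<eta> / 6 * 1"
    using calculation(1) eta by (intro mult_left_mono) auto
  ultimately have less: "(\<Sum>x\<in>D. 5 * r x) < \<eta>" using eta by linarith
  have pos: "\<forall>c\<in>D. 0 < 5 * r c" using r(1) DC by auto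
  show "\<exists>T r. finite T \<and> T \<subseteq> C \<and> (\<forall>c\<in>T. 0 < r c) \<and> (\<Sum>c\<in>T. r c) < \<eta> \<and> C \<subseteq> (\<Union>c\<in>T. ball c (r c))"
    by (intro exI[of _ D] exI[of _ "\<lambda>x. 5 * r x"] conjI fD DC pos less D(3))
qed

text \<open>The one-sided analogue of the McShane extension: the supremum of the kinked minorants
  \<^term>\<open>\<lambda>t. f p + min (L * (t - x p)) ((t - x p) / L)\<close>.\<close>
lemma increasing_bilipschitz_extension:
  fixes x f :: "'i \<Rightarrow> real"
  assumes L: "L \<ge> 1" and ne: "S \<noteq> {}"
    and f: "\<And>p q. p \<in> S \<Longrightarrow> q \<in> S \<Longrightarrow> x p \<le> x q \<Longrightarrow>
      (x q - x p) / L \<le> f q - f p \<and> f q - f p \<le> L * (x q - x p)"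
  obtains F where "\<And>p. p \<in> S \<Longrightarrow> F (x p) = f p"
    "\<And>s t. s \<le> t \<Longrightarrow> (t - s) / L \<le> F t - F s \<and> F t - F s \<le> L * (t - s)"
proof -
  define \<phi> where "\<phi> t = min (L * t) (t / L)" for t
  have L0: "L > 0" using L by simp
  have \<phi>0: "\<phi> t = (if t \<ge> 0 then t / L else L * t)" for t
  proof (cases "t \<ge> 0")
    case True
    have "t / L \<le> t * 1" unfolding divide_inverse using True L by (intro mult_left_mono) (auto simp: inverse_le_1_iff)
    also have "\<dots> \<le> L * t" using mult_right_mono[OF L True] by simp
    finally show ?thesis using True by (simp add: \<phi>_def)
  next
    case False
    then have t: "-t \<ge> 0" by simp
    have "-t / L \<le> -t * 1" unfolding divide_inverse using t L by (intro mult_left_mono) (auto simp: inverse_le_1_iff)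
    also have "\<dots> \<le> L * -t" using mult_right_mono[OF L t] by simp
    finally show ?thesis using False by (simp add: \<phi>_def)
  qed
  have \<phi>: "(t - s) / L \<le> \<phi> t - \<phi> s" "\<phi> t - \<phi> s \<le> L * (t - s)" if "s \<le> t" for s t
  proof -
    have a: "(t - s) / L \<le> L * (t - s)" using \<phi>0[of "t - s"] that by (simp add: \<phi>_def)
    have "L * s + (t - s) / L \<le> L * t" using a by (simp add: algebra_simps)
    moreover have "s / L + (t - s) / L = t / L" by (simp add: diff_divide_distrib)
    ultimately show "(t - s) / L \<le> \<phi> t - \<phi> s" unfolding \<phi>_def by (auto simp: min_def)
    have "t / L \<le> s / L + L * (t - s)" using a by (simp add: diff_divide_distrib)
    then show "\<phi> t - \<phi> s \<le> L * (t - s)" unfolding \<phi>_def by (auto simp: min_def algebra_simps)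
  qed
  \<comment> \<open>No kinked minorant exceeds the data at another node. Both slope bounds of the
    hypothesis are spent here, and the inequality makes \<open>F\<close> interpolate.\<close>
  have le: "f p + \<phi> (x q - x p) \<le> f q" if "p \<in> S" "q \<in> S" for p q
  proof (cases "x p \<le> x q")
    case True
    then show ?thesis using f[OF that True] \<phi>0[of "x q - x p"] by simp
  next
    case False
    then show ?thesis using f[OF that(2,1)] \<phi>0[of "x q - x p"] by (simp add: algebra_simps)
  qed
  define F where "F t = (SUP p\<in>S. f p + \<phi> (t - x p))" for t
  obtain p0 where p0: "p0 \<in> S" using ne by blast
  \<comment> \<open>\<open>S\<close> may be infinite. Moving \<open>t\<close> to the right until it
    is at least \<open>x p0\<close> allows every minorant to be compared with the single base point
    \<open>p0\<close>.\<close>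
  have bdd: "bdd_above ((\<lambda>p. f p + \<phi> (t - x p)) ` S)" for t
  proof (rule bdd_aboveI2)
    fix p assume p: "p \<in> S"
    have "\<phi> (t - x p) \<le> \<phi> (max t (x p0) - x p)"
      using \<phi>(1)[of "t - x p" "max t (x p0) - x p"] L0 
      by (smt (verit) divide_nonneg_pos max.cobounded1)
    also have "\<dots> \<le> \<phi> (x p0 - x p) + L * (max t (x p0) - x p0)"
      using \<phi>(2)[of "x p0 - x p" "max t (x p0) - x p"] by simp
    finally show "f p + \<phi> (t - x p) \<le> f p0 + L * (max t (x p0) - x p0)"
      using le[OF p p0] by simp
  qed
  have up: "f p + \<phi> (t - x p) \<le> F t" if "p \<in> S" for p t
    unfolding F_def by (rule cSUP_upper[OF that bdd])
  show ?thesis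
  proof
    fix p assume p: "p \<in> S"
    show "F (x p) = f p"
    proof (rule antisym)
      show "F (x p) \<le> f p" unfolding F_def using ne le p by (intro cSUP_least) auto
      show "f p \<le> F (x p)" using up[OF p, of "x p"] by (simp add: \<phi>_def)
    qed
  next
    fix s t :: real assume st: "s \<le> t"
    have "F s \<le> F t - (t - s) / L"
      unfolding F_def[of s]
    proof (rule cSUP_least[OF ne])
      fix p assume p: "p \<in> S"
      show "f p + \<phi> (s - x p) \<le> F t - (t - s) / L"
        using up[OF p, of t] \<phi>(1)[of "s - x p" "t - x p"] st by simp
    qed
    moreover have "F t \<le> F s + L * (t - s)"
      unfolding F_def[of t]
    proof (rule cSUP_least[OF ne])
      fix p assume p: "p \<in> S"
      show "f p + \<phi> (t - x p) \<le> F s + L * (t - s)"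
        using up[OF p, of s] \<phi>(2)[of "s - x p" "t - x p"] st by simp
    qed
    ultimately show "(t - s) / L \<le> F t - F s \<and> F t - F s \<le> L * (t - s)" by simp
  qed
qed

section \<open>Peaking on bi-Lipschitz graphs\<close>

lemma norm_cis_diff: "cmod (cis s - cis t) = 2 * \<bar>sin ((s - t) / 2)\<bar>"
proof -
  have "cis s - cis t = cis t * (cis (s - t) - 1)" by (simp add: right_diff_distrib cis_mult)
  then have "cmod (cis s - cis t) = cmod (cis (s - t) - 1)" by (simp add: norm_mult)
  also have "\<dots> = 2 * \<bar>sin ((s - t) / 2)\<bar>"
    using dist_exp_i_1[of "s - t"] by (simp add: cis_conv_exp)
  finally show ?thesis .
qed

lemma norm_cis_diff_le: "cmod (cis s - cis t) \<le> \<bar>s - t\<bar>"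
  using abs_sin_x_le_abs_x[of "(s - t) / 2"] by (simp add: norm_cis_diff)

text \<open>The cubic Taylor bound gives \<open>sin z \<ge> z - z ^ 3 / 6 \<ge> z / 2\<close> for
  \<open>0 \<le> z \<le> 3/2\<close>. The range 3 is the length of \<open>{-1..2}\<close>, in which
  the net and its image under \<open>F\<close> will lie.\<close>

lemma norm_cis_diff_ge:
  assumes "\<bar>s - t\<bar> \<le> 3"
  shows "\<bar>s - t\<bar> / 2 \<le> cmod (cis s - cis t)"
proof -
  define z where "z = \<bar>s - t\<bar> / 2"
  have z: "0 \<le> z" "z \<le> 3/2" using assms by (auto simp: z_def)
  have "\<bar>sin z - (\<Sum>m<3. sin_coeff m * z ^ m)\<bar> \<le> inverse (fact 3) * \<bar>z\<bar> ^ 3"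
    by (rule Maclaurin_sin_bound)
  then have "\<bar>sin z - z\<bar> \<le> z ^ 3 / 6"
    using z(1) by (simp add: eval_nat_numeral sin_coeff_def)
  then have "z - sin z \<le> z ^ 3 / 6" by linarith
  also have "z ^ 3 = z * z\<^sup>2" by (simp add: eval_nat_numeral)
  also have "z * z\<^sup>2 / 6 \<le> z * (3/2)\<^sup>2 / 6"
    using z by (intro divide_right_mono mult_left_mono power_mono) auto
  finally have "z / 2 \<le> sin z" using z(1) by (simp add: power2_eq_square)
  moreover have "\<bar>sin ((s - t) / 2)\<bar> = \<bar>sin z\<bar>"
    using sin_minus[of "(t - s) / 2"] by (cases "s \<ge> t") (simp_all add: z_def minus_divide_left)
  ultimately show ?thesis unfolding norm_cis_diff z_def by linarith
qed

lemma norm_csqrt: "cmod (csqrt z) = sqrt (cmod z)"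
  by (metis norm_ge_zero norm_power power2_csqrt real_sqrt_abs abs_of_nonneg)

text \<open>Square roots of numbers in the right half plane have argument below
  \<open>pi / 4\<close> in modulus, so a product of two stays in the right half plane. If the
  imaginary parts of \<open>w\<close> and \<open>w'\<close> have opposite signs, the arguments
  partly cancel and the product \<open>P\<close> lies in the sector
  \<open>\<bar>Im P\<bar> \<le> Re P\<close>; hence a loss of only a factor 2.\<close>

lemma Re_inverse_csqrt_mult:
  assumes w: "Re w > 0" "Re w' > 0"
  shows "Re (1 / (csqrt w * csqrt w')) \<ge> 0"
    "Im w \<ge> 0 \<Longrightarrow> Im w' \<le> 0 \<Longrightarrow> Re (1 / (csqrt w * csqrt w')) \<ge> 1 / (2 * sqrt (cmod w * cmod w'))"
proof -
  define a b c d where abcd: "a = Re (csqrt w)" "b = Im (csqrt w)" "c = Re (csqrt w')" "d = Im (csqrt w')"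
  have re: "\<bar>Im (csqrt z)\<bar> < Re (csqrt z)" if "Re z > 0" for z
  proof -
    define c where "c = csqrt z"
    have "c\<^sup>2 = z" by (simp add: c_def)
    then have "(Im c)\<^sup>2 < (Re c)\<^sup>2" using that by (metis Re_power2 diff_gt_0_iff_gt)
    then have "\<bar>Im (csqrt z)\<bar> < \<bar>Re (csqrt z)\<bar>"
      unfolding c_def by (metis abs_le_square_iff not_le)
    moreover have "Re (csqrt z) \<ge> 0" by (rule Re_csqrt)
    ultimately show ?thesis by simp
  qed
  have ab: "\<bar>b\<bar> < a" "\<bar>d\<bar> < c" using re w by (simp_all add: abcd)
  define P where "P = csqrt w * csqrt w'"
  have ReP: "Re P = a * c - b * d" by (simp add: P_def abcd)
  have bd: "\<bar>b * d\<bar> \<le> a * c" unfolding abs_mult using ab by (intro mult_mono) auto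
  have Re1: "Re (1 / P) = Re P / (cmod P)\<^sup>2" by (simp add: Re_divide cmod_power2)
  show "Re (1 / (csqrt w * csqrt w')) \<ge> 0"
    unfolding P_def[symmetric] Re1 ReP using bd by (intro divide_nonneg_nonneg) auto
  assume im: "Im w \<ge> 0" "Im w' \<le> 0"
  have "b \<ge> 0" using im(1) complex_Re_le_cmod[of w] by (simp add: abcd sgn_if)
  \<comment> \<open>On the real axis \<open>csqrt\<close> takes the sign \<open>+1\<close>, but the
    imaginary part is 0 there because \<open>Re w' > 0\<close>.\<close>
  moreover have "d \<le> 0"
  proof (cases "Im w' = 0")
    case True
    then have "cmod w' = Re w'" using w(2) by (simp add: cmod_eq_Re)
    then show ?thesis by (simp add: abcd)
  next
    case False
    then show ?thesis using im(2) complex_Re_le_cmod[of w'] by (simp add: abcd sgn_if)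
  qed
  ultimately have "b * d \<le> 0" by (rule mult_nonneg_nonpos)
  then have 1: "a * c \<le> Re P" using ReP by simp
  have nP: "cmod P = sqrt (cmod w * cmod w')" by (simp add: P_def norm_mult norm_csqrt real_sqrt_mult)
  have ImP: "Im P = a * d + b * c" by (simp add: P_def abcd)
  have P0: "cmod P > 0" using w unfolding nP by (auto intro!: mult_pos_pos)
  have "\<bar>a * d\<bar> \<le> a * c" "\<bar>b * c\<bar> \<le> a * c" unfolding abs_mult using ab by (auto intro!: mult_mono)
  moreover have "a * d \<le> 0" "b * c \<ge> 0"
    using ab \<open>b \<ge> 0\<close> \<open>d \<le> 0\<close> by (auto intro: mult_nonneg_nonpos)
  ultimately have "\<bar>Im P\<bar> \<le> a * c" unfolding ImP by linarith
  then have "cmod P \<le> 2 * Re P" using cmod_le[of P] 1 bd by linarith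
  then have "1 / (2 * cmod P) \<le> Re (1 / P)" unfolding Re1 using P0
    by (simp add: field_simps power2_eq_square)
  then show "Re (1 / (csqrt w * csqrt w')) \<ge> 1 / (2 * sqrt (cmod w * cmod w'))"
    unfolding nP unfolding P_def .
qed

section \<open>Sums of inverse square roots over a separated net\<close>

lemma sum_inverse_sqrt_le: "(\<Sum>n<N. 1 / sqrt (1 + real n)) \<le> 2 * sqrt (real N)"
proof (induction N)
  case (Suc N)
  have "sqrt (1 + real N) > 0" by simp
  have "(sqrt (1 + real N) - sqrt (real N)) * (sqrt (1 + real N) + sqrt (real N)) = 1"
    by (simp add: algebra_simps)
  moreover have "(sqrt (1 + real N) - sqrt (real N)) * (sqrt (1 + real N) + sqrt (real N))
     \<le> (sqrt (1 + real N) - sqrt (real N)) * (2 * sqrt (1 + real N))"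
    by (intro mult_left_mono) auto
  ultimately have "1 / sqrt (1 + real N) \<le> 2 * (sqrt (1 + real N) - sqrt (real N))"
    using \<open>sqrt (1 + real N) > 0\<close> by (simp add: field_simps)
  then show ?case using Suc.IH by (simp add: add.commute)
qed simp

lemma sum_inverse_sqrt_int_le:
  assumes "J \<subseteq> {- int N..int N}"
  shows "(\<Sum>j\<in>J. 1 / sqrt (1 + real_of_int \<bar>j\<bar>)) \<le> 4 * sqrt (real (Suc N))"
proof -
  have nn: "nat ` {0..int N} = {..<Suc N}"
    by (auto simp: image_iff intro!: bexI[of _ "int _"])
  have "(\<Sum>j\<in>{0..int N}. 1 / sqrt (1 + real_of_int \<bar>j\<bar>)) = (\<Sum>n<Suc N. 1 / sqrt (1 + real n))"
    by (rule sum.reindex_bij_witness[of _ int nat]) auto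
  then have pos: "(\<Sum>j\<in>{0..int N}. 1 / sqrt (1 + real_of_int \<bar>j\<bar>)) \<le> 2 * sqrt (real (Suc N))"
    using sum_inverse_sqrt_le[of "Suc N"] by simp
  have "(\<Sum>j\<in>{- int N..0}. 1 / sqrt (1 + real_of_int \<bar>j\<bar>)) = (\<Sum>j\<in>{0..int N}. 1 / sqrt (1 + real_of_int \<bar>j\<bar>))"
    by (rule sum.reindex_bij_witness[of _ uminus uminus]) auto
  with pos have neg: "(\<Sum>j\<in>{- int N..0}. 1 / sqrt (1 + real_of_int \<bar>j\<bar>)) \<le> 2 * sqrt (real (Suc N))" by simp
  have "(\<Sum>j\<in>J. 1 / sqrt (1 + real_of_int \<bar>j\<bar>)) \<le> (\<Sum>j\<in>{- int N..0} \<union> {0..int N}. 1 / sqrt (1 + real_of_int \<bar>j\<bar>))"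
    using assms by (intro sum_mono2) auto
  also have "\<dots> \<le> (\<Sum>j\<in>{- int N..0}. 1 / sqrt (1 + real_of_int \<bar>j\<bar>)) + (\<Sum>j\<in>{0..int N}. 1 / sqrt (1 + real_of_int \<bar>j\<bar>))"
    by (subst sum_Un) (auto intro!: sum_nonneg)
  finally show ?thesis using pos neg by simp
qed

text \<open>Measuring from the node closest to \<^term>\<open>z\<close> at most doubles the distances.\<close>
lemma sum_inverse_sqrt_dist_le:
  fixes e :: "int \<Rightarrow> complex" and \<omega> :: "int \<Rightarrow> real"
  assumes J: "finite J" "J \<subseteq> {- int N..int N}" and a: "0 < a" "a \<le> 1" and \<epsilon>: "\<epsilon> > 0"
    and e: "\<And>i j. i \<in> J \<Longrightarrow> j \<in> J \<Longrightarrow> a * real_of_int \<bar>i - j\<bar> * \<epsilon> \<le> cmod (e i - e j)"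
    and \<omega>: "\<And>j. j \<in> J \<Longrightarrow> \<epsilon> \<le> \<omega> j" "\<And>j. j \<in> J \<Longrightarrow> cmod (z - e j) \<le> \<omega> j"
  shows "(\<Sum>j\<in>J. 1 / sqrt (\<omega> j)) \<le> 8 / sqrt (a * \<epsilon>) * sqrt (real (Suc (2 * N)))"
proof (cases "J = {}")
  case False
  obtain k where k: "k \<in> J" "\<And>j. j \<in> J \<Longrightarrow> cmod (z - e k) \<le> cmod (z - e j)"
    using ex_is_arg_min_if_finite[OF J(1) False, of "\<lambda>j. cmod (z - e j)"]
    by (auto simp: is_arg_min_linorder)
  have "1 / sqrt (\<omega> j) \<le> 2 / sqrt (a * \<epsilon>) * (1 / sqrt (1 + real_of_int \<bar>j - k\<bar>))" if j: "j \<in> J" for j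
  proof -
    have "a * real_of_int \<bar>j - k\<bar> * \<epsilon> \<le> cmod (e j - z) + cmod (z - e k)"
      using e[OF j k(1)] norm_triangle_ineq[of "e j - z" "z - e k"] by simp
    also have "\<dots> \<le> 2 * \<omega> j" using k(2)[OF j] \<omega>(2)[OF j] by (simp add: norm_minus_commute)
    finally have 1: "a * real_of_int \<bar>j - k\<bar> * \<epsilon> \<le> 2 * \<omega> j" .
    have "a * \<epsilon> \<le> 1 * \<epsilon>" using a \<epsilon> by (intro mult_right_mono) auto
    then have "a * \<epsilon> \<le> \<omega> j" using \<omega>(1)[OF j] by simp
    \<comment> \<open>The separation bound is empty at \<open>j = k\<close>; adding the lower bound
      \<open>a * \<epsilon> \<le> \<omega> j\<close> supplies the summand 1.\<close>
    with 1 have le: "a * \<epsilon> * (1 + real_of_int \<bar>j - k\<bar>) / 4 \<le> \<omega> j"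
      using \<omega>(1)[OF j] \<epsilon> by (simp add: algebra_simps)
    have "sqrt (a * \<epsilon>) * sqrt (1 + real_of_int \<bar>j - k\<bar>) / 2 \<le> sqrt (\<omega> j)"
      using real_sqrt_le_mono[OF le] by (simp add: real_sqrt_mult real_sqrt_divide)
    moreover have "sqrt (a * \<epsilon>) * sqrt (1 + real_of_int \<bar>j - k\<bar>) / 2 > 0" using a \<epsilon> by simp
    ultimately have "1 / sqrt (\<omega> j) \<le> 1 / (sqrt (a * \<epsilon>) * sqrt (1 + real_of_int \<bar>j - k\<bar>) / 2)"
      using less_le_trans[OF \<epsilon> \<omega>(1)[OF j]] by (intro divide_left_mono mult_pos_pos) auto
    then show ?thesis by simp
  qed
  then have "(\<Sum>j\<in>J. 1 / sqrt (\<omega> j)) \<le> (\<Sum>j\<in>J. 2 / sqrt (a * \<epsilon>) * (1 / sqrt (1 + real_of_int \<bar>j - k\<bar>)))"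
    by (rule sum_mono)
  also have "\<dots> = 2 / sqrt (a * \<epsilon>) * (\<Sum>j\<in>J. 1 / sqrt (1 + real_of_int \<bar>j - k\<bar>))"
    by (simp only: sum_distrib_left)
  \<comment> \<open>Recentring at \<open>k\<close> can double the index range, hence the
    \<open>2 * N\<close> in the conclusion.\<close>
  also have "(\<Sum>j\<in>J. 1 / sqrt (1 + real_of_int \<bar>j - k\<bar>)) = (\<Sum>i\<in>(\<lambda>j. j - k) ` J. 1 / sqrt (1 + real_of_int \<bar>i\<bar>))"
    by (subst sum.reindex) (auto simp: inj_on_def)
  also have "2 / sqrt (a * \<epsilon>) * \<dots> \<le> 2 / sqrt (a * \<epsilon>) * (4 * sqrt (real (Suc (2 * N))))"
  proof (intro mult_left_mono sum_inverse_sqrt_int_le)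
    show "(\<lambda>j. j - k) ` J \<subseteq> {- int (2 * N)..int (2 * N)}"
    proof (rule image_subsetI)
      fix j assume "j \<in> J"
      then have "j \<in> {- int N..int N}" "k \<in> {- int N..int N}" using J(2) k(1) by auto
      then show "j - k \<in> {- int (2 * N)..int (2 * N)}" by auto
    qed
  qed (use a \<epsilon> in auto)
  finally show ?thesis by simp
qed (use a \<epsilon> in auto)

text \<open>\<open>csqrt\<close> jumps across the negative real axis, so measurability is read off
  from its real and imaginary parts instead of from continuity.\<close>

lemma csqrt_measurable: "csqrt \<in> borel_measurable borel"
proof -
  have "csqrt = (\<lambda>z. of_real (sqrt ((cmod z + Re z) / 2)) +
      \<i> * of_real ((if Im z = 0 then 1 else sgn (Im z)) * sqrt ((cmod z - Re z) / 2)))"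
    by (intro ext complex_eqI) simp_all
  also have "\<dots> \<in> borel_measurable borel"
    unfolding sgn_if by measurable
  finally show ?thesis .
qed

context analytic_pair
begin

text \<open>The shift by \<open>\<epsilon>\<close> keeps the argument of each \<open>csqrt\<close>
  off the branch cut in a disc of radius \<open>1 + \<epsilon>\<close>, and each factor depends on
  one coordinate only.\<close>

lemma mult_csqrt_kernels:
  assumes "cmod c = 1" "cmod d = 1" "\<epsilon> > 0"
  shows "mult (\<lambda>p. of_real \<epsilon> * (1 / (csqrt (1 + of_real \<epsilon> - cnj c * u p) * csqrt (1 + of_real \<epsilon> - cnj d * v p))))"
proof -
  have g: "(\<lambda>z. 1 / csqrt (1 + of_real \<epsilon> - cnj c * z)) holomorphic_on ball 0 (1 + \<epsilon>)" if "cmod c = 1" for c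
  proof -
    have Re: "Re (1 + of_real \<epsilon> - cnj c * z) > 0" if "z \<in> ball 0 (1 + \<epsilon>)" for z
      using Re_pos_kernel_ball[OF \<open>cmod c = 1\<close> assms(3) that] .
    then have "1 + of_real \<epsilon> - cnj c * z \<notin> \<real>\<^sub>\<le>\<^sub>0" if "z \<in> ball 0 (1 + \<epsilon>)" for z
      using that Re by (metis complex_nonpos_Reals_iff not_le)
    moreover have "1 + of_real \<epsilon> - cnj c * z \<noteq> 0" if "z \<in> ball 0 (1 + \<epsilon>)" for z
      using that Re by (metis less_irrefl zero_complex.simps(1))
    ultimately show ?thesis by (auto intro!: holomorphic_intros)
  qed
  have m: "mult (\<lambda>p. 1 / csqrt (1 + of_real \<epsilon> - cnj c * F p))"
    if c: "cmod c = 1" and F: "mult F" "\<And>p. p \<in> W \<Longrightarrow> cmod (F p) \<le> 1"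
      "F \<in> borel_measurable borel" for c F
  proof (rule mult_holomorphic[OF F(1,2) g[OF c]])
    have "(\<lambda>p. 1 / csqrt p) \<in> borel_measurable borel"
      using csqrt_measurable by measurable
    from measurable_compose[OF _ this, of "\<lambda>p. 1 + of_real \<epsilon> - cnj c * F p"] F(3)
    show "(\<lambda>x. 1 / csqrt (1 + complex_of_real \<epsilon> - cnj c * F x)) \<in> borel_measurable borel"
      by simp
  qed (use assms(3) in auto)
  have "mult (\<lambda>p. of_real \<epsilon> * ((1 / csqrt (1 + of_real \<epsilon> - cnj c * u p)) * (1 / csqrt (1 + of_real \<epsilon> - cnj d * v p))))"
    by (intro mult_mult mult_const m assms mult_u mult_v u_meas v_meas) (auto simp: W_def)
  then show ?thesis by simp
qed

text \<open>Distance from \<open>K\<close> is measured in the coordinates \<open>u\<close>,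
  \<open>v\<close>, in which the kernels are estimated; compactness makes their joint injectivity
  quantitative.\<close>

lemma bounded_away_from_compact:
  assumes K: "compact K" and p: "p \<notin> K"
  obtains r where "r > 0" "\<And>q. q \<in> K \<Longrightarrow> r \<le> cmod (u p - u q) + cmod (v p - v q)"
proof (cases "K = {}")
  case False
  have "continuous_on K (\<lambda>q. cmod (u p - u q) + cmod (v p - v q))"
    using continuous_on_subset[OF cont_u, of K] continuous_on_subset[OF cont_v, of K]
    by (auto intro!: continuous_intros)
  then obtain q where q: "q \<in> K" "\<And>q'. q' \<in> K \<Longrightarrow>
      cmod (u p - u q) + cmod (v p - v q) \<le> cmod (u p - u q') + cmod (v p - v q')"
    using continuous_attains_inf[OF K False] by blast
  have "cmod (u p - u q) + cmod (v p - v q) \<noteq> 0"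
  proof
    assume "cmod (u p - u q) + cmod (v p - v q) = 0"
    then have "cmod (u p - u q) = 0" "cmod (v p - v q) = 0"
      using norm_ge_zero[of "u p - u q"] norm_ge_zero[of "v p - v q"] by linarith+
    then have "u p = u q" "v p = v q" by simp_all
    then show False using uv_inj[of p q] q(1) p by auto
  qed
  then have "cmod (u p - u q) + cmod (v p - v q) > 0"
    using norm_ge_zero[of "u p - u q"] norm_ge_zero[of "v p - v q"] by linarith
  then show ?thesis using that q(2) by blast
qed (use that[of 1] in auto)

end

section \<open>Kernel sums along a bi-Lipschitz curve\<close>

locale bilipschitz_graph = analytic_pair +
  fixes K :: "'a set" and x y :: "'a \<Rightarrow> real" and L :: real and F :: "real \<Rightarrow> real"
  assumes K: "compact K" and ne: "K \<noteq> {}"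
    and x01: "p \<in> K \<Longrightarrow> x p \<in> {0..1}" and y01: "p \<in> K \<Longrightarrow> y p \<in> {0..1}"
    and ux: "p \<in> K \<Longrightarrow> u p = cis (x p)" and vy: "p \<in> K \<Longrightarrow> v p = cis (- y p)"
    and L: "L \<ge> 1" and Fx: "p \<in> K \<Longrightarrow> F (x p) = y p"
    and F: "s \<le> t \<Longrightarrow> (t - s) / L \<le> F t - F s \<and> F t - F s \<le> L * (t - s)"
begin

text \<open>The mesh is the square of the radius \<open>1 / real m\<close> in \<open>nodes\<close>:
  each point of \<open>K\<close> has \<open>m\<close> nodes within reach on its right, enough for a
  logarithm, while the net still shrinks to \<open>K\<close>.\<close>

definition eps :: "nat \<Rightarrow> real" where "eps m = 1 / (real m)\<^sup>2"

text \<open>An abscissa \<open>t\<close> close to one of \<open>K\<close> need not belong to a point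
  of \<open>K\<close>; the extension \<open>F\<close> to the whole line provides the node
  \<open>(cis t, cis (- F t))\<close> all the same.\<close>

definition nodes :: "nat \<Rightarrow> int set" where
  "nodes m = {j. \<exists>p\<in>K. \<bar>of_int j * eps m - x p\<bar> \<le> 1 / real m}"

definition w1 :: "nat \<Rightarrow> int \<Rightarrow> 'a \<Rightarrow> complex" where
  "w1 m j p = 1 + of_real (eps m) - cnj (cis (of_int j * eps m)) * u p"

definition w2 :: "nat \<Rightarrow> int \<Rightarrow> 'a \<Rightarrow> complex" where
  "w2 m j p = 1 + of_real (eps m) - cnj (cis (- F (of_int j * eps m))) * v p"

definition kap :: "nat \<Rightarrow> int \<Rightarrow> 'a \<Rightarrow> complex" where
  "kap m j p = of_real (eps m) * (1 / (csqrt (w1 m j p) * csqrt (w2 m j p)))"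

definition S :: "nat \<Rightarrow> 'a \<Rightarrow> complex" where
  "S m p = (\<Sum>j\<in>nodes m. kap m j p)"

lemma eps_pos: "m \<ge> 1 \<Longrightarrow> eps m > 0" by (simp add: eps_def)

lemma F_abs: "\<bar>F s - F t\<bar> \<le> L * \<bar>s - t\<bar>" "\<bar>s - t\<bar> / L \<le> \<bar>F s - F t\<bar>"
proof -
  have *: "\<bar>F s - F t\<bar> \<le> L * \<bar>s - t\<bar> \<and> \<bar>s - t\<bar> / L \<le> \<bar>F s - F t\<bar>" if "s \<le> t" for s t
  proof -
    have "0 \<le> (t - s) / L" using that L by simp
    then have "\<bar>F s - F t\<bar> = F t - F s" using F[OF that] by simp
    then show ?thesis using F[OF that] that by simp
  qed
  show "\<bar>F s - F t\<bar> \<le> L * \<bar>s - t\<bar>" "\<bar>s - t\<bar> / L \<le> \<bar>F s - F t\<bar>"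
    using *[of s t] *[of t s] by (cases "s \<le> t"; simp add: abs_minus_commute)+
qed

text \<open>\<open>real m \<ge> L\<close> bounds the error \<open>L / real m\<close> in the second
  coordinate by 1, so both parameters of a node stay in \<open>{-1..2}\<close>, where chords control
  arcs.\<close>

lemma node_bounds:
  assumes m: "m \<ge> 1" "real m \<ge> L" and j: "j \<in> nodes m"
  obtains q where "q \<in> K" "\<bar>of_int j * eps m - x q\<bar> \<le> 1 / real m"
    "\<bar>F (of_int j * eps m) - y q\<bar> \<le> L / real m"
    "of_int j * eps m \<in> {-1..2}" "F (of_int j * eps m) \<in> {-1..2}"
proof -
  obtain q where q: "q \<in> K" "\<bar>of_int j * eps m - x q\<bar> \<le> 1 / real m"
    using j by (auto simp: nodes_def)
  have "L * \<bar>of_int j * eps m - x q\<bar> \<le> L * (1 / real m)"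
    using q(2) L by (intro mult_left_mono) auto
  then have F: "\<bar>F (of_int j * eps m) - y q\<bar> \<le> L / real m"
    using F_abs(1)[of "of_int j * eps m" "x q"] Fx[OF q(1)] by simp
  have "1 / real m \<le> 1" "L / real m \<le> 1" using m L by auto
  then have "of_int j * eps m \<in> {-1..2}" "F (of_int j * eps m) \<in> {-1..2}"
    using q(2) F x01[OF q(1)] y01[OF q(1)] unfolding abs_le_iff atLeastAtMost_iff by linarith+
  then show ?thesis using that q F by blast
qed

lemma nodes_subset:
  assumes m: "m \<ge> 1" "real m \<ge> L"
  shows "nodes m \<subseteq> {- int (2 * m\<^sup>2)..int (2 * m\<^sup>2)}" "finite (nodes m)"
proof -
  show "nodes m \<subseteq> {- int (2 * m\<^sup>2)..int (2 * m\<^sup>2)}"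
  proof
    fix j assume "j \<in> nodes m"
    then have "of_int j * eps m \<in> {-1..2}" by (rule node_bounds[OF m])
    then have "\<bar>of_int j\<bar> * eps m \<le> 2"
      using eps_pos[OF m(1)] abs_mult[of "of_int j" "eps m"] by auto
    then have "\<bar>of_int j\<bar> \<le> 2 * (real m)\<^sup>2"
      using m(1) by (simp add: eps_def field_simps)
    then have "real_of_int \<bar>j\<bar> \<le> real_of_int (int (2 * m\<^sup>2))" by simp
    then have "\<bar>j\<bar> \<le> int (2 * m\<^sup>2)" unfolding of_int_le_iff .
    then show "j \<in> {- int (2 * m\<^sup>2)..int (2 * m\<^sup>2)}" by auto
  qed
  then show "finite (nodes m)" by (rule finite_subset) simp
qed

lemma Re_w:
  assumes "m \<ge> 1" "p \<in> W"
  shows "Re (w1 m j p) > 0" "Re (w2 m j p) > 0"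
    and "eps m \<le> cmod (w1 m j p)" "eps m \<le> cmod (w2 m j p)"
    and "cmod (u p - cis (of_int j * eps m)) \<le> cmod (w1 m j p)"
    and "cmod (v p - cis (- F (of_int j * eps m))) \<le> cmod (w2 m j p)"
    and "cmod (w1 m j p) \<le> eps m + cmod (u p - cis (of_int j * eps m))"
    and "cmod (w2 m j p) \<le> eps m + cmod (v p - cis (- F (of_int j * eps m)))"
proof -
  have p: "cmod (u p) = 1" "cmod (v p) = 1" using assms(2) by (auto simp: W_def)
  note e = eps_pos[OF assms(1)]
  note a = unit_circle_kernel[OF norm_cis p(1) e, of "of_int j * eps m", folded w1_def]
  note b = unit_circle_kernel[OF norm_cis p(2) e, of "- F (of_int j * eps m)", folded w2_def]
  show "Re (w1 m j p) > 0" "Re (w2 m j p) > 0" using a(1) b(1) e by auto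
  show "eps m \<le> cmod (w1 m j p)" "eps m \<le> cmod (w2 m j p)"
    using a(1) b(1) complex_Re_le_cmod order_trans by blast+
qed (use unit_circle_kernel(2,3)[OF norm_cis _ eps_pos[OF assms(1)]] assms(2) in \<open>auto simp: W_def w1_def w2_def\<close>)

lemma Re_kap: "Re (kap m j p) = eps m * Re (1 / (csqrt (w1 m j p) * csqrt (w2 m j p)))"
proof -
  have "Re (of_real a * z) = a * Re z" for a z by simp
  then show ?thesis unfolding kap_def .
qed

lemma Re_kap_nonneg: "m \<ge> 1 \<Longrightarrow> p \<in> W \<Longrightarrow> Re (kap m j p) \<ge> 0"
proof -
  assume "m \<ge> 1" "p \<in> W"
  then have "eps m * Re (1 / (csqrt (w1 m j p) * csqrt (w2 m j p))) \<ge> 0"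
    by (intro mult_nonneg_nonneg Re_inverse_csqrt_mult Re_w) (auto simp: less_imp_le eps_pos)
  then show ?thesis unfolding Re_kap .
qed

lemma norm_kap: "m \<ge> 1 \<Longrightarrow> cmod (kap m j p) = eps m * (1 / sqrt (cmod (w1 m j p))) * (1 / sqrt (cmod (w2 m j p)))"
  using eps_pos[of m] by (simp add: kap_def norm_mult norm_divide norm_csqrt)

definition h :: "nat \<Rightarrow> real" where "h m = (\<Sum>i=1..m. 1 / (real i + 1))"

text \<open>Only the \<open>m\<close> nodes to the right of \<open>x p\<close> are kept, all other
  terms having nonnegative real part. There \<open>F\<close> is above \<open>y p\<close> as well,
  and since \<open>v\<close> turns the opposite way, the imaginary parts of \<open>w1\<close> and
  \<open>w2\<close> have opposite signs. The \<open>i\<close>-th term then has real part at least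
  \<open>1 / (2 * sqrt L * (i + 1))\<close>.\<close>

lemma Re_S_ge:
  assumes m: "m \<ge> 1" "real m \<ge> L" and p: "p \<in> K" "p \<in> W"
  shows "Re (S m p) \<ge> h m / (2 * sqrt L)"
proof -
  define \<epsilon> where "\<epsilon> = eps m"
  have e: "\<epsilon> > 0" using eps_pos[OF m(1)] by (simp add: \<epsilon>_def)
  have me: "real m * \<epsilon> = 1 / real m" using m(1) by (simp add: \<epsilon>_def eps_def power2_eq_square)
  \<comment> \<open>The last node not to the right of \<open>x p\<close>; from \<open>i = 1\<close>
    on, \<open>j0 + i\<close> is to the right, at distance at most
    \<open>i * \<epsilon>\<close>.\<close>
  define j0 where "j0 = \<lfloor>x p / \<epsilon>\<rfloor>"
  have j0: "of_int j0 * \<epsilon> \<le> x p" "x p < (of_int j0 + 1) * \<epsilon>"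
    unfolding j0_def by (rule floor_divide_lower[OF e], rule floor_divide_upper[OF e])
  have d: "0 \<le> of_int (j0 + int i) * \<epsilon> - x p" "of_int (j0 + int i) * \<epsilon> - x p \<le> real i * \<epsilon>" if "i \<ge> 1" for i
  proof -
    have "1 * \<epsilon> \<le> real i * \<epsilon>" using that e by (intro mult_right_mono) auto
    then show "0 \<le> of_int (j0 + int i) * \<epsilon> - x p" using j0(2) by (simp add: algebra_simps)
    show "of_int (j0 + int i) * \<epsilon> - x p \<le> real i * \<epsilon>" using j0(1) by (simp add: algebra_simps)
  qed
  have k: "1 / (2 * sqrt L) * (1 / (real i + 1)) \<le> Re (kap m (j0 + int i) p)" if i: "i \<in> {1..m}" for i
  proof -
    define j where "j = j0 + int i"
    define t where "t = of_int j * \<epsilon> - x p"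
    have t: "0 \<le> t" "t \<le> real i * \<epsilon>" using d[of i] i by (auto simp: t_def j_def)
    have "real i * \<epsilon> \<le> real m * \<epsilon>" using i e by (intro mult_right_mono) auto
    then have tm: "t \<le> 1 / real m" using t me by simp
    have m1: "1 / real m \<le> 1" "L / real m \<le> 1" using m L by auto
    define s where "s = F (of_int j * \<epsilon>) - y p"
    have s: "0 \<le> s" "s \<le> L * t"
    proof -
      have "0 \<le> t / L" using t(1) L by simp
      moreover have "t / L \<le> s \<and> s \<le> L * t"
        using F[of "x p" "of_int j * \<epsilon>"] t(1) Fx[OF p(1)] by (simp add: t_def s_def)
      ultimately show "0 \<le> s" "s \<le> L * t" by auto
    qed
    have "L * t \<le> L * (1 / real m)" using tm L by (intro mult_left_mono) auto
    then have s1: "s \<le> 1" using s m1 by simp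
    have pi: "1 < pi" using pi_gt3 by simp
    have im1: "Im (w1 m j p) = sin t"
    proof -
      have "cnj (cis (of_int j * \<epsilon>)) * cis (x p) = cis (- t)" by (simp add: cis_cnj cis_mult t_def)
      then show ?thesis unfolding w1_def \<epsilon>_def[symmetric] ux[OF p(1)] by simp
    qed
    have im2: "Im (w2 m j p) = - sin s"
    proof -
      have "cnj (cis (- F (of_int j * \<epsilon>))) * cis (- y p) = cis s" by (simp add: cis_cnj cis_mult s_def)
      then show ?thesis unfolding w2_def \<epsilon>_def[symmetric] vy[OF p(1)] by simp
    qed
    have "Im (w1 m j p) \<ge> 0" unfolding im1 using t(1) tm m1 pi by (intro sin_ge_zero) auto
    moreover have "Im (w2 m j p) \<le> 0" unfolding im2 using s(1) s1 pi sin_ge_zero[of s] by simp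
    ultimately have A: "1 / (2 * sqrt (cmod (w1 m j p) * cmod (w2 m j p))) \<le> Re (1 / (csqrt (w1 m j p) * csqrt (w2 m j p)))"
      using Re_w(1,2)[OF m(1) p(2)] by (intro Re_inverse_csqrt_mult) auto
    have n1: "cmod (w1 m j p) \<le> \<epsilon> * (real i + 1)"
    proof -
      have "cmod (u p - cis (of_int j * \<epsilon>)) \<le> \<bar>x p - of_int j * \<epsilon>\<bar>"
        unfolding ux[OF p(1)] by (rule norm_cis_diff_le)
      also have "\<dots> = t" using t(1) by (simp add: t_def)
      finally show ?thesis using Re_w(7)[OF m(1) p(2), of j] t(2) by (simp add: \<epsilon>_def algebra_simps)
    qed
    have n2: "cmod (w2 m j p) \<le> L * (\<epsilon> * (real i + 1))"
    proof -
      have "cmod (v p - cis (- F (of_int j * \<epsilon>))) \<le> \<bar>- y p - - F (of_int j * \<epsilon>)\<bar>"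
        unfolding vy[OF p(1)] by (rule norm_cis_diff_le)
      also have "\<dots> = s" using s(1) by (simp add: s_def)
      finally have "cmod (w2 m j p) \<le> \<epsilon> + s" using Re_w(8)[OF m(1) p(2), of j] by (simp add: \<epsilon>_def)
      also have "\<dots> \<le> L * \<epsilon> + L * (real i * \<epsilon>)"
      proof -
        have "L * t \<le> L * (real i * \<epsilon>)" using t(2) L by (intro mult_left_mono) auto
        moreover have "1 * \<epsilon> \<le> L * \<epsilon>" using L e by (intro mult_right_mono) auto
        ultimately show ?thesis using s(2) by linarith
      qed
      finally show ?thesis by (simp add: algebra_simps)
    qed
    have w0: "cmod (w1 m j p) > 0" "cmod (w2 m j p) > 0"
      using Re_w(3,4)[OF m(1) p(2), of j] e by (auto simp: \<epsilon>_def)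
    have "cmod (w1 m j p) * cmod (w2 m j p) \<le> (\<epsilon> * (real i + 1)) * (L * (\<epsilon> * (real i + 1)))"
      using e L by (intro mult_mono n1 n2) auto
    also have "\<dots> = L * (\<epsilon> * (real i + 1))\<^sup>2" by (simp add: power2_eq_square)
    finally have "sqrt (cmod (w1 m j p) * cmod (w2 m j p)) \<le> sqrt (L * (\<epsilon> * (real i + 1))\<^sup>2)"
      by (rule real_sqrt_le_mono)
    also have "\<dots> = sqrt L * (\<epsilon> * (real i + 1))" using e by (simp add: real_sqrt_mult)
    finally have B: "sqrt (cmod (w1 m j p) * cmod (w2 m j p)) \<le> sqrt L * (\<epsilon> * (real i + 1))" .
    have "1 / (2 * (sqrt L * (\<epsilon> * (real i + 1)))) \<le> 1 / (2 * sqrt (cmod (w1 m j p) * cmod (w2 m j p)))"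
      using B w0 e L by (intro divide_left_mono mult_left_mono) (auto intro!: mult_pos_pos)
    then have "\<epsilon> * (1 / (2 * (sqrt L * (\<epsilon> * (real i + 1))))) \<le> \<epsilon> * Re (1 / (csqrt (w1 m j p) * csqrt (w2 m j p)))"
      using A e by (intro mult_left_mono) auto
    also have "\<dots> = Re (kap m j p)" unfolding Re_kap \<epsilon>_def ..
    also have "\<epsilon> * (1 / (2 * (sqrt L * (\<epsilon> * (real i + 1))))) = 1 / (2 * sqrt L) * (1 / (real i + 1))"
      using e by simp
    finally show ?thesis by (simp add: j_def)
  qed
  \<comment> \<open>The radius in \<open>nodes\<close> is
    \<open>1 / real m = m * \<epsilon>\<close>, just enough for \<open>m\<close> steps of the
    mesh.\<close>
  have sub: "(\<lambda>i. j0 + int i) ` {1..m} \<subseteq> nodes m"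
  proof (rule image_subsetI)
    fix i assume i: "i \<in> {1..m}"
    have "real i * \<epsilon> \<le> real m * \<epsilon>" using i e by (intro mult_right_mono) auto
    then have "\<bar>of_int (j0 + int i) * \<epsilon> - x p\<bar> \<le> 1 / real m" using d[of i] i me by auto
    then show "j0 + int i \<in> nodes m" using p(1) unfolding nodes_def \<epsilon>_def by blast
  qed
  have "h m / (2 * sqrt L) = (\<Sum>i=1..m. 1 / (2 * sqrt L) * (1 / (real i + 1)))"
    unfolding h_def sum_divide_distrib by (intro sum.cong) (auto simp: field_simps)
  also have "\<dots> \<le> (\<Sum>i=1..m. Re (kap m (j0 + int i) p))" by (rule sum_mono[OF k])
  also have "\<dots> = (\<Sum>j\<in>(\<lambda>i. j0 + int i) ` {1..m}. Re (kap m j p))"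
    by (subst sum.reindex) (auto simp: inj_on_def)
  also have "\<dots> \<le> (\<Sum>j\<in>nodes m. Re (kap m j p))"
    using nodes_subset(2)[OF m] sub Re_kap_nonneg[OF m(1) p(2)] by (intro sum_mono2) auto
  finally show ?thesis by (simp add: S_def)
qed

lemma h_ge: "ln (real m + 2) - ln 2 \<le> h m"
proof (induction m)
  case (Suc m)
  have "ln (real (Suc m) + 2) - ln (real m + 2) = ln (1 + 1 / (real m + 2))"
  proof -
    have "1 + 1 / (real m + 2) = (real (Suc m) + 2) / (real m + 2)" by (simp add: field_simps)
    then show ?thesis using ln_div[of "real (Suc m) + 2" "real m + 2"] by simp
  qed
  also have "\<dots> \<le> 1 / (real m + 2)" by (rule ln_add_one_self_le_self) simp
  finally show ?case using Suc.IH by (simp add: h_def add.commute)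
qed (simp add: h_def)

lemma h_at_top: "filterlim h at_top sequentially"
proof (rule filterlim_at_top_mono)
  show "filterlim (\<lambda>m. ln (real m + 2) - ln 2) at_top sequentially" by real_asymp
qed (use h_ge in auto)

text \<open>A node cannot be close to \<open>p\<close> in both coordinates, so one factor is at most
  \<open>1 / sqrt r\<close> and the product is dominated by a sum of single factors. Inverse square
  roots summed over a separated net of about \<open>m^2\<close> nodes are of order
  \<open>m^2\<close>, which \<open>eps m\<close> cancels.\<close>

lemma norm_S_bounded:
  assumes p: "p \<in> W" "p \<notin> K"
  obtains C where "\<forall>\<^sub>F m in sequentially. cmod (S m p) \<le> C"
proof -
  obtain r0 where r0: "r0 > 0" "\<And>q. q \<in> K \<Longrightarrow> r0 \<le> cmod (u p - u q) + cmod (v p - v q)"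
    using bounded_away_from_compact[OF K p(2)] by blast
  \<comment> \<open>Of the distance \<open>4 * r\<close> the deviation of the nodes from
    \<open>K\<close> may consume \<open>2 * r\<close>; the remaining \<open>2 * r\<close> leaves at
    least \<open>r\<close> in one coordinate.\<close>
  define r where "r = r0 / 4"
  have r: "r > 0" using r0(1) by (simp add: r_def)
  \<comment> \<open>Chord against arc costs \<open>1 / 2\<close>, and the slope of \<open>F\<close>
    costs \<open>1 / L\<close>.\<close>
  define a where "a = 1 / (2 * L)"
  have a: "0 < a" "a \<le> 1" using L by (auto simp: a_def)
  \<comment> \<open>\<open>48 = 2 * 8 * 3\<close>: two coordinates, the 8 of the net estimate, and
    \<open>sqrt (4 * m^2 + 1) \<le> 3 * m\<close>.\<close>
  define C where "C = 48 / (sqrt r * sqrt a)"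
  have "\<forall>\<^sub>F m in sequentially. 1 \<le> m \<and> L \<le> real m \<and> (1 + L) / real m \<le> 2 * r"
  proof (intro eventually_conj)
    show "\<forall>\<^sub>F m in sequentially. L \<le> real m" by real_asymp
    have "(\<lambda>m. (1 + L) / real m) \<longlonglongrightarrow> 0" by real_asymp
    then have "\<forall>\<^sub>F m in sequentially. (1 + L) / real m < 2 * r" using r by (intro order_tendstoD) auto
    then show "\<forall>\<^sub>F m in sequentially. (1 + L) / real m \<le> 2 * r" by eventually_elim simp
  qed (rule eventually_ge_at_top)
  then have "\<forall>\<^sub>F m in sequentially. cmod (S m p) \<le> C"
  proof eventually_elim
    case (elim m)
    then have m: "m \<ge> 1" "real m \<ge> L" and mr: "(1 + L) / real m \<le> 2 * r" by auto
    define e1 where "e1 j = cis (of_int j * eps m)" for j :: int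
    define e2 where "e2 j = cis (- F (of_int j * eps m))" for j :: int
    note e = eps_pos[OF m(1)]
    have far: "r \<le> cmod (w1 m j p) \<or> r \<le> cmod (w2 m j p)" if j: "j \<in> nodes m" for j
    proof -
      obtain q where q: "q \<in> K" "\<bar>of_int j * eps m - x q\<bar> \<le> 1 / real m"
         "\<bar>F (of_int j * eps m) - y q\<bar> \<le> L / real m"
        by (rule node_bounds[OF m j])
      have "cmod (u q - e1 j) \<le> 1 / real m"
        using q(2) norm_cis_diff_le[of "x q" "of_int j * eps m"] ux[OF q(1)] by (simp add: e1_def)
      moreover have "cmod (v q - e2 j) \<le> L / real m"
        using q(3) norm_cis_diff_le[of "- y q" "- F (of_int j * eps m)"] vy[OF q(1)] by (simp add: e2_def)
      moreover have "cmod (u p - u q) \<le> cmod (u p - e1 j) + cmod (u q - e1 j)"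
        using norm_triangle_ineq4[of "u p - e1 j" "u q - e1 j"] by simp
      moreover have "cmod (v p - v q) \<le> cmod (v p - e2 j) + cmod (v q - e2 j)"
        using norm_triangle_ineq4[of "v p - e2 j" "v q - e2 j"] by simp
      moreover have "4 * r \<le> cmod (u p - u q) + cmod (v p - v q)" using r0(2)[OF q(1)] by (simp add: r_def)
      moreover have "1 / real m + L / real m \<le> 2 * r" using mr by (simp add: add_divide_distrib)
      ultimately have "2 * r \<le> cmod (u p - e1 j) + cmod (v p - e2 j)" by linarith
      then show ?thesis using Re_w(5,6)[OF m(1) p(1), of j] unfolding e1_def e2_def by linarith
    qed
    have w0: "cmod (w1 m j p) > 0" "cmod (w2 m j p) > 0" for j
      using Re_w(3,4)[OF m(1) p(1), of j] e by auto
    have kb: "cmod (kap m j p) \<le> eps m / sqrt r * (1 / sqrt (cmod (w1 m j p)) + 1 / sqrt (cmod (w2 m j p)))"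
      if j: "j \<in> nodes m" for j
    proof -
      define A B where "A = 1 / sqrt (cmod (w1 m j p))" and "B = 1 / sqrt (cmod (w2 m j p))"
      have AB: "A > 0" "B > 0" using w0[of j] by (simp_all add: A_def B_def)
      have "A \<le> 1 / sqrt r \<or> B \<le> 1 / sqrt r"
        using far[OF j] r w0[of j] unfolding A_def B_def by (auto intro!: divide_left_mono mult_pos_pos)
      then have "A * B \<le> 1 / sqrt r * (A + B)"
      proof
        assume "A \<le> 1 / sqrt r"
        then have "A * B \<le> 1 / sqrt r * B" using AB by (intro mult_right_mono) auto
        also have "\<dots> \<le> 1 / sqrt r * (A + B)" using AB r by (intro mult_left_mono) auto
        finally show ?thesis .
      next
        assume "B \<le> 1 / sqrt r"
        then have "A * B \<le> A * (1 / sqrt r)" using AB by (intro mult_left_mono) auto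
        also have "\<dots> \<le> (A + B) * (1 / sqrt r)" using AB r by (intro mult_right_mono) auto
        finally show ?thesis by (simp add: mult.commute)
      qed
      then have "eps m * (A * B) \<le> eps m * (1 / sqrt r * (A + B))" using e by (intro mult_left_mono) auto
      then show ?thesis unfolding norm_kap[OF m(1)] A_def[symmetric] B_def[symmetric] by (simp add: mult.assoc)
    qed
    have sep: "a * real_of_int \<bar>i - j\<bar> * eps m \<le> cmod (e1 i - e1 j)"
         "a * real_of_int \<bar>i - j\<bar> * eps m \<le> cmod (e2 i - e2 j)" if ij: "i \<in> nodes m" "j \<in> nodes m" for i j
    proof -
      have bi: "of_int i * eps m \<in> {-1..2}" "F (of_int i * eps m) \<in> {-1..2}"
        by (rule node_bounds[OF m ij(1)]; assumption)+
      have bj: "of_int j * eps m \<in> {-1..2}" "F (of_int j * eps m) \<in> {-1..2}"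
        by (rule node_bounds[OF m ij(2)]; assumption)+
      have abs: "real_of_int \<bar>i - j\<bar> * eps m = \<bar>of_int i * eps m - of_int j * eps m\<bar>"
        using e by (simp add: abs_mult flip: left_diff_distrib)
      have "a * (real_of_int \<bar>i - j\<bar> * eps m) \<le> 1/2 * (real_of_int \<bar>i - j\<bar> * eps m)"
        using e L by (intro mult_right_mono) (auto simp: a_def field_simps)
      also have "\<dots> \<le> cmod (e1 i - e1 j)"
        using norm_cis_diff_ge[of "of_int i * eps m" "of_int j * eps m"] bi(1) bj(1)
        unfolding abs e1_def by auto
      finally show "a * real_of_int \<bar>i - j\<bar> * eps m \<le> cmod (e1 i - e1 j)" by (simp add: mult.assoc)
      have "a * (real_of_int \<bar>i - j\<bar> * eps m) = (real_of_int \<bar>i - j\<bar> * eps m) / L / 2"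
        by (simp add: a_def)
      also have "\<dots> \<le> \<bar>F (of_int i * eps m) - F (of_int j * eps m)\<bar> / 2"
        unfolding abs using F_abs(2) by (intro divide_right_mono) auto
      also have "\<dots> = \<bar>- F (of_int i * eps m) - - F (of_int j * eps m)\<bar> / 2" by simp
      also have "\<dots> \<le> cmod (e2 i - e2 j)"
        unfolding e2_def using bi(2) bj(2) by (intro norm_cis_diff_ge) auto
      finally show "a * real_of_int \<bar>i - j\<bar> * eps m \<le> cmod (e2 i - e2 j)" by (simp add: mult.assoc)
    qed
    define M where "M = 8 / sqrt (a * eps m) * sqrt (real (Suc (2 * (2 * m\<^sup>2))))"
    have s1: "(\<Sum>j\<in>nodes m. 1 / sqrt (cmod (w1 m j p))) \<le> M"
      unfolding M_def
      by (rule sum_inverse_sqrt_dist_le[OF nodes_subset(2,1)[OF m] a e sep(1), where z="u p"])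
         (use Re_w[OF m(1) p(1)] in \<open>auto simp: e1_def\<close>)
    have s2: "(\<Sum>j\<in>nodes m. 1 / sqrt (cmod (w2 m j p))) \<le> M"
      unfolding M_def
      by (rule sum_inverse_sqrt_dist_le[OF nodes_subset(2,1)[OF m] a e sep(2), where z="v p"])
         (use Re_w[OF m(1) p(1)] in \<open>auto simp: e2_def\<close>)
    have "real (Suc (2 * (2 * m\<^sup>2))) \<le> (3 * real m)\<^sup>2"
    proof -
      have "1 \<le> real m * real m" using m(1) mult_mono[of 1 "real m" 1 "real m"] by simp
      then show ?thesis by (simp add: power2_eq_square)
    qed
    then have "sqrt (real (Suc (2 * (2 * m\<^sup>2)))) \<le> 3 * real m" by (intro real_le_lsqrt) auto
    then have "8 / (sqrt a / real m) * sqrt (real (Suc (2 * (2 * m\<^sup>2)))) \<le> 8 / (sqrt a / real m) * (3 * real m)"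
      by (rule mult_left_mono) (use a in simp)
    moreover have "sqrt (a * eps m) = sqrt a / real m" by (simp add: eps_def real_sqrt_divide)
    ultimately have M: "M \<le> 8 / (sqrt a / real m) * (3 * real m)"
      unfolding M_def by simp
    have "cmod (S m p) \<le> (\<Sum>j\<in>nodes m. eps m / sqrt r * (1 / sqrt (cmod (w1 m j p)) + 1 / sqrt (cmod (w2 m j p))))"
      unfolding S_def by (rule sum_norm_le[OF kb])
    also have "\<dots> = eps m / sqrt r * ((\<Sum>j\<in>nodes m. 1 / sqrt (cmod (w1 m j p))) + (\<Sum>j\<in>nodes m. 1 / sqrt (cmod (w2 m j p))))"
      by (simp only: sum_distrib_left[symmetric] sum.distrib)
    also have "\<dots> \<le> eps m / sqrt r * (2 * (8 / (sqrt a / real m) * (3 * real m)))"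
      using s1 s2 M e r by (intro mult_left_mono) auto
    also have "\<dots> = C" using m(1) by (simp add: C_def eps_def power2_eq_square)
    finally show ?case .
  qed
  then show ?thesis by (rule that)
qed

lemma mult_indicator_bilipschitz:
  assumes KW: "K \<subseteq> W"
  shows "mult (indicator K)"
proof -
  have h0: "h m \<ge> 0" for m unfolding h_def by (intro sum_nonneg) auto
  \<comment> \<open>The index starts at 1, where \<open>eps\<close> is positive. Dividing by
    \<open>sqrt (h m)\<close> rather than \<open>h m\<close> keeps the exponent divergent on
    \<open>K\<close> and still sends it to 0 off \<open>K\<close>.\<close>
  define G where "G n p = exp (of_real (- (1 / sqrt (h (Suc n)))) * S (Suc n) p)" for n p
  have nG: "cmod (G n p) = exp (- (Re (S (Suc n) p) / sqrt (h (Suc n))))" for n p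
    by (simp add: G_def norm_exp_eq_Re)
  have mG: "mult (G n)" for n
  proof -
    have "mult (\<lambda>p. kap (Suc n) j p)" for j
      unfolding kap_def w1_def w2_def by (intro mult_csqrt_kernels eps_pos) auto
    then have "mult (\<lambda>p. S (Suc n) p)" unfolding S_def by (intro mult_sum)
    then show ?thesis unfolding G_def by (intro mult_exp mult_mult mult_const)
  qed
  have "mult (\<lambda>p. 1 - indicator K p)"
  proof (rule mult_limit[OF mG, where B=1])
    have [measurable]: "K \<in> sets borel" using compact_imp_closed[OF K] by simp
    show "(\<lambda>p. 1 - indicator K p :: complex) \<in> borel_measurable borel" by measurable
    show "cmod (G n p) \<le> 1" if "p \<in> W" for n p
    proof -
      have "Re (S (Suc n) p) \<ge> 0"
        unfolding S_def Re_sum using that by (intro sum_nonneg Re_kap_nonneg) auto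
      then show ?thesis unfolding nG using h0[of "Suc n"] by simp
    qed
    show "(\<lambda>n. G n p) \<longlonglongrightarrow> 1 - indicator K p" if p: "p \<in> W" for p
    proof (cases "p \<in> K")
      case True
      have "(\<lambda>n. G n p) \<longlonglongrightarrow> 0"
      proof (rule Lim_null_comparison)
        have ev: "\<forall>\<^sub>F m in sequentially. 1 \<le> m \<and> L \<le> real m"
          by (intro eventually_conj eventually_ge_at_top) real_asymp
        have ev2: "\<forall>\<^sub>F n in sequentially. 1 \<le> Suc n \<and> L \<le> real (Suc n)"
          using ev by (subst eventually_sequentially_Suc)
        show "\<forall>\<^sub>F n in sequentially. cmod (G n p) \<le> exp (- (sqrt (h (Suc n)) / (2 * sqrt L)))"
          using ev2
        proof eventually_elim
          case (elim n)
          have "sqrt (h (Suc n)) / (2 * sqrt L) = h (Suc n) / (2 * sqrt L) / sqrt (h (Suc n))"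
            using real_div_sqrt[OF h0[of "Suc n"]] by (metis divide_divide_eq_left mult.commute)
          also have "\<dots> \<le> Re (S (Suc n) p) / sqrt (h (Suc n))"
            using Re_S_ge[of "Suc n" p] elim True p h0[of "Suc n"] by (intro divide_right_mono) auto
          finally show ?case unfolding nG by simp
        qed
        have "filterlim (\<lambda>n. h (Suc n)) at_top sequentially"
          by (rule filterlim_compose[OF h_at_top filterlim_Suc])
        then have "filterlim (\<lambda>n. sqrt (h (Suc n)) / (2 * sqrt L)) at_top sequentially"
          using L by (intro filterlim_at_top_mult_tendsto_pos[where c="1 / (2 * sqrt L)", of "\<lambda>_. 1 / (2 * sqrt L)", simplified]
            filterlim_compose[OF sqrt_at_top]) auto
        then show "(\<lambda>n. exp (- (sqrt (h (Suc n)) / (2 * sqrt L)))) \<longlonglongrightarrow> 0"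
          by (intro filterlim_compose[OF exp_at_bot] filterlim_uminus_at_top[THEN iffD1]) simp
      qed
      then show ?thesis using True by simp
    next
      case False
      obtain C where C: "\<forall>\<^sub>F m in sequentially. cmod (S m p) \<le> C" by (rule norm_S_bounded[OF p False])
      have C': "\<forall>\<^sub>F n in sequentially. cmod (S (Suc n) p) \<le> C"
        using C by (subst eventually_sequentially_Suc)
      have "(\<lambda>n. of_real (- (1 / sqrt (h (Suc n)))) * S (Suc n) p) \<longlonglongrightarrow> 0"
      proof (rule Lim_null_comparison)
        show "\<forall>\<^sub>F n in sequentially. cmod (of_real (- (1 / sqrt (h (Suc n)))) * S (Suc n) p) \<le> C * (1 / sqrt (h (Suc n)))"
          using C'
        proof eventually_elim
          case (elim n)
          have "cmod (of_real (- (1 / sqrt (h (Suc n)))) * S (Suc n) p) = cmod (S (Suc n) p) * (1 / sqrt (h (Suc n)))"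
            unfolding norm_mult norm_of_real using h0[of "Suc n"] by simp
          also have "\<dots> \<le> C * (1 / sqrt (h (Suc n)))"
            using elim h0[of "Suc n"] by (intro mult_right_mono) auto
          finally show ?case .
        qed
        have "filterlim (\<lambda>n. sqrt (h (Suc n))) at_top sequentially"
          by (rule filterlim_compose[OF sqrt_at_top filterlim_compose[OF h_at_top filterlim_Suc]])
        then have "(\<lambda>n. 1 / sqrt (h (Suc n))) \<longlonglongrightarrow> 0"
          by (intro tendsto_divide_0[OF tendsto_const] filterlim_at_top_imp_at_infinity)
        then show "(\<lambda>n. C * (1 / sqrt (h (Suc n)))) \<longlonglongrightarrow> 0" by (rule tendsto_mult_right_zero)
      qed
      from tendsto_exp[OF this] show ?thesis using False by (simp add: G_def)
    qed
  qed
  from mult_diff[OF mult_const[of 1] this] show ?thesis by simp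
qed

end

section \<open>Increasing graphs are null\<close>

lemma inj_on_cis: "inj_on cis {0..1}"
proof (rule inj_onI)
  fix s t :: real assume "s \<in> {0..1}" "t \<in> {0..1}" "cis s = cis t"
  then show "s = t" using norm_cis_diff_ge[of s t] by auto
qed

context analytic_pair
begin

text \<open>The exchange lets results on the first projection serve for the second.\<close>

lemma swap: "analytic_pair P N v u"
proof (rule analytic_pair.intro)
  show "(\<integral>x. v x ^ k * u x ^ l \<partial>P) = (\<integral>x. v x ^ k * u x ^ l \<partial>N)" if "1 \<le> k" "1 \<le> l" for k l
    using orth[OF that(2,1)] by (simp add: mult.commute)
  show "AE x in P. cmod (v x) = 1 \<and> cmod (u x) = 1" using AE_P by eventually_elim simp
  show "AE x in N. cmod (v x) = 1 \<and> cmod (u x) = 1" using AE_N by eventually_elim simp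
  show "x = y" if "v x = v y" "u x = u y" for x y by (rule uv_inj[OF that(2,1)])
qed (rule sets_P sets_N finite_P finite_N jordan cont_u cont_v)+

text \<open>Inner regularity of finite Borel measures. It is called for because the exceptional
  pieces of the graph, and the pieces cut out by a discontinuous function, need not be
  compact.\<close>

lemma null_if_compact_subsets_null:
  assumes B: "B \<in> sets borel"
    and C: "\<And>C. compact C \<Longrightarrow> C \<subseteq> B \<Longrightarrow> emeasure P C = 0 \<and> emeasure N C = 0"
  shows "emeasure P B = 0 \<and> emeasure N B = 0"
proof -
  have "emeasure P (space P) \<noteq> \<infinity>" "emeasure N (space N) \<noteq> \<infinity>"
    using finite_measure.emeasure_finite[OF finite_P] finite_measure.emeasure_finite[OF finite_N] by auto
  then have "emeasure P B = (SUP K\<in>{K. K \<subseteq> B \<and> compact K}. emeasure P K)"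
    "emeasure N B = (SUP K\<in>{K. K \<subseteq> B \<and> compact K}. emeasure N K)"
    using inner_regular[OF sets_P _ B] inner_regular[OF sets_N _ B] by auto
  moreover have "(SUP K\<in>{K. K \<subseteq> B \<and> compact K}. emeasure P K) \<le> 0"
     "(SUP K\<in>{K. K \<subseteq> B \<and> compact K}. emeasure N K) \<le> 0"
    using C by (intro SUP_least; simp)+
  ultimately show ?thesis by simp
qed

text \<open>Nullity asks for the indicators of all compact subsets; each inherits the two slope
  bounds and gets an extension of its own.\<close>

lemma null_bilipschitz_graph:
  assumes K: "compact K" "K \<subseteq> W" and L: "L \<ge> 1"
    and xy: "\<And>p. p \<in> K \<Longrightarrow> x p \<in> {0..1} \<and> y p \<in> {0..1} \<and> u p = cis (x p) \<and> v p = cis (- y p)"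
    and bil: "\<And>p q. p \<in> K \<Longrightarrow> q \<in> K \<Longrightarrow> x p \<le> x q \<Longrightarrow>
      (x q - x p) / L \<le> y q - y p \<and> y q - y p \<le> L * (x q - x p)"
  shows "emeasure P K = 0 \<and> emeasure N K = 0"
proof (rule null_if_mult[OF K(1)])
  note KW = K(2)
  fix C assume C: "compact C" "C \<subseteq> K"
  show "mult (indicator C)"
  proof (cases "C = {}")
    case True
    moreover have "indicator {} = (\<lambda>p::'a. 0::complex)" by (auto simp: fun_eq_iff)
    ultimately show ?thesis using mult_const[of 0] by simp
  next
    case False
    obtain F where F: "\<And>p. p \<in> C \<Longrightarrow> F (x p) = y p"
      "\<And>s t. s \<le> t \<Longrightarrow> (t - s) / L \<le> F t - F s \<and> F t - F s \<le> L * (t - s)"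
      by (rule increasing_bilipschitz_extension[OF L False, of x y]) (use bil C(2) in blast)+
    interpret bilipschitz_graph P N u v C x y L F
      using C False xy F L by unfold_locales auto
    show ?thesis using C(2) KW by (intro mult_indicator_bilipschitz) auto
  qed
qed

text \<open>The slope bound in \<open>A n\<close> runs over all of \<open>K\<close>, not over a
  neighbourhood of \<open>p\<close>; this makes \<open>A n\<close> closed. Outside all
  \<open>A n\<close> the secants are arbitrarily steep, so the first projection is null. The map
  \<open>e\<close> stands for \<open>cis\<close> or for its conjugate, so that both coordinates can
  be treated.\<close>

lemma null_steep_points:
  fixes x y :: "'a \<Rightarrow> real" and K :: "'a set"
  defines "A \<equiv> \<lambda>n::nat. {p\<in>K. \<forall>q\<in>K. \<bar>y p - y q\<bar> \<le> real n * \<bar>x p - x q\<bar>}"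
  assumes K: "compact K" "K \<subseteq> W" and cont: "continuous_on K x" "continuous_on K y"
    and xy: "\<And>p. p \<in> K \<Longrightarrow> x p \<in> {0..1} \<and> y p \<in> {0..1} \<and> u p = e (x p)"
    and e: "inj_on e {0..1}" "\<And>s t. dist (e s) (e t) \<le> dist s t" and inj: "inj_on x K"
    and mono: "\<And>p q. p \<in> K \<Longrightarrow> q \<in> K \<Longrightarrow> x p < x q \<Longrightarrow> y p < y q"
  shows "closed (A n)" "emeasure P (K - (\<Union>n. A n)) = 0 \<and> emeasure N (K - (\<Union>n. A n)) = 0"
proof -
  have Kc: "closed K" by (rule compact_imp_closed[OF K(1)])
  show A: "closed (A n)" for n
  proof -
    have "A n = K \<inter> (\<Inter>q\<in>K. {p\<in>K. \<bar>y p - y q\<bar> \<le> real n * \<bar>x p - x q\<bar>})" by (auto simp: A_def)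
    also have "closed \<dots>"
      using Kc cont by (intro closed_Int closed_INT ballI continuous_on_closed_Collect_le continuous_intros) auto
    finally show ?thesis .
  qed
  show "emeasure P (K - (\<Union>n. A n)) = 0 \<and> emeasure N (K - (\<Union>n. A n)) = 0"
  proof (rule null_if_compact_subsets_null)
    show "K - (\<Union>n. A n) \<in> sets borel" using A Kc by auto
    fix C assume C: "compact C" "C \<subseteq> K - (\<Union>n. A n)"
    then have CK: "C \<subseteq> K" by auto
    \<comment> \<open>Meaningful on the image of \<open>K\<close> under \<open>x\<close> only, which
      is where the steepness argument reads it.\<close>
    define f where "f t = y (the_inv_into K x t)" for t
    have f: "f (x p) = y p" if "p \<in> K" for p
      unfolding f_def by (simp add: the_inv_into_f_f[OF inj that])
    have "content_zero (x ` C)"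
    proof (rule content_zero_steep[where S="x ` K" and f=f])
      show "compact (x ` C)" by (intro compact_continuous_image C continuous_on_subset[OF cont(1) CK])
      show "x ` C \<subseteq> x ` K" using CK by auto
      show "x ` K \<subseteq> {0..1}" using xy by blast
      show "f s \<in> {0..1}" if "s \<in> x ` K" for s using that xy f by auto
      show "f s \<le> f t" if st: "s \<in> x ` K" "t \<in> x ` K" "s \<le> t" for s t
      proof -
        obtain p where p: "p \<in> K" "s = x p" using st(1) by blast
        obtain q where q: "q \<in> K" "t = x q" using st(2) by blast
        show ?thesis
        proof (cases "s = t")
          case False
          then have "y p < y q" using mono[OF p(1) q(1)] st(3) p(2) q(2) by simp
          then show ?thesis using f p q by simp
        qed simp
      qed
      fix s L assume "s \<in> x ` C"
      then obtain p where p: "p \<in> C" "s = x p" by blast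
      obtain n where n: "L \<le> real n" using real_arch_simple by blast
      have pK: "p \<in> K" using p CK by blast
      have "p \<notin> A n" using p C(2) by blast
      then obtain q where q: "q \<in> K" "\<not> \<bar>y p - y q\<bar> \<le> real n * \<bar>x p - x q\<bar>"
        using pK unfolding A_def by blast
      have "L * \<bar>x p - x q\<bar> \<le> real n * \<bar>x p - x q\<bar>" using n by (intro mult_right_mono) auto
      then have "\<bar>f s - f (x q)\<bar> > L * \<bar>s - x q\<bar>" using q(2) f[OF q(1)] f[OF pK] p(2) by simp
      then show "\<exists>s'\<in>x ` K. \<bar>f s - f s'\<bar> > L * \<bar>s - s'\<bar>" using q(1) by blast
    qed
    then have "content_zero (e ` x ` C)" by (rule content_zero_image[OF _ e(2)])
    moreover have "e ` x ` C = u ` C"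
      unfolding image_image using xy CK by (intro image_cong refl) (metis subsetD)
    moreover have "inj_on u C"
    proof (rule inj_onI)
      fix p q assume pq: "p \<in> C" "q \<in> C" "u p = u q"
      then have pqK: "p \<in> K" "q \<in> K" using CK by auto
      then have "e (x p) = e (x q)" "x p \<in> {0..1}" "x q \<in> {0..1}" using xy pq(3) by metis+
      then have "x p = x q" using inj_onD[OF e(1)] by blast
      then show "p = q" using inj_onD[OF inj] pqK by blast
    qed
    ultimately show "emeasure P C = 0 \<and> emeasure N C = 0"
      using C(1) CK K(2) by (intro null_if_content_zero) auto
  qed
qed

text \<open>Membership in \<open>A n\<close> bounds the secant slopes above, membership in
  \<open>B n\<close> bounds them below, and each complement has one null projection. The equivalence
  in \<open>mono\<close> states strict increase symmetrically in \<open>x\<close> and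
  \<open>y\<close>, so it survives the exchange of coordinates.\<close>

lemma null_increasing_graph:
  assumes K: "compact K" "K \<subseteq> W" and cont: "continuous_on K x" "continuous_on K y"
    and xy: "\<And>p. p \<in> K \<Longrightarrow> x p \<in> {0..1} \<and> y p \<in> {0..1} \<and> u p = cis (x p) \<and> v p = cis (- y p)"
    and mono: "\<And>p q. p \<in> K \<Longrightarrow> q \<in> K \<Longrightarrow> x p < x q \<longleftrightarrow> y p < y q"
  shows "emeasure P K = 0 \<and> emeasure N K = 0"
proof -
  interpret swapped: analytic_pair P N v u by (rule swap)
  have W': "swapped.W = W" by (auto simp: W_def swapped.W_def)
  have Kc: "closed K" by (rule compact_imp_closed[OF K(1)])
  have eq: "x p = x q \<longleftrightarrow> y p = y q" if "p \<in> K" "q \<in> K" for p q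
    using mono[OF that] mono[OF that(2,1)] by linarith
  have inj: "p = q" if "p \<in> K" "q \<in> K" "x p = x q" for p q
  proof -
    have "u p = u q" "v p = v q" using that eq[OF that(1,2)] xy by auto
    then show ?thesis by (rule uv_inj)
  qed
  have e: "inj_on (\<lambda>t. cis (- t)) {0..1}"
  proof (rule inj_onI)
    fix s t :: real assume *: "s \<in> {0..1}" "t \<in> {0..1}" "cis (- s) = cis (- t)"
    then have "\<bar>- s - - t\<bar> \<le> 3" by auto
    from norm_cis_diff_ge[OF this] show "s = t" using *(3) by simp
  qed
  have d: "dist (cis s) (cis t) \<le> dist s t" "dist (cis (- s)) (cis (- t)) \<le> dist s t" for s t
    using norm_cis_diff_le[of s t] norm_cis_diff_le[of "- s" "- t"] by (simp_all add: dist_norm)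
  define A where "A n = {p\<in>K. \<forall>q\<in>K. \<bar>y p - y q\<bar> \<le> real n * \<bar>x p - x q\<bar>}" for n
  define B where "B n = {p\<in>K. \<forall>q\<in>K. \<bar>x p - x q\<bar> \<le> real n * \<bar>y p - y q\<bar>}" for n
  have inj_xy: "inj_on x K" "inj_on y K" using inj eq by (auto simp: inj_on_def)
  have xcis: "x p \<in> {0..1} \<and> y p \<in> {0..1} \<and> u p = cis (x p)"
    and ycis: "y p \<in> {0..1} \<and> x p \<in> {0..1} \<and> v p = cis (- y p)" if "p \<in> K" for p
    using xy[OF that] by auto
  have mono': "x p < x q \<Longrightarrow> y p < y q" "y p < y q \<Longrightarrow> x p < x q" if "p \<in> K" "q \<in> K" for p q
    using mono[OF that] by auto
  note steepA = null_steep_points[OF K cont xcis inj_on_cis d(1) inj_xy(1) mono'(1), folded A_def]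
  note steepB = swapped.null_steep_points[OF K(1) K(2)[folded W'] cont(2,1) ycis e d(2) inj_xy(2) mono'(2), folded B_def]
  have A: "closed (A n)" for n by (rule steepA(1))
  have B: "closed (B n)" for n by (rule steepB(1))
  have Q: "emeasure P (A n \<inter> B n) = 0 \<and> emeasure N (A n \<inter> B n) = 0" for n
  \<comment> \<open>\<open>Suc n\<close> replaces \<open>n\<close> because the Lipschitz constant
    has to be at least 1.\<close>
  proof (rule null_bilipschitz_graph[where L="real (Suc n)" and x=x and y=y])
    have "A n \<inter> B n = K \<inter> (A n \<inter> B n)" by (auto simp: A_def)
    then show "compact (A n \<inter> B n)" using compact_Int_closed[OF K(1) closed_Int[OF A B]] by metis
    show "A n \<inter> B n \<subseteq> W" using K(2) by (auto simp: A_def)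
    show "x p \<in> {0..1} \<and> y p \<in> {0..1} \<and> u p = cis (x p) \<and> v p = cis (- y p)" if "p \<in> A n \<inter> B n" for p
      using xy[of p] that by (simp add: A_def)
    show "(x q - x p) / real (Suc n) \<le> y q - y p \<and> y q - y p \<le> real (Suc n) * (x q - x p)"
      if p: "p \<in> A n \<inter> B n" and q: "q \<in> A n \<inter> B n" and le: "x p \<le> x q" for p q
    proof -
      have pK: "p \<in> K" "q \<in> K" using p q by (auto simp: A_def)
      have y: "y p \<le> y q" using mono[OF pK(2,1)] le by linarith
      have "\<bar>y p - y q\<bar> \<le> real n * \<bar>x p - x q\<bar>" "\<bar>x p - x q\<bar> \<le> real n * \<bar>y p - y q\<bar>"
        using p pK by (auto simp: A_def B_def)
      then have "y q - y p \<le> real n * (x q - x p)" "x q - x p \<le> real n * (y q - y p)"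
        using y le by auto
      then have "y q - y p \<le> real (Suc n) * (x q - x p)" "x q - x p \<le> real (Suc n) * (y q - y p)"
        using y le by (auto simp: algebra_simps)
      then show ?thesis by (simp add: divide_le_eq mult.commute)
    qed
  qed simp
  \<comment> \<open>Growth in the index lets a single \<open>n\<close> serve for both slope
    bounds.\<close>
  have mono_A: "A m \<subseteq> A n" "B m \<subseteq> B n" if "m \<le> n" for m n
  proof -
    have "real m * \<bar>t\<bar> \<le> real n * \<bar>t\<bar>" for t using that by (intro mult_right_mono) auto
    then show "A m \<subseteq> A n" "B m \<subseteq> B n" unfolding A_def B_def by (auto intro: order_trans)
  qed
  have cover: "K \<subseteq> (\<Union>n. A n \<inter> B n) \<union> (K - (\<Union>n. A n)) \<union> (K - (\<Union>n. B n))"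
  proof
    fix p assume p: "p \<in> K"
    show "p \<in> (\<Union>n. A n \<inter> B n) \<union> (K - (\<Union>n. A n)) \<union> (K - (\<Union>n. B n))"
    proof (cases "p \<in> (\<Union>n. A n) \<and> p \<in> (\<Union>n. B n)")
      case True
      then obtain m n where "p \<in> A m" "p \<in> B n" by auto
      then have "p \<in> A (max m n) \<inter> B (max m n)" using mono_A by (meson IntI max.cobounded1 max.cobounded2 subsetD)
      then show ?thesis by blast
    qed (use p in auto)
  qed
  have sets: "A n \<in> sets borel" "B n \<in> sets borel" "K \<in> sets borel" for n using A B Kc by auto
  have null: "K \<in> null_sets M" if s: "sets M = sets borel" 
    and "\<And>n. emeasure M (A n \<inter> B n) = 0" "emeasure M (K - (\<Union>n. A n)) = 0" "emeasure M (K - (\<Union>n. B n)) = 0"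
    for M :: "'a measure"
  proof (rule null_sets_subset[OF _ _ cover])
    show "(\<Union>n. A n \<inter> B n) \<union> (K - (\<Union>n. A n)) \<union> (K - (\<Union>n. B n)) \<in> null_sets M"
      using that sets by (intro null_sets.Un null_sets_UN null_setsI) (auto simp: s)
  qed (use sets s in auto)
  show ?thesis using null[OF sets_P] null[OF sets_N] Q steepA(2) steepB(2) by (auto simp: null_sets_def)
qed

end

section \<open>Moments of RP-measures\<close>

text \<open>Arc length, of total mass \<open>2 * pi\<close>; the point 1 is hit twice, but by
  parameters of measure zero.\<close>

definition circle_measure :: "complex measure" where
  "circle_measure = distr (restrict_space lborel {0..2 * pi}) borel cis"

lemma cis_meas: "cis \<in> borel_measurable borel"
  by (intro borel_measurable_continuous_onI continuous_intros)

lemma cis_meas_restrict: "cis \<in> borel_measurable (restrict_space lborel {0..2 * pi})"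
  by (intro measurable_restrict_space1) (use cis_meas in simp)

lemma sets_circle [measurable_cong]: "sets circle_measure = sets borel" and space_circle: "space circle_measure = UNIV"
  by (simp_all add: circle_measure_def)

lemma finite_circle: "finite_measure circle_measure"
proof -
  have "finite_measure (restrict_space lborel {0..2 * pi})"
    by (rule finite_measureI) (simp add: emeasure_restrict_space space_restrict_space)
  then show ?thesis unfolding circle_measure_def
    by (rule finite_measure.finite_measure_distr) (rule cis_meas_restrict)
qed

lemma AE_circle: "AE z in circle_measure. cmod z = 1"
  unfolding circle_measure_def by (subst AE_distr_iff[OF cis_meas_restrict]) (auto intro!: closed_Collect_eq borel_closed continuous_intros)

lemma circle_AE: "{z. cmod z = 1} \<in> sets borel" "AE z in circle_measure. z \<in> {z. cmod z = 1}"
  using AE_circle by (auto intro!: borel_closed closed_Collect_eq continuous_intros)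

lemma integral_circle:
  fixes F :: "complex \<Rightarrow> complex"
  assumes "F \<in> borel_measurable borel"
  shows "(\<integral>z. F z \<partial>circle_measure) = (\<integral>t. indicator {0..2 * pi} t *\<^sub>R F (cis t) \<partial>lborel)"
  unfolding circle_measure_def by (subst integral_distr[OF cis_meas_restrict assms]) (simp add: integral_restrict_space)

lemma integrable_borel_bounded:
  fixes f :: "'a::topological_space \<Rightarrow> 'b::{banach, second_countable_topology}"
  assumes "finite_measure M" "sets M = sets borel" "f \<in> borel_measurable borel"
    and "AE x in M. x \<in> A" "\<And>x. x \<in> A \<Longrightarrow> norm (f x) \<le> B"
  shows "integrable M f"
proof (rule finite_measure.integrable_const_bound[OF assms(1)])
  show "AE x in M. norm (f x) \<le> B" using assms(4) by eventually_elim (rule assms(5))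
  show "f \<in> borel_measurable M" using assms(2,3) by (simp cong: measurable_cong_sets)
qed

lemma norm_integral_le_bound:
  fixes f :: "'a::topological_space \<Rightarrow> 'b::{banach, second_countable_topology}"
  assumes "finite_measure M" "sets M = sets borel" "f \<in> borel_measurable borel"
    and "AE x in M. x \<in> A" "\<And>x. x \<in> A \<Longrightarrow> norm (f x) \<le> B"
  shows "norm (\<integral>x. f x \<partial>M) \<le> B * measure M (space M)"
proof -
  have "norm (\<integral>x. f x \<partial>M) \<le> (\<integral>x. norm (f x) \<partial>M)" by (rule integral_norm_bound)
  also have "\<dots> \<le> (\<integral>x. B \<partial>M)"
  proof (rule integral_mono_AE)
    show "integrable M (\<lambda>x. norm (f x))" using integrable_borel_bounded[OF assms] by (rule integrable_norm)
    show "integrable M (\<lambda>x. B)" by (rule finite_measure.integrable_const[OF assms(1)])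
    show "AE x in M. norm (f x) \<le> B" using assms(4) by eventually_elim (rule assms(5))
  qed
  finally show ?thesis by (simp add: mult.commute)
qed

lemma integral_circle_power: "(\<integral>z. z ^ n \<partial>circle_measure) = (if n = 0 then 2 * pi else 0)"
proof -
  define G where "G t = (if n = 0 then of_real t else cis (real n * t) / (\<i> * of_nat n))" for t
  have "(\<integral>z. z ^ n \<partial>circle_measure) = (\<integral>t. indicator {0..2 * pi} t *\<^sub>R (cis t ^ n) \<partial>lborel)"
    by (rule integral_circle) measurable
  also have "\<dots> = G (2 * pi) - G 0"
  proof (rule integral_FTC_atLeastAtMost)
    fix t :: real
    show "(G has_vector_derivative cis t ^ n) (at t within {0..2 * pi})"
    proof (cases "n = 0")
      case True
      then show ?thesis by (auto simp: G_def[abs_def] intro!: derivative_eq_intros)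
    next
      case False
      have "((\<lambda>z. exp (\<i> * of_nat n * z) / (\<i> * of_nat n)) has_field_derivative exp (\<i> * of_nat n * of_real t))
          (at (of_real t))"
        using False by (auto intro!: derivative_eq_intros)
      from has_vector_derivative_real_field[OF this]
      have "((\<lambda>t. exp (\<i> * of_nat n * of_real t) / (\<i> * of_nat n)) has_vector_derivative
          exp (\<i> * of_nat n * of_real t)) (at t within {0..2 * pi})" .
      moreover have "exp (\<i> * of_nat n * of_real t) = cis (real n * t)" for t
        by (simp add: cis_conv_exp mult.assoc)
      ultimately show ?thesis using False unfolding G_def[abs_def] Complex.DeMoivre by simp
    qed
  qed (auto intro!: continuous_intros)
  also have "\<dots> = (if n = 0 then 2 * pi else 0)"
  proof -
    have "cis (real n * (2 * pi)) = 1"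
      using cis_multiple_2pi[of "real n"] by (metis Ints_of_nat mult.commute)
    then show ?thesis by (simp add: G_def)
  qed
  finally show ?thesis .
qed

text \<open>The mean value property, by power series and dominated convergence. \<open>G\<close> is
  kept apart from \<open>g\<close> because \<open>g\<close> is holomorphic on a disc only, while the
  integrand has to be Borel on the whole plane.\<close>

lemma integral_circle_holomorphic:
  fixes g :: "complex \<Rightarrow> complex"
  assumes g: "g holomorphic_on ball 0 R" "R > 1" and G: "G \<in> borel_measurable borel"
    and eq: "\<And>z. cmod z = 1 \<Longrightarrow> G z = g z"
  shows "(\<integral>z. G z \<partial>circle_measure) = of_real (2 * pi) * g 0"
proof -
  define a where "a n = (deriv ^^ n) g 0 / fact n" for n
  have s: "(\<lambda>n. a n * w ^ n) sums g w" if "w \<in> ball 0 R" for w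
    using holomorphic_power_series[OF g(1) that] unfolding a_def by simp
  define r where "r = (1 + R) / 2"
  have r: "1 < r" "r < R" using g(2) by (auto simp: r_def)
  have "summable (\<lambda>n. a n * of_real r ^ n)"
    using s[of "of_real r"] r by (auto simp: sums_iff)
  then have "summable (\<lambda>n. cmod (a n * 1 ^ n))"
    by (rule powser_insidea) (use r in auto)
  then have sm: "summable (\<lambda>n. cmod (a n))" by (simp add: norm_mult)
  have "(\<lambda>n. \<integral>z. (\<Sum>i<n. a i * z ^ i) \<partial>circle_measure) \<longlonglongrightarrow> (\<integral>z. G z \<partial>circle_measure)"
  proof (rule integral_dominated_convergence[where w="\<lambda>_. \<Sum>n. cmod (a n)"])
    show "integrable circle_measure (\<lambda>_. \<Sum>n. cmod (a n))"
      using finite_circle by (simp add: finite_measure.integrable_const)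
    show "AE z in circle_measure. (\<lambda>n. \<Sum>i<n. a i * z ^ i) \<longlonglongrightarrow> G z"
      using AE_circle
    proof eventually_elim
      case (elim z)
      then show ?case using s[of z] g(2) eq[OF elim] by (simp add: sums_def)
    qed
    show "AE z in circle_measure. cmod (\<Sum>i<n. a i * z ^ i) \<le> (\<Sum>n. cmod (a n))" for n
      using AE_circle
    proof eventually_elim
      case (elim z)
      have "cmod (\<Sum>i<n. a i * z ^ i) \<le> (\<Sum>i<n. cmod (a i))"
        by (rule sum_norm_le) (use elim in \<open>simp add: norm_mult norm_power\<close>)
      also have "\<dots> \<le> (\<Sum>n. cmod (a n))" using sm by (intro sum_le_suminf) auto
      finally show ?case .
    qed
  qed (use G in \<open>simp_all cong: measurable_cong_sets add: sets_circle\<close>)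
  moreover have moment: "(\<integral>z. (\<Sum>i<n. a i * z ^ i) \<partial>circle_measure) = of_real (2 * pi) * a 0" if "n > 0" for n
  proof -
    have "integrable circle_measure (\<lambda>z. a i * z ^ i)" for i
      by (rule integrable_borel_bounded[OF finite_circle sets_circle _ circle_AE(2), where B="cmod (a i)"])
         (measurable, simp add: norm_mult norm_power)
    then have "(\<integral>z. (\<Sum>i<n. a i * z ^ i) \<partial>circle_measure) = (\<Sum>i<n. a i * (\<integral>z. z ^ i \<partial>circle_measure))"
      by (simp only: Bochner_Integration.integral_sum integral_mult_right_zero)
    also have "\<dots> = (\<Sum>i<n. if i = 0 then a 0 * of_real (2 * pi) else 0)"
      by (intro sum.cong) (auto simp: integral_circle_power)
    finally show ?thesis using that by (simp add: mult.commute)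
  qed
  have "\<forall>\<^sub>F n in sequentially. (\<integral>z. (\<Sum>i<n. a i * z ^ i) \<partial>circle_measure) = of_real (2 * pi) * a 0"
    by (rule eventually_mono[OF eventually_gt_at_top[of 0] moment])
  then have "(\<lambda>n. \<integral>z. (\<Sum>i<n. a i * z ^ i) \<partial>circle_measure) \<longlonglongrightarrow> of_real (2 * pi) * a 0"
    by (rule tendsto_eventually)
  ultimately have "(\<integral>z. G z \<partial>circle_measure) = of_real (2 * pi) * a 0" by (rule LIMSEQ_unique)
  then show ?thesis by (simp add: a_def)
qed

lemma fubini_bounded:
  fixes f :: "'a::second_countable_topology \<Rightarrow> 'b::second_countable_topology \<Rightarrow> complex"
  assumes M1: "finite_measure M1" "sets M1 = sets borel" and M2: "finite_measure M2" "sets M2 = sets borel"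
    and f: "(\<lambda>z. f (fst z) (snd z)) \<in> borel_measurable borel"
    and A: "A \<in> sets borel" "AE x in M1. x \<in> A" and B: "B \<in> sets borel" "AE y in M2. y \<in> B"
    and bound: "\<And>x y. x \<in> A \<Longrightarrow> y \<in> B \<Longrightarrow> cmod (f x y) \<le> C"
  shows "(\<integral>y. (\<integral>x. f x y \<partial>M1) \<partial>M2) = (\<integral>x. (\<integral>y. f x y \<partial>M2) \<partial>M1)"
proof -
  interpret M1: finite_measure M1 by (rule M1)
  interpret M2: finite_measure M2 by (rule M2)
  interpret pair_sigma_finite M1 M2 ..
  have sets: "sets (M1 \<Otimes>\<^sub>M M2) = sets borel"
    using M1(2) M2(2) by (simp add: borel_prod[symmetric] cong: sets_pair_measure_cong)
  then have sp: "space (M1 \<Otimes>\<^sub>M M2) = UNIV" by (metis sets_eq_imp_space_eq space_borel)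
  have AB: "A \<times> B \<in> sets borel" using A(1) B(1) by (auto simp: borel_prod[symmetric])
  have "AE z in M1 \<Otimes>\<^sub>M M2. z \<in> A \<times> B"
  proof (rule AE_pair_measure)
    show "{z \<in> space (M1 \<Otimes>\<^sub>M M2). z \<in> A \<times> B} \<in> sets (M1 \<Otimes>\<^sub>M M2)" using AB by (simp add: sets sp)
    show "AE x in M1. AE y in M2. (x, y) \<in> A \<times> B" using A(2)
    proof eventually_elim
      case (elim x) show ?case using B(2) by eventually_elim (simp add: elim)
    qed
  qed
  then have "integrable (M1 \<Otimes>\<^sub>M M2) (\<lambda>z. f (fst z) (snd z))"
    using bound by (intro integrable_borel_bounded[OF finite_measure_pair_measure[OF M2(1) M1(1)] sets f]) auto
  then have "integrable (M1 \<Otimes>\<^sub>M M2) (case_prod f)" by (simp add: case_prod_beta')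
  then show ?thesis by (rule Fubini_integral)
qed

text \<open>One factor of \<open>poisson2\<close> at the point \<open>z / 2\<close>. With
  \<open>z\<close> on the unit circle the fixed radius 1/2 yields all moments up to powers of 2, and
  no limit at the boundary is taken.\<close>

definition poisson_half :: "complex \<Rightarrow> complex \<Rightarrow> real" where
  "poisson_half z \<zeta> = (1 - (cmod (z / 2))\<^sup>2) / (cmod (\<zeta> - z / 2))\<^sup>2"

lemma poisson_half_bound:
  assumes "cmod z = 1" "cmod \<zeta> = 1"
  shows "\<bar>poisson_half z \<zeta>\<bar> \<le> 3"
proof -
  have "1/2 \<le> cmod (\<zeta> - z / 2)" using norm_triangle_ineq2[of \<zeta> "z / 2"] assms by (simp add: norm_divide)
  then have "(1/2)\<^sup>2 \<le> (cmod (\<zeta> - z / 2))\<^sup>2" by (intro power_mono) auto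
  then have "(3/4) / (cmod (\<zeta> - z / 2))\<^sup>2 \<le> (3/4) / (1/2)\<^sup>2" by (intro divide_left_mono) (auto simp: power2_eq_square)
  then show ?thesis using assms by (simp add: poisson_half_def norm_divide power2_eq_square)
qed

text \<open>On the circle the kernel equals
  \<open>z / (z - w) + cnj w * z / (1 - cnj w * z)\<close>. After multiplication by
  \<open>z ^ k\<close> the geometric sum splits off a polynomial with constant term
  \<open>w ^ k\<close>; what remains is a holomorphic function and the conjugate of one, both
  vanishing at 0.\<close>

lemma poisson_half_eq:
  assumes "cmod z = 1" "cmod \<zeta> = 1" and w: "w = \<zeta> / 2"
  shows "z ^ k * of_real (poisson_half z \<zeta>) = (\<Sum>i<Suc k. w ^ (k - i) * z ^ i)
     + cnj (cnj w ^ Suc k * z / (1 - cnj w * z)) + z ^ Suc k * cnj w / (1 - cnj w * z)"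
proof -
  have wn: "cmod w = 1/2" using assms by (simp add: w norm_divide)
  have zz: "cnj z * z = 1" using assms(1) by (simp add: complex_norm_square[symmetric] mult.commute)
  have z0: "z \<noteq> 0" using assms(1) by auto
  have d1: "z - w \<noteq> 0" using wn assms(1) by auto
  have "cmod (cnj w * z) = 1/2" using wn assms(1) by (simp add: norm_mult)
  then have d2: "1 - cnj w * z \<noteq> 0" by auto
  \<comment> \<open>The halving may pass from \<open>z\<close> to \<open>\<zeta>\<close> since both
    lie on the unit circle; the kernel thus becomes rational in \<open>z\<close>, with poles at
    \<open>w\<close> and at its reflection in the circle.\<close>
  have "(cmod (\<zeta> - z / 2))\<^sup>2 = (cmod (z - w))\<^sup>2"
    using assms(1,2) unfolding w cmod_def by (simp add: power2_eq_square algebra_simps)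
  also have "complex_of_real \<dots> = (z - w) * cnj (z - w)" by (rule complex_norm_square)
  also have "\<dots> = (z - w) * (1 - cnj w * z) / z" using zz z0 by (simp add: field_simps)
  finally have den: "complex_of_real ((cmod (\<zeta> - z / 2))\<^sup>2) = (z - w) * (1 - cnj w * z) / z" .
  have "complex_of_real (1 - (cmod (z / 2))\<^sup>2) = 1 - w * cnj w"
  proof -
    have "w * cnj w = of_real ((1/2)\<^sup>2)" unfolding complex_norm_square[symmetric] wn ..
    moreover have "(cmod (z / 2))\<^sup>2 = (1/2)\<^sup>2" using assms(1) by (simp add: norm_divide)
    ultimately show ?thesis by simp
  qed
  then have "complex_of_real (poisson_half z \<zeta>) = (1 - w * cnj w) * z / ((z - w) * (1 - cnj w * z))"
    unfolding poisson_half_def of_real_divide den by simp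
  also have "\<dots> = z / (z - w) + cnj w * z / (1 - cnj w * z)"
    using d1 d2 by (simp add: field_simps)
  finally have "z ^ k * of_real (poisson_half z \<zeta>) = z ^ Suc k / (z - w) + z ^ Suc k * cnj w / (1 - cnj w * z)"
    by (simp add: algebra_simps)
  moreover have "z ^ Suc k - w ^ Suc k = (z - w) * (\<Sum>i<Suc k. w ^ (k - i) * z ^ i)"
    using power_diff_sumr2[of z "Suc k" w] by simp
  then have "z ^ Suc k / (z - w) = (\<Sum>i<Suc k. w ^ (k - i) * z ^ i) + w ^ Suc k / (z - w)"
    using d1 by (simp add: divide_simps) (simp add: algebra_simps)
  moreover have "w ^ Suc k / (z - w) = cnj (cnj w ^ Suc k * z / (1 - cnj w * z))"
  proof -
    have "1 - w * cnj z = cnj z * (z - w)" using zz by (simp add: algebra_simps)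
    then show ?thesis using z0 by simp
  qed
  ultimately show ?thesis by simp
qed

text \<open>Only the constant term of the polynomial part survives the mean value property. The
  second moment is the conjugate of the first because the kernel is real.\<close>

lemma poisson_half_moment:
  assumes "cmod \<zeta> = 1"
  shows "(\<integral>z. z ^ k * of_real (poisson_half z \<zeta>) \<partial>circle_measure) = of_real (2 * pi) * (\<zeta> / 2) ^ k"
    "(\<integral>z. cnj z ^ k * of_real (poisson_half z \<zeta>) \<partial>circle_measure) = of_real (2 * pi) * (cnj \<zeta> / 2) ^ k"
proof -
  define w where "w = \<zeta> / 2"
  have wn: "cmod w = 1/2" using assms by (simp add: w_def norm_divide)
  have d: "1 - cnj w * z \<noteq> 0" if "z \<in> ball 0 2" for z
  proof
    assume "1 - cnj w * z = 0"
    then have "cmod (cnj w * z) = 1" by simp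
    then show False using that wn by (simp add: norm_mult)
  qed
  define g1 where "g1 z = (\<Sum>i<Suc k. w ^ (k - i) * z ^ i)" for z
  define g2 where "g2 z = cnj w ^ Suc k * z / (1 - cnj w * z)" for z
  define g3 where "g3 z = z ^ Suc k * cnj w / (1 - cnj w * z)" for z
  have hol: "g1 holomorphic_on ball 0 2" "g2 holomorphic_on ball 0 2" "g3 holomorphic_on ball 0 2"
    unfolding g1_def g2_def g3_def using d by (auto intro!: holomorphic_intros)
  have meas [measurable]: "g1 \<in> borel_measurable borel" "g2 \<in> borel_measurable borel" "g3 \<in> borel_measurable borel"
    unfolding g1_def g2_def g3_def by measurable
  have int: "integrable circle_measure g" if g: "g holomorphic_on ball 0 2" "g \<in> borel_measurable borel" for g
  proof -
    have "compact (g ` sphere 0 1)"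
    proof (rule compact_continuous_image)
      show "continuous_on (sphere 0 1) g"
        by (rule holomorphic_on_imp_continuous_on, rule holomorphic_on_subset[OF g(1)]) auto
    qed simp
    from compact_imp_bounded[OF this] have "\<exists>B. \<forall>z\<in>sphere 0 1. cmod (g z) \<le> B"
      by (simp add: bounded_iff)
    then obtain B where B: "\<And>z. z \<in> sphere 0 1 \<Longrightarrow> cmod (g z) \<le> B" by blast
    have "AE z in circle_measure. z \<in> sphere 0 1" using AE_circle by eventually_elim simp
    then show ?thesis
      by (rule integrable_borel_bounded[OF finite_circle sets_circle g(2)]) (rule B)
  qed
  have mean: "(\<integral>z. g z \<partial>circle_measure) = of_real (2 * pi) * g 0"
    if g: "g holomorphic_on ball 0 2" "g \<in> borel_measurable borel" for g
    by (rule integral_circle_holomorphic[OF g(1) _ g(2)]) auto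
  have "(\<integral>z. z ^ k * of_real (poisson_half z \<zeta>) \<partial>circle_measure) = (\<integral>z. g1 z + cnj (g2 z) + g3 z \<partial>circle_measure)"
  proof (rule integral_cong_AE)
    have "(\<lambda>z. poisson_half z \<zeta>) \<in> borel_measurable borel"
      unfolding poisson_half_def by (intro borel_measurable_divide borel_measurable_continuous_onI continuous_intros) auto
    then show "(\<lambda>z. z ^ k * of_real (poisson_half z \<zeta>)) \<in> borel_measurable circle_measure" by measurable
    have "cnj \<in> borel_measurable borel" by (intro borel_measurable_continuous_onI continuous_intros)
    then show "(\<lambda>z. g1 z + cnj (g2 z) + g3 z) \<in> borel_measurable circle_measure" by measurable
    show "AE z in circle_measure. z ^ k * of_real (poisson_half z \<zeta>) = g1 z + cnj (g2 z) + g3 z"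
      using AE_circle by eventually_elim (unfold g1_def g2_def g3_def, rule poisson_half_eq[OF _ assms w_def])
  qed
  also have "\<dots> = (\<integral>z. g1 z \<partial>circle_measure) + cnj (\<integral>z. g2 z \<partial>circle_measure) + (\<integral>z. g3 z \<partial>circle_measure)"
    using int[OF hol(1) meas(1)] int[OF hol(2) meas(2)] int[OF hol(3) meas(3)] by simp
  also have "\<dots> = of_real (2 * pi) * g1 0 + cnj (of_real (2 * pi) * g2 0) + of_real (2 * pi) * g3 0"
    using mean[OF hol(1) meas(1)] mean[OF hol(2) meas(2)] mean[OF hol(3) meas(3)] by simp
  also have "\<dots> = of_real (2 * pi) * (\<zeta> / 2) ^ k"
  proof -
    have "g2 0 = 0" "g3 0 = 0" by (simp_all add: g2_def g3_def)
    moreover have "g1 0 = (\<Sum>i<Suc k. if i = 0 then w ^ k else 0)"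
      unfolding g1_def by (intro sum.cong) auto
    ultimately show ?thesis by (simp add: w_def)
  qed
  finally show *: "(\<integral>z. z ^ k * of_real (poisson_half z \<zeta>) \<partial>circle_measure) = of_real (2 * pi) * (\<zeta> / 2) ^ k" .
  have "(\<integral>z. cnj z ^ k * of_real (poisson_half z \<zeta>) \<partial>circle_measure) = (\<integral>z. cnj (z ^ k * of_real (poisson_half z \<zeta>)) \<partial>circle_measure)" by simp
  also have "\<dots> = cnj (of_real (2 * pi) * (\<zeta> / 2) ^ k)" unfolding *[symmetric] by (rule Bochner_Integration.integral_cnj)
  finally show "(\<integral>z. cnj z ^ k * of_real (poisson_half z \<zeta>) \<partial>circle_measure) = of_real (2 * pi) * (cnj \<zeta> / 2) ^ k"
    by simp
qed

lemma measurable_integral_borel: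
  fixes f :: "'a::second_countable_topology \<Rightarrow> 'b::second_countable_topology \<Rightarrow> complex"
  assumes M: "finite_measure M" "sets M = sets borel"
    and f: "(\<lambda>z. f (fst z) (snd z)) \<in> borel_measurable borel"
  shows "(\<lambda>x. \<integral>y. f x y \<partial>M) \<in> borel_measurable borel"
proof -
  interpret finite_measure M by (rule M)
  have "sets ((borel :: 'a measure) \<Otimes>\<^sub>M M) = sets (borel :: ('a \<times> 'b) measure)"
    using M(2) by (simp add: borel_prod[symmetric] cong: sets_pair_measure_cong)
  then have "case_prod f \<in> borel_measurable (borel \<Otimes>\<^sub>M M)"
    using f by (simp add: case_prod_beta' cong: measurable_cong_sets)
  then show ?thesis by (rule borel_measurable_lebesgue_integral)
qed

lemma torus2_borel: "torus2 \<in> sets borel"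
  unfolding torus2_def
  by (intro borel_closed closed_Collect_conj closed_Collect_eq continuous_intros)

lemma borel_measurable_fst_snd_cnj [measurable]:
  fixes g :: "'x \<Rightarrow> 'a::topological_space \<times> 'b::topological_space" and h :: "'x \<Rightarrow> complex"
  shows "g \<in> borel_measurable M \<Longrightarrow> (\<lambda>x. fst (g x)) \<in> borel_measurable M"
    and "g \<in> borel_measurable M \<Longrightarrow> (\<lambda>x. snd (g x)) \<in> borel_measurable M"
    and "h \<in> borel_measurable M \<Longrightarrow> (\<lambda>x. cnj (h x)) \<in> borel_measurable M"
  by (erule measurable_compose; intro borel_measurable_continuous_onI continuous_intros)+

lemma poisson_half_meas_compose [measurable]:
  assumes [measurable]: "g \<in> borel_measurable M" "h \<in> borel_measurable M"
  shows "(\<lambda>x. poisson_half (g x) (h x)) \<in> borel_measurable M"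
  unfolding poisson_half_def by measurable

section \<open>Circle moments of the Poisson integral, one variable at a time\<close>

context
  fixes M :: "(complex \<times> complex) measure"
  assumes M: "finite_measure M" "sets M = sets borel" and AE_M: "AE \<zeta> in M. \<zeta> \<in> torus2"
begin

lemma integral_circle_poisson2:
  assumes a: "cmod a = 1"
  shows "(\<integral>b. cnj b ^ l * of_real (\<integral>\<zeta>. poisson_half a (fst \<zeta>) * poisson_half b (snd \<zeta>) \<partial>M) \<partial>circle_measure)
    = of_real (2 * pi) * (\<integral>\<zeta>. of_real (poisson_half a (fst \<zeta>)) * (cnj (snd \<zeta>) / 2) ^ l \<partial>M)"
proof -
  define f where "f \<zeta> b = cnj b ^ l * complex_of_real (poisson_half a (fst \<zeta>) * poisson_half b (snd \<zeta>))" for \<zeta> b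
  have f: "(\<lambda>z. f (fst z) (snd z)) \<in> borel_measurable borel"
    unfolding f_def
    by measurable
  have f': "(\<lambda>z. f (snd z) (fst z)) \<in> borel_measurable borel"
    unfolding f_def
    by measurable
  have "(\<integral>b. cnj b ^ l * of_real (\<integral>\<zeta>. poisson_half a (fst \<zeta>) * poisson_half b (snd \<zeta>) \<partial>M) \<partial>circle_measure) = (\<integral>b. (\<integral>\<zeta>. f \<zeta> b \<partial>M) \<partial>circle_measure)"
    by (simp only: f_def integral_mult_right_zero integral_complex_of_real)
  also have "\<dots> = (\<integral>\<zeta>. (\<integral>b. f \<zeta> b \<partial>circle_measure) \<partial>M)"
  proof (rule fubini_bounded[OF M finite_circle sets_circle f torus2_borel AE_M circle_AE, where C="1 * (3 * 3)"])
    show "cmod (f \<zeta> b) \<le> 1 * (3 * 3)" if "\<zeta> \<in> torus2" "b \<in> {z. cmod z = 1}" for \<zeta> b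
    proof -
      have "\<bar>poisson_half a (fst \<zeta>)\<bar> \<le> 3" "\<bar>poisson_half b (snd \<zeta>)\<bar> \<le> 3" using that a poisson_half_bound by (auto simp: torus2_def)
      then show ?thesis using that(2) unfolding f_def norm_mult norm_of_real abs_mult
        by (intro mult_mono) (auto simp: norm_power)
    qed
  qed
  also have "\<dots> = (\<integral>\<zeta>. of_real (2 * pi) * (of_real (poisson_half a (fst \<zeta>)) * (cnj (snd \<zeta>) / 2) ^ l) \<partial>M)"
  proof (rule integral_cong_AE)
    show "(\<lambda>\<zeta>. \<integral>b. f \<zeta> b \<partial>circle_measure) \<in> borel_measurable M"
      using measurable_integral_borel[OF finite_circle sets_circle f] M(2) by (simp cong: measurable_cong_sets)
    have "(\<lambda>\<zeta>. of_real (2 * pi) * (of_real (poisson_half a (fst \<zeta>)) * (cnj (snd \<zeta>) / 2) ^ l)) \<in> borel_measurable borel"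
      by measurable
    then show "(\<lambda>\<zeta>. of_real (2 * pi) * (of_real (poisson_half a (fst \<zeta>)) * (cnj (snd \<zeta>) / 2) ^ l)) \<in> borel_measurable M"
      using M(2) by (simp cong: measurable_cong_sets)
    show "AE \<zeta> in M. (\<integral>b. f \<zeta> b \<partial>circle_measure) = of_real (2 * pi) * (of_real (poisson_half a (fst \<zeta>)) * (cnj (snd \<zeta>) / 2) ^ l)"
      using AE_M
    proof eventually_elim
      case (elim \<zeta>)
      have "(\<integral>b. f \<zeta> b \<partial>circle_measure) = (\<integral>b. of_real (poisson_half a (fst \<zeta>)) * (cnj b ^ l * of_real (poisson_half b (snd \<zeta>))) \<partial>circle_measure)"
        by (intro Bochner_Integration.integral_cong refl) (simp add: f_def algebra_simps)
      also have "\<dots> = of_real (poisson_half a (fst \<zeta>)) * (of_real (2 * pi) * (cnj (snd \<zeta>) / 2) ^ l)"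
        using poisson_half_moment(2)[of "snd \<zeta>" l] elim by (simp add: torus2_def)
      finally show ?case by (simp only: mult.left_commute)
    qed
  qed
  finally show ?thesis by (simp only: integral_mult_right_zero)
qed

lemma poisson_half_fst_meas:
  "(\<lambda>z. snd z ^ k * (of_real (poisson_half (snd z) (fst (fst z))) * (cnj (snd (fst z)) / 2) ^ l)) \<in> borel_measurable
     (borel :: ((complex \<times> complex) \<times> complex) measure)"
  "(\<lambda>z. fst z ^ k * (of_real (poisson_half (fst z) (fst (snd z))) * (cnj (snd (snd z)) / 2) ^ l)) \<in> borel_measurable
     (borel :: (complex \<times> complex \<times> complex) measure)"
  by measurable

lemma poisson_half_fst_bound:
  assumes "\<zeta> \<in> torus2" "cmod a = 1"
  shows "cmod (a ^ k * (of_real (poisson_half a (fst \<zeta>)) * (cnj (snd \<zeta>) / 2) ^ l)) \<le> 3"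
proof -
  have "\<bar>poisson_half a (fst \<zeta>)\<bar> \<le> 3" using assms poisson_half_bound by (auto simp: torus2_def)
  moreover have "cmod ((cnj (snd \<zeta>) / 2) ^ l) \<le> 1"
    using assms(1) by (simp add: torus2_def norm_power norm_divide power_le_one)
  ultimately have "\<bar>poisson_half a (fst \<zeta>)\<bar> * cmod ((cnj (snd \<zeta>) / 2) ^ l) \<le> 3 * 1"
    by (intro mult_mono) auto
  then show ?thesis unfolding norm_mult norm_of_real using assms(2) by (simp add: norm_power)
qed

lemma integral_circle_poisson_half_fst: "(\<integral>a. a ^ k * (\<integral>\<zeta>. of_real (poisson_half a (fst \<zeta>)) * (cnj (snd \<zeta>) / 2) ^ l \<partial>M) \<partial>circle_measure)
    = of_real (2 * pi) * (\<integral>\<zeta>. (fst \<zeta> / 2) ^ k * (cnj (snd \<zeta>) / 2) ^ l \<partial>M)"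
proof -
  define f where "f \<zeta> a = a ^ k * (of_real (poisson_half a (fst \<zeta>)) * (cnj (snd \<zeta>) / 2) ^ l)" for \<zeta> :: "complex \<times> complex" and a
  have f: "(\<lambda>z. f (fst z) (snd z)) \<in> borel_measurable borel" unfolding f_def by (rule poisson_half_fst_meas)
  have "(\<integral>a. a ^ k * (\<integral>\<zeta>. of_real (poisson_half a (fst \<zeta>)) * (cnj (snd \<zeta>) / 2) ^ l \<partial>M) \<partial>circle_measure) = (\<integral>a. (\<integral>\<zeta>. f \<zeta> a \<partial>M) \<partial>circle_measure)"
    by (simp only: f_def integral_mult_right_zero)
  also have "\<dots> = (\<integral>\<zeta>. (\<integral>a. f \<zeta> a \<partial>circle_measure) \<partial>M)"
    by (rule fubini_bounded[OF M finite_circle sets_circle f torus2_borel AE_M circle_AE, where C=3])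
       (unfold f_def, rule poisson_half_fst_bound, auto)
  also have "\<dots> = (\<integral>\<zeta>. of_real (2 * pi) * ((fst \<zeta> / 2) ^ k * (cnj (snd \<zeta>) / 2) ^ l) \<partial>M)"
  proof (rule integral_cong_AE)
    show "(\<lambda>\<zeta>. \<integral>b. f \<zeta> b \<partial>circle_measure) \<in> borel_measurable M"
      using measurable_integral_borel[OF finite_circle sets_circle f] M(2) by (simp cong: measurable_cong_sets)
    have "(\<lambda>\<zeta>::complex \<times> complex. of_real (2 * pi) * ((fst \<zeta> / 2) ^ k * (cnj (snd \<zeta>) / 2) ^ l)) \<in> borel_measurable borel"
      by (intro borel_measurable_continuous_onI continuous_intros) auto
    then show "(\<lambda>\<zeta>. of_real (2 * pi) * ((fst \<zeta> / 2) ^ k * (cnj (snd \<zeta>) / 2) ^ l)) \<in> borel_measurable M"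
      using M(2) by (simp cong: measurable_cong_sets)
    show "AE \<zeta> in M. (\<integral>b. f \<zeta> b \<partial>circle_measure) = of_real (2 * pi) * ((fst \<zeta> / 2) ^ k * (cnj (snd \<zeta>) / 2) ^ l)"
      using AE_M
    proof eventually_elim
      case (elim \<zeta>)
      have "(\<integral>a. f \<zeta> a \<partial>circle_measure) = (\<integral>a. (a ^ k * of_real (poisson_half a (fst \<zeta>))) * (cnj (snd \<zeta>) / 2) ^ l \<partial>circle_measure)"
        by (intro Bochner_Integration.integral_cong refl) (simp add: f_def algebra_simps)
      also have "\<dots> = (of_real (2 * pi) * (fst \<zeta> / 2) ^ k) * (cnj (snd \<zeta>) / 2) ^ l"
        using poisson_half_moment(1)[of "fst \<zeta>" k] elim by (simp only: integral_mult_left_zero) (simp add: torus2_def)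
      finally show ?case by (simp only: mult.assoc)
    qed
  qed
  finally show ?thesis by (simp only: integral_mult_right_zero)
qed

lemma integrable_circle_poisson_half_fst:
  "integrable circle_measure (\<lambda>a. a ^ k * (\<integral>\<zeta>. of_real (poisson_half a (fst \<zeta>)) * (cnj (snd \<zeta>) / 2) ^ l \<partial>M))"
proof (rule integrable_borel_bounded[OF finite_circle sets_circle _ circle_AE(2), where B="3 * measure M (space M)"])
  have "(\<lambda>a. \<integral>\<zeta>. a ^ k * (of_real (poisson_half a (fst \<zeta>)) * (cnj (snd \<zeta>) / 2) ^ l) \<partial>M) \<in> borel_measurable borel"
    by (rule measurable_integral_borel[OF M poisson_half_fst_meas(2)])
  then show "(\<lambda>a. a ^ k * (\<integral>\<zeta>. of_real (poisson_half a (fst \<zeta>)) * (cnj (snd \<zeta>) / 2) ^ l \<partial>M)) \<in> borel_measurable borel"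
    by (simp only: integral_mult_right_zero)
  fix a :: complex assume "a \<in> {z. cmod z = 1}"
  then have a: "cmod a = 1" by simp
  have meas: "(\<lambda>\<zeta>. a ^ k * (of_real (poisson_half a (fst \<zeta>)) * (cnj (snd \<zeta>) / 2) ^ l)) \<in> borel_measurable borel"
    by measurable
  have "cmod (\<integral>\<zeta>. a ^ k * (of_real (poisson_half a (fst \<zeta>)) * (cnj (snd \<zeta>) / 2) ^ l) \<partial>M) \<le> 3 * measure M (space M)"
    by (rule norm_integral_le_bound[OF M meas AE_M poisson_half_fst_bound[OF _ a]])
  then show "cmod (a ^ k * (\<integral>\<zeta>. of_real (poisson_half a (fst \<zeta>)) * (cnj (snd \<zeta>) / 2) ^ l \<partial>M)) \<le> 3 * measure M (space M)"
    by (simp only: integral_mult_right_zero)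
qed

lemma measurable_integral_poisson2:
  "(\<lambda>b. of_real (\<integral>\<zeta>. poisson_half a (fst \<zeta>) * poisson_half b (snd \<zeta>) \<partial>M) :: complex) \<in> borel_measurable borel"
proof -
  have "(\<lambda>b. \<integral>\<zeta>. complex_of_real (poisson_half a (fst \<zeta>) * poisson_half b (snd \<zeta>)) \<partial>M) \<in> borel_measurable borel"
    by (intro measurable_integral_borel[OF M]) measurable
  then show ?thesis by (simp only: integral_complex_of_real)
qed

lemma integrable_circle_poisson2:
  assumes a: "cmod a = 1"
  shows "integrable circle_measure (\<lambda>b. cnj b ^ l * of_real (\<integral>\<zeta>. poisson_half a (fst \<zeta>) * poisson_half b (snd \<zeta>) \<partial>M))"
proof (rule integrable_borel_bounded[OF finite_circle sets_circle _ circle_AE(2), where B="9 * measure M (space M)"])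
  show "(\<lambda>b. cnj b ^ l * of_real (\<integral>\<zeta>. poisson_half a (fst \<zeta>) * poisson_half b (snd \<zeta>) \<partial>M)) \<in> borel_measurable borel"
    using measurable_integral_poisson2 by measurable
  fix b :: complex assume "b \<in> {z. cmod z = 1}"
  then have b: "cmod b = 1" by simp
  have "norm (\<integral>\<zeta>. poisson_half a (fst \<zeta>) * poisson_half b (snd \<zeta>) \<partial>M) \<le> 9 * measure M (space M)"
  proof (rule norm_integral_le_bound[OF M _ AE_M])
    show "(\<lambda>\<zeta>. poisson_half a (fst \<zeta>) * poisson_half b (snd \<zeta>)) \<in> borel_measurable borel"
      by measurable
    fix \<zeta> :: "complex \<times> complex" assume "\<zeta> \<in> torus2"
    then have "\<bar>poisson_half a (fst \<zeta>)\<bar> \<le> 3" "\<bar>poisson_half b (snd \<zeta>)\<bar> \<le> 3" using a b poisson_half_bound by (auto simp: torus2_def)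
    then have "\<bar>poisson_half a (fst \<zeta>)\<bar> * \<bar>poisson_half b (snd \<zeta>)\<bar> \<le> 3 * 3" by (intro mult_mono) auto
    then show "norm (poisson_half a (fst \<zeta>) * poisson_half b (snd \<zeta>)) \<le> 9" by (simp add: abs_mult)
  qed
  then show "cmod (cnj b ^ l * of_real (\<integral>\<zeta>. poisson_half a (fst \<zeta>) * poisson_half b (snd \<zeta>) \<partial>M)) \<le> 9 * measure M (space M)"
    using b by (simp add: norm_mult norm_power)
qed

end

text \<open>The moments are computed from separate holomorphy and joint continuity. Halving the
  arguments makes the slices holomorphic on a disc of radius 2, beyond the circle of
  integration.\<close>

lemma holomorphic2_slices:
  assumes f: "holomorphic2_on f disc2"
  shows "cmod b = 1 \<Longrightarrow> (\<lambda>a. f (a / 2, b / 2)) holomorphic_on ball 0 2"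
    and "cmod a = 1 \<Longrightarrow> (\<lambda>b. f (a / 2, b / 2)) holomorphic_on ball 0 2"
    and "continuous_on disc2 f"
proof -
  have der: "\<exists>p q. (f has_derivative (\<lambda>h. p * fst h + q * snd h)) (at z)" if "z \<in> disc2" for z
    using f that by (auto simp: holomorphic2_on_def)
  show "continuous_on disc2 f"
  proof (rule continuous_at_imp_continuous_on, rule ballI)
    fix z assume "z \<in> disc2"
    then show "isCont f z" using der has_derivative_continuous by blast
  qed
  show "(\<lambda>a. f (a / 2, b / 2)) holomorphic_on ball 0 2" if b: "cmod b = 1"
    unfolding holomorphic_on_def
  proof
    fix a :: complex assume "a \<in> ball 0 2"
    then have "(a / 2, b / 2) \<in> disc2" using b by (simp add: disc2_def norm_divide)
    then obtain p q where "(f has_derivative (\<lambda>h. p * fst h + q * snd h)) (at (a / 2, b / 2))"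
      using der by blast
    moreover have "((\<lambda>a. (a / 2, b / 2)) has_derivative (\<lambda>h. (h / 2, 0))) (at a within ball 0 2)"
      by (auto intro!: derivative_eq_intros has_derivative_Pair)
    ultimately have "((\<lambda>a. f (a / 2, b / 2)) has_derivative (\<lambda>h. p * (h / 2) + q * 0)) (at a within ball 0 2)"
      using has_derivative_compose by fastforce
    moreover have "(\<lambda>h. p * (h / 2) + q * 0) = (*) (p / 2)" by (auto simp: fun_eq_iff)
    ultimately have "((\<lambda>a. f (a / 2, b / 2)) has_field_derivative p / 2) (at a within ball 0 2)"
      unfolding has_field_derivative_def by simp
    then show "(\<lambda>a. f (a / 2, b / 2)) field_differentiable at a within ball 0 2"
      by (auto simp: field_differentiable_def)
  qed
  show "(\<lambda>b. f (a / 2, b / 2)) holomorphic_on ball 0 2" if a: "cmod a = 1"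
    unfolding holomorphic_on_def
  proof
    fix b :: complex assume "b \<in> ball 0 2"
    then have "(a / 2, b / 2) \<in> disc2" using a by (simp add: disc2_def norm_divide)
    then obtain p q where "(f has_derivative (\<lambda>h. p * fst h + q * snd h)) (at (a / 2, b / 2))"
      using der by blast
    moreover have "((\<lambda>b. (a / 2, b / 2)) has_derivative (\<lambda>h. (0, h / 2))) (at b within ball 0 2)"
      by (auto intro!: derivative_eq_intros has_derivative_Pair)
    ultimately have "((\<lambda>b. f (a / 2, b / 2)) has_derivative (\<lambda>h. p * 0 + q * (h / 2))) (at b within ball 0 2)"
      using has_derivative_compose by fastforce
    moreover have "(\<lambda>h. p * 0 + q * (h / 2)) = (*) (q / 2)" by (auto simp: fun_eq_iff)
    ultimately have "((\<lambda>b. f (a / 2, b / 2)) has_field_derivative q / 2) (at b within ball 0 2)"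
      unfolding has_field_derivative_def by simp
    then show "(\<lambda>b. f (a / 2, b / 2)) field_differentiable at b within ball 0 2"
      by (auto simp: field_differentiable_def)
  qed
qed

lemma compact_torus2: "compact torus2"
proof -
  have "torus2 = sphere 0 1 \<times> sphere 0 1" by (auto simp: torus2_def)
  then show ?thesis by (metis compact_Times compact_sphere)
qed

lemma AE_torus2:
  assumes "sets M = sets borel" "emeasure M (UNIV - torus2) = 0"
  shows "AE \<zeta> in M. \<zeta> \<in> torus2"
proof (rule AE_I[where N="UNIV - torus2"])
  show "UNIV - torus2 \<in> sets M" using torus2_borel assms(1) by auto
qed (use assms(2) in auto)

text \<open>\<open>Re f\<close> is half of \<open>f + cnj f\<close>. Against
  \<open>cnj b ^ l\<close> the conjugate part integrates to 0 in the second variable, because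
  \<open>b ^ l * f\<close> vanishes at \<open>b = 0\<close>; against \<open>a ^ k\<close> the
  holomorphic part then integrates to 0 in the first. Each step spends one of the conditions
  \<open>l \<ge> 1\<close>, \<open>k \<ge> 1\<close>.\<close>

lemma RP_measure_moments:
  assumes RP: "RP_measure Mp Mn" and k: "1 \<le> k" and l: "1 \<le> l"
  shows "(\<integral>\<zeta>. fst \<zeta> ^ k * cnj (snd \<zeta>) ^ l \<partial>Mp) = (\<integral>\<zeta>. fst \<zeta> ^ k * cnj (snd \<zeta>) ^ l \<partial>Mn)"
proof -
  obtain f where f: "holomorphic2_on f disc2"
    and Re: "\<And>z. z \<in> disc2 \<Longrightarrow> Re (f z) = (\<integral>\<zeta>. poisson2 z \<zeta> \<partial>Mp) - (\<integral>\<zeta>. poisson2 z \<zeta> \<partial>Mn)"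
    using RP by (auto simp: RP_measure_def)
  have M: "finite_measure Mp" "sets Mp = sets borel" "finite_measure Mn" "sets Mn = sets borel"
    and null: "emeasure Mp (UNIV - torus2) = 0" "emeasure Mn (UNIV - torus2) = 0"
    using RP unfolding RP_measure_def real_measure_T2_def by blast+
  note AE = AE_torus2[OF M(2) null(1)] AE_torus2[OF M(4) null(2)]
  note Mp = M(1,2) AE(1) and Mn = M(3,4) AE(2)
  define R where "R M a b = (\<integral>\<zeta>. poisson_half a (fst \<zeta>) * poisson_half b (snd \<zeta>) \<partial>M)"
    for M :: "(complex \<times> complex) measure" and a b
  define Q where "Q M a = (\<integral>\<zeta>. of_real (poisson_half a (fst \<zeta>)) * (cnj (snd \<zeta>) / 2) ^ l \<partial>M)"
    for M :: "(complex \<times> complex) measure" and a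
  \<comment> \<open>The cutoff makes the integrand Borel on the whole space, as nothing is known
    about \<open>f\<close> off the bidisc.\<close>
  define F where "F z = indicator torus2 z *\<^sub>R f (fst z / 2, snd z / 2)" for z
  have ReF: "R Mp a b - R Mn a b = Re (F (a, b))" if "cmod a = 1" "cmod b = 1" for a b
  proof -
    have "(a / 2, b / 2) \<in> disc2" using that by (simp add: disc2_def norm_divide)
    from Re[OF this] show ?thesis
      using that by (simp add: R_def F_def torus2_def poisson2_def poisson_half_def)
  qed
  have cont: "continuous_on torus2 (\<lambda>z. f (fst z / 2, snd z / 2))"
    by (rule continuous_on_compose2[OF holomorphic2_slices(3)[OF f]])
       (auto intro!: continuous_intros simp: torus2_def disc2_def norm_divide)
  have Fm [measurable]: "F \<in> borel_measurable borel"
    unfolding F_def by (intro borel_measurable_continuous_on_indicator torus2_borel cont)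
  obtain B where B: "\<And>z. z \<in> torus2 \<Longrightarrow> cmod (F z) \<le> B"
  proof -
    have "bounded ((\<lambda>z. f (fst z / 2, snd z / 2)) ` torus2)"
      by (intro compact_imp_bounded compact_continuous_image compact_torus2 cont)
    then have "\<exists>B. \<forall>z\<in>torus2. cmod (F z) \<le> B" by (auto simp: bounded_iff F_def)
    then show ?thesis using that by blast
  qed
  have Fab: "cmod (F (a, b)) \<le> B" "F (a, b) = f (a / 2, b / 2)" if "cmod a = 1" "cmod b = 1" for a b
    using B[of "(a, b)"] that by (auto simp: torus2_def F_def)
  have Fmeas [measurable]: "(\<lambda>b. F (a, b)) \<in> borel_measurable borel" "(\<lambda>a. F (a, b)) \<in> borel_measurable borel" for a b
    by (rule measurable_compose[OF _ Fm]; intro borel_measurable_continuous_onI continuous_intros)+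
  define D where "D a = (\<integral>b. cnj b ^ l * F (a, b) \<partial>circle_measure)" for a
  have step1: "of_real (2 * pi) * (Q Mp a - Q Mn a) = D a / 2" if a: "cmod a = 1" for a
  proof -
    have int: "integrable circle_measure (\<lambda>b. q b ^ l * F (a, b))"
      if [measurable]: "q \<in> borel_measurable borel" and q: "\<And>b. cmod b = 1 \<Longrightarrow> cmod (q b) = 1" for q
    proof (rule integrable_borel_bounded[OF finite_circle sets_circle _ circle_AE(2), where B=B])
      show "(\<lambda>b. q b ^ l * F (a, b)) \<in> borel_measurable borel" by measurable
      show "cmod (q b ^ l * F (a, b)) \<le> B" if "b \<in> {z. cmod z = 1}" for b
        unfolding norm_mult norm_power using that q[of b] Fab(1)[OF a, of b] by simp
    qed
    have int: "integrable circle_measure (\<lambda>b. cnj b ^ l * F (a, b))" "integrable circle_measure (\<lambda>b. b ^ l * F (a, b))"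
      by (rule int; simp)+
    have "of_real (2 * pi) * (Q Mp a - Q Mn a)
        = (\<integral>b. cnj b ^ l * of_real (R Mp a b) \<partial>circle_measure) - (\<integral>b. cnj b ^ l * of_real (R Mn a b) \<partial>circle_measure)"
      unfolding R_def Q_def integral_circle_poisson2[OF Mp a] integral_circle_poisson2[OF Mn a]
      by (rule right_diff_distrib)
    also have "\<dots> = (\<integral>b. cnj b ^ l * of_real (R Mp a b) - cnj b ^ l * of_real (R Mn a b) \<partial>circle_measure)"
      unfolding R_def using integrable_circle_poisson2[OF Mp a] integrable_circle_poisson2[OF Mn a]
      by (rule Bochner_Integration.integral_diff[symmetric])
    also have "\<dots> = (\<integral>b. (cnj b ^ l * F (a, b) + cnj (b ^ l * F (a, b))) / 2 \<partial>circle_measure)"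
    proof (rule integral_cong_AE)
      show "(\<lambda>b. cnj b ^ l * of_real (R Mp a b) - cnj b ^ l * of_real (R Mn a b)) \<in> borel_measurable circle_measure"
        unfolding R_def using measurable_integral_poisson2[OF Mp, of a] measurable_integral_poisson2[OF Mn, of a]
        by measurable
      show "(\<lambda>b. (cnj b ^ l * F (a, b) + cnj (b ^ l * F (a, b))) / 2) \<in> borel_measurable circle_measure" by measurable
      show "AE b in circle_measure. cnj b ^ l * of_real (R Mp a b) - cnj b ^ l * of_real (R Mn a b)
          = (cnj b ^ l * F (a, b) + cnj (b ^ l * F (a, b))) / 2"
        using AE_circle
      proof eventually_elim
        case (elim b)
        have eq: "of_real (R Mp a b) - of_real (R Mn a b) = (F (a, b) + cnj (F (a, b))) / 2"
          unfolding of_real_diff[symmetric] ReF[OF a elim] by (simp add: complex_add_cnj)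
        show ?case unfolding right_diff_distrib[symmetric] eq by (simp add: distrib_left)
      qed
    qed
    also have "\<dots> = (D a + cnj (\<integral>b. b ^ l * F (a, b) \<partial>circle_measure)) / 2"
    proof -
      have "integrable circle_measure (\<lambda>b. cnj (b ^ l * F (a, b)))" using int(2) by (rule Bochner_Integration.integrable_cnj)
      then show ?thesis using int(1) unfolding D_def
        by (simp only: integral_divide_zero Bochner_Integration.integral_add Bochner_Integration.integral_cnj)
    qed
    also have "(\<integral>b. b ^ l * F (a, b) \<partial>circle_measure) = of_real (2 * pi) * (0 ^ l * f (a / 2, 0 / 2))"
      by (rule integral_circle_holomorphic[where R=2 and g="\<lambda>b. b ^ l * f (a / 2, b / 2)"])
         (auto intro!: holomorphic_intros holomorphic2_slices(2)[OF f a] simp: Fab(2)[OF a])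
    also have "\<dots> = 0" using l by simp
    finally show ?thesis by simp
  qed
  \<comment> \<open>The order of integration is exchanged so that, for fixed \<open>b\<close>, the
    inner integrand is a holomorphic slice in \<open>a\<close>.\<close>
  have step2: "(\<integral>a. a ^ k * D a \<partial>circle_measure) = 0"
  proof -
    define H where "H a b = a ^ k * (cnj b ^ l * F (a, b))" for a b
    have Hm: "(\<lambda>z. H (fst z) (snd z)) \<in> borel_measurable borel"
      unfolding H_def prod.collapse by measurable
    have "(\<integral>a. a ^ k * D a \<partial>circle_measure) = (\<integral>a. (\<integral>b. H a b \<partial>circle_measure) \<partial>circle_measure)"
      unfolding D_def H_def by (simp only: integral_mult_right_zero)
    also have "\<dots> = (\<integral>b. (\<integral>a. H a b \<partial>circle_measure) \<partial>circle_measure)"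
      by (rule fubini_bounded[symmetric, OF finite_circle sets_circle finite_circle sets_circle Hm circle_AE circle_AE, where C=B])
         (simp add: H_def norm_mult norm_power Fab(1))
    also have "\<dots> = (\<integral>b. 0 \<partial>circle_measure)"
    proof (rule integral_cong_AE)
      have "(\<lambda>z. H (snd z) (fst z)) \<in> borel_measurable borel"
        using measurable_compose[of "\<lambda>z. (snd z, fst z)" borel borel "\<lambda>z. H (fst z) (snd z)" borel] Hm
        by (simp add: borel_measurable_continuous_onI continuous_intros)
      then show "(\<lambda>b. \<integral>a. H a b \<partial>circle_measure) \<in> borel_measurable circle_measure"
        using measurable_integral_borel[OF finite_circle sets_circle, of "\<lambda>b a. H a b"] by simp
      show "AE b in circle_measure. (\<integral>a. H a b \<partial>circle_measure) = 0" using AE_circle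
      proof eventually_elim
        case (elim b)
        have "(\<integral>a. H a b \<partial>circle_measure) = of_real (2 * pi) * (0 ^ k * (cnj b ^ l * f (0 / 2, b / 2)))"
          unfolding H_def
          by (rule integral_circle_holomorphic[where R=2 and g="\<lambda>a. a ^ k * (cnj b ^ l * f (a / 2, b / 2))"])
             (auto intro!: holomorphic_intros holomorphic2_slices(1)[OF f elim] simp: Fab(2)[OF _ elim])
        then show ?case using k by simp
      qed
    qed simp
    finally show ?thesis by simp
  qed
  have "(\<integral>a. a ^ k * Q Mp a \<partial>circle_measure) - (\<integral>a. a ^ k * Q Mn a \<partial>circle_measure) = (\<integral>a. a ^ k * Q Mp a - a ^ k * Q Mn a \<partial>circle_measure)"
    unfolding Q_def using integrable_circle_poisson_half_fst[OF Mp] integrable_circle_poisson_half_fst[OF Mn]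
    by (rule Bochner_Integration.integral_diff[symmetric])
  also have "\<dots> = (\<integral>a. (1 / (2 * of_real (2 * pi))) * (a ^ k * D a) \<partial>circle_measure)"
  proof (rule integral_cong_AE)
    show "(\<lambda>a. a ^ k * Q Mp a - a ^ k * Q Mn a) \<in> borel_measurable circle_measure"
      unfolding Q_def using integrable_circle_poisson_half_fst[OF Mp] integrable_circle_poisson_half_fst[OF Mn]
      by (intro borel_measurable_diff borel_measurable_integrable)
    have "(\<lambda>z. cnj (snd z) ^ l * F (fst z, snd z)) \<in> borel_measurable borel"
      unfolding prod.collapse by measurable
    from measurable_integral_borel[OF finite_circle sets_circle, of "\<lambda>a b. cnj b ^ l * F (a, b)", OF this]
    have [measurable]: "D \<in> borel_measurable borel" unfolding D_def .
    show "(\<lambda>a. (1 / (2 * of_real (2 * pi))) * (a ^ k * D a)) \<in> borel_measurable circle_measure" by measurable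
    show "AE a in circle_measure. a ^ k * Q Mp a - a ^ k * Q Mn a = (1 / (2 * of_real (2 * pi))) * (a ^ k * D a)"
      using AE_circle
    proof eventually_elim
      case (elim a)
      have "Q Mp a - Q Mn a = (1 / (2 * of_real (2 * pi))) * D a"
        using step1[OF elim] by (simp add: field_simps)
      then show ?case by (simp add: right_diff_distrib[symmetric] mult.left_commute)
    qed
  qed
  also have "\<dots> = 0" by (simp only: integral_mult_right_zero step2 mult_zero_right)
  finally have "(\<integral>\<zeta>. (fst \<zeta> / 2) ^ k * (cnj (snd \<zeta>) / 2) ^ l \<partial>Mp) = (\<integral>\<zeta>. (fst \<zeta> / 2) ^ k * (cnj (snd \<zeta>) / 2) ^ l \<partial>Mn)"
    unfolding Q_def integral_circle_poisson_half_fst[OF Mp] integral_circle_poisson_half_fst[OF Mn] by simp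
  moreover have "(fst \<zeta> / 2) ^ k * (cnj (snd \<zeta>) / 2) ^ l = (1 / 2) ^ (k + l) * (fst \<zeta> ^ k * cnj (snd \<zeta>) ^ l)" for \<zeta> :: "complex \<times> complex"
    by (simp add: power_divide power_add)
  ultimately show ?thesis by (simp only: integral_mult_right_zero) simp
qed

text \<open>The rotations bring any unit arc of each circle to the parameters \<open>{0..1}\<close>
  and only multiply the moments by a constant. Conjugating the second coordinate turns the mixed
  moments into positive powers of \<open>u\<close> and \<open>v\<close>.\<close>

lemma RP_measure_analytic_pair:
  assumes RP: "RP_measure Mp Mn" and c: "cmod c = 1" "cmod d = 1"
  shows "analytic_pair Mp Mn (\<lambda>\<zeta>. fst \<zeta> * c) (\<lambda>\<zeta>. cnj (snd \<zeta> * d))"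
proof (rule analytic_pair.intro)
  have rm: "real_measure_T2 Mp Mn" using RP by (simp add: RP_measure_def)
  then show "sets Mp = sets borel" "sets Mn = sets borel" "finite_measure Mp" "finite_measure Mn"
    "\<exists>A\<in>sets borel. emeasure Mp (UNIV - A) = 0 \<and> emeasure Mn A = 0"
    by (simp_all add: real_measure_T2_def)
  have "AE \<zeta> in Mp. \<zeta> \<in> torus2" "AE \<zeta> in Mn. \<zeta> \<in> torus2"
    using rm unfolding real_measure_T2_def by (blast intro: AE_torus2)+
  then show "AE \<zeta> in Mp. cmod (fst \<zeta> * c) = 1 \<and> cmod (cnj (snd \<zeta> * d)) = 1"
    "AE \<zeta> in Mn. cmod (fst \<zeta> * c) = 1 \<and> cmod (cnj (snd \<zeta> * d)) = 1"
    using c by (auto elim!: eventually_mono simp: torus2_def norm_mult)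
  show "\<zeta> = \<zeta>'" if "fst \<zeta> * c = fst \<zeta>' * c" "cnj (snd \<zeta> * d) = cnj (snd \<zeta>' * d)" for \<zeta> \<zeta>'
    using that c by (auto simp: prod_eq_iff)
  have eq: "(fst \<zeta> * c) ^ k * cnj (snd \<zeta> * d) ^ l = (c ^ k * cnj d ^ l) * (fst \<zeta> ^ k * cnj (snd \<zeta>) ^ l)" for \<zeta> k l
    by (simp add: power_mult_distrib algebra_simps)
  show "(\<integral>\<zeta>. (fst \<zeta> * c) ^ k * cnj (snd \<zeta> * d) ^ l \<partial>Mp) = (\<integral>\<zeta>. (fst \<zeta> * c) ^ k * cnj (snd \<zeta> * d) ^ l \<partial>Mn)"
    if "1 \<le> k" "1 \<le> l" for k l
    using RP_measure_moments[OF RP that] unfolding eq by (simp only: integral_mult_right_zero)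
qed (intro continuous_intros)+

theorem mainTheorem9:
  fixes \<psi> :: "real \<Rightarrow> real" and K :: "(complex \<times> complex) set"
    and Mp Mn :: "(complex \<times> complex) measure"
  assumes "strict_mono \<psi>"
    and "compact K"
    and "K \<subseteq> Phi ` {(x, \<psi> x) | x. True}"
    and "RP_measure Mp Mn"
  shows "total_variation Mp Mn K = 0"
proof -
  have KT: "K \<subseteq> torus2" using assms(3) by (auto simp: Phi_def torus2_def)
  \<comment> \<open>On an arc of parameter length 1 \<open>cis\<close> is injective and has a
    continuous inverse.\<close>
  define E where "E = cis ` {0..1}"
  define g where "g = the_inv_into {0..1} cis"
  have g: "g (cis t) = t" if "t \<in> {0..1}" for t
    unfolding g_def by (rule the_inv_into_f_f[OF inj_on_cis that])
  have gE: "g z \<in> {0..1}" "cis (g z) = z" if "z \<in> E" for z using that g by (auto simp: E_def)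
  have E: "compact E" unfolding E_def by (intro compact_continuous_image continuous_intros) auto
  have gc: "continuous_on E g" unfolding E_def
    by (rule continuous_on_inv) (use g in \<open>auto intro!: continuous_intros\<close>)
  define u where "u i \<zeta> = fst \<zeta> * cis (- real_of_int i)" for i :: int and \<zeta> :: "complex \<times> complex"
  define v where "v j \<zeta> = cnj (snd \<zeta> * cis (- real_of_int j))" for j :: int and \<zeta> :: "complex \<times> complex"
  define Z where "Z i j = K \<inter> (u i -` E \<inter> (\<lambda>\<zeta>. cnj (v j \<zeta>)) -` E)" for i j
  define x where "x i \<zeta> = g (u i \<zeta>)" for i \<zeta>
  define y where "y j \<zeta> = g (cnj (v j \<zeta>))" for j \<zeta>
  \<comment> \<open>\<open>Z i j\<close> may contain points whose parameter on the graph lies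
    elsewhere and differs by a multiple of \<open>2 * pi\<close>. The equation selects those given
    by the graph over the unit interval from \<open>i\<close>, with value in the one from
    \<open>j\<close>.\<close>
  define G where "G i j = {\<zeta> \<in> Z i j. \<psi> (of_int i + x i \<zeta>) = of_int j + y j \<zeta>}" for i j
  have uc: "continuous_on UNIV (u i)" and vc: "continuous_on UNIV (\<lambda>\<zeta>. cnj (v j \<zeta>))" for i j
    unfolding u_def v_def by (intro continuous_intros)+
  have Zc: "closed (Z i j)" for i j
    unfolding Z_def using E assms(2) uc[of i] vc[of j]
    by (intro closed_Int closed_vimage compact_imp_closed) auto
  have xc: "continuous_on (Z i j) (x i)" and yc: "continuous_on (Z i j) (y j)" for i j
    unfolding x_def y_def
    by (rule continuous_on_compose2[OF gc continuous_on_subset[OF uc]]; auto simp: Z_def)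
       (rule continuous_on_compose2[OF gc continuous_on_subset[OF vc]]; auto simp: Z_def)
  have Gnull: "emeasure Mp (G i j) = 0 \<and> emeasure Mn (G i j) = 0" and Gb: "G i j \<in> sets borel" for i j
  proof -
    interpret analytic_pair Mp Mn "u i" "v j"
      unfolding u_def v_def by (rule RP_measure_analytic_pair[OF assms(4)]) auto
    \<comment> \<open>A monotone function is Borel, which makes the pieces Borel though not
      necessarily closed; compact subsets of them are then tested.\<close>
    have [measurable]: "\<psi> \<in> borel_measurable borel"
      using assms(1) by (intro borel_measurable_mono strict_mono_mono)
    have Zb: "Z i j \<in> sets borel" using Zc by simp
    have [measurable]: "(\<lambda>\<zeta>. indicator (Z i j) \<zeta> *\<^sub>R x i \<zeta>) \<in> borel_measurable borel"
       "(\<lambda>\<zeta>. indicator (Z i j) \<zeta> *\<^sub>R y j \<zeta>) \<in> borel_measurable borel"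
      by (intro borel_measurable_continuous_on_indicator Zb xc yc)+
    have "G i j = Z i j \<inter> {\<zeta>. \<psi> (of_int i + indicator (Z i j) \<zeta> *\<^sub>R x i \<zeta>) = of_int j + indicator (Z i j) \<zeta> *\<^sub>R y j \<zeta>}"
      by (auto simp: G_def)
    also have "\<dots> \<in> sets borel"
    proof (rule sets.Int[OF Zb])
      have "Measurable.pred borel (\<lambda>\<zeta>. \<psi> (of_int i + indicator (Z i j) \<zeta> *\<^sub>R x i \<zeta>) = of_int j + indicator (Z i j) \<zeta> *\<^sub>R y j \<zeta>)"
        by measurable
      then show "{\<zeta>. \<psi> (of_int i + indicator (Z i j) \<zeta> *\<^sub>R x i \<zeta>) = of_int j + indicator (Z i j) \<zeta> *\<^sub>R y j \<zeta>} \<in> sets borel"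
        by (simp add: pred_def)
    qed
    finally show Gb: "G i j \<in> sets borel" .
    show "emeasure Mp (G i j) = 0 \<and> emeasure Mn (G i j) = 0"
    proof (rule null_if_compact_subsets_null[OF Gb])
      fix C assume C: "compact C" "C \<subseteq> G i j"
      then have CZ: "C \<subseteq> Z i j" by (auto simp: G_def)
      show "emeasure Mp C = 0 \<and> emeasure Mn C = 0"
      proof (rule null_increasing_graph[where x="x i" and y="y j"])
        show "C \<subseteq> W"
        proof
          fix \<zeta> assume "\<zeta> \<in> C"
          then have "\<zeta> \<in> torus2" using CZ KT by (auto simp: Z_def)
          then show "\<zeta> \<in> W" by (simp add: W_def u_def v_def torus2_def norm_mult)
        qed
        show "continuous_on C (x i)" "continuous_on C (y j)"
          using continuous_on_subset[OF xc CZ] continuous_on_subset[OF yc CZ] .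
        show "x i \<zeta> \<in> {0..1} \<and> y j \<zeta> \<in> {0..1} \<and> u i \<zeta> = cis (x i \<zeta>) \<and> v j \<zeta> = cis (- y j \<zeta>)" if "\<zeta> \<in> C" for \<zeta>
        proof -
          have uE: "u i \<zeta> \<in> E" and vE: "cnj (v j \<zeta>) \<in> E" using that CZ by (auto simp: Z_def)
          have "cis (- y j \<zeta>) = cnj (cis (y j \<zeta>))" by (simp add: cis_cnj)
          also have "\<dots> = v j \<zeta>" unfolding y_def gE(2)[OF vE] by simp
          finally show ?thesis using gE[OF uE] gE(1)[OF vE] by (simp only: x_def y_def)
        qed
        show "x i \<zeta> < x i \<zeta>' \<longleftrightarrow> y j \<zeta> < y j \<zeta>'" if "\<zeta> \<in> C" "\<zeta>' \<in> C" for \<zeta> \<zeta>'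
        proof -
          have "\<psi> (of_int i + x i \<zeta>) = of_int j + y j \<zeta>" "\<psi> (of_int i + x i \<zeta>') = of_int j + y j \<zeta>'"
            using that C(2) by (auto simp: G_def)
          then show ?thesis
            using strict_mono_less[OF assms(1), of "of_int i + x i \<zeta>" "of_int i + x i \<zeta>'"] by simp
        qed
      qed (rule C(1))
    qed
  qed
  have cover: "K \<subseteq> (\<Union>(i, j). G i j)"
  proof
    fix \<zeta> assume \<zeta>: "\<zeta> \<in> K"
    then obtain s where s: "\<zeta> = (cis s, cis (\<psi> s))" using assms(3) by (auto simp: Phi_def)
    define i j where "i = \<lfloor>s\<rfloor>" and "j = \<lfloor>\<psi> s\<rfloor>"
    have t: "s - of_int i \<in> {0..1}" "\<psi> s - of_int j \<in> {0..1}"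
      using floor_correct[of s] floor_correct[of "\<psi> s"] unfolding i_def j_def atLeastAtMost_iff
      by linarith+
    have uv: "u i \<zeta> = cis (s - of_int i)" "cnj (v j \<zeta>) = cis (\<psi> s - of_int j)"
      by (simp_all add: u_def v_def s cis_mult)
    have "x i \<zeta> = s - of_int i" "y j \<zeta> = \<psi> s - of_int j"
      unfolding x_def y_def uv using g t by auto
    moreover have "\<zeta> \<in> Z i j" using \<zeta> t by (auto simp: Z_def E_def uv)
    ultimately have "\<zeta> \<in> G i j" by (simp add: G_def)
    then show "\<zeta> \<in> (\<Union>(i, j). G i j)" by auto
  qed
  have null: "emeasure M K = 0" if s: "sets M = sets borel" and n: "\<And>i j. emeasure M (G i j) = 0" for M
  proof -
    have "(\<Union>(i, j). G i j) \<in> null_sets M"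
      using n Gb by (intro null_sets_UN) (auto simp: s null_sets_def)
    then have "K \<in> null_sets M"
      using cover compact_imp_closed[OF assms(2)] by (intro null_sets_subset[of _ M K]) (auto simp: s)
    then show ?thesis by (simp add: null_sets_def)
  qed
  have "sets Mp = sets borel" "sets Mn = sets borel"
    using assms(4) by (simp_all add: RP_measure_def real_measure_T2_def)
  then show ?thesis using null Gnull by (simp add: total_variation_def)
qed

end
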